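(* Let $A = kQ/I$ be a quadratic string algebra. Then $$\dim_k \mathrm{HH}^0(A) = \left| {}^{-}(Q_0 // \mathcal{P}_1)^{-} \right| + 1,$$ $$\dim_k \mathrm{HH}^1(A) = \begin{cases} \left| {}^{-}(0,0)^{-}_1 \right| + |Q_1| - |Q_0| + 1 & \text{if } \operatorname{char} k \neq 2,\\ \left| {}^{-}(0,0)^{-}_1 \right| + |Q_1| - |Q_0| + 1 + |\mathcal{G}_1| & \text{if } \operatorname{char} k = 2. \end{cases}$$
   Context: Let $k$ be an algebraically closed field and $Q=(Q_0,Q_1,s,t)$ a finite connected quiver. Paths are written $\alpha_1\cdots\alpha_l$ with $t(\alpha_i)=s(\alpha_{i+1})$; $e_x$ is the trivial path at a vertex $x$, with $s(e_x)=t(e_x)=x$, and $Q_0$ also denotes the set of trivial paths. For arrows $\alpha,\beta$, "$\alpha\beta\in I$" (resp. "$\alpha\beta\notin I$") means $t(\alpha)=s(\beta)$ and the path $\alpha\beta$ lies (resp. does not lie) in $I$. A quadratic string algebra is $A=kQ/I$ where $I$ is an admissible ideal of $kQ$ (so $F^m\subseteq I\subseteq F^2$ for some $m\ge 2$, $F$ the arrow ideal; in particular $A$ is finite dimensional) generated by paths of length two, such that: (S1) each vertex is the source of at most two arrows and the target of at most two arrows; (S2) for each arrow $\alpha$ there is at most one arrow $\beta$ with $\alpha\beta\notin I$ and at most one arrow $\gamma$ with $\gamma\alpha\notin I$. $\mathrm{HH}^n(A)=\mathrm{Ext}^n_{A-A}(A,A)$ is Hochschild cohomology. $\mathcal{P}$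 is the set of paths in $Q$ not in $I$ (their classes form a basis of $A$; it contains $Q_0\cup Q_1$), and $\mathcal{P}_m$ is the set of paths in $\mathcal{P}$ of length $\ge m$. For sets $X,Y$ of paths, $(X//Y)=\{(\rho,\gamma)\in X\times Y: s(\rho)=s(\gamma),\ t(\rho)=t(\gamma)\}$. $(0,0)_1$ is the set of $(\alpha,\gamma)\in (Q_1//\mathcal{P})$ such that the path $\gamma$ neither starts nor ends with the arrow $\alpha$. For any set $S$ of pairs $(\rho,\gamma)$ with $\gamma\in\mathcal P$: ${}^{-}S$ is the subset of those with $Q_1\gamma\subset I$ (no arrow $\beta$ such that $\beta\gamma$ is a path not in $I$), $S^{-}$ the subset of those with $\gamma Q_1\subset I$ (no arrow $\beta$ such that $\gamma\beta$ is a path not in $I$), and ${}^{-}S^{-}={}^{-}S\cap S^{-}$. $\mathcal{G}_1$ is the set of pairs $(\alpha, e_{s(\alpha)})$ where $\alpha$ is a loop with $\alpha\alpha\in I$ such that there is no arrow $\beta\ne\alpha$ with $\alpha\beta\in I$ and no arrow $\gamma\neq\alpha$ with $\gamma\alpha\in I$ (this is the case $n=1$ of the notion of gentle pair). *)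

theory Defs
  imports
    "Graph_Theory.Digraph_Component"
    "Graph_Theory.Arc_Walk"
    "HOL-Algebra.Ideal_Product"
    "HOL-Algebra.QuotRing"
    "HOL-Computational_Algebra.Polynomial"
    "Jordan_Normal_Form.VS_Connect"
begin

section \<open>Quotients\<close>

text \<open>
  Algebras over a field \<open>'k\<close> and vector spaces over \<open>'k\<close> are both records of type
  \<open>('k, 'a) module\<close>, with scalars in \<^term>\<open>class_ring\<close>. For a bare vector space \<open>R\<close> the fields
  \<open>mult\<close> and \<open>one\<close> of \<open>R\<close>, and hence those of the quotient, carry no meaning.
\<close>

definition quotient_module :: "('k, 'a) module \<Rightarrow> 'a set \<Rightarrow> ('k, 'a set) module" where
  "quotient_module R I =
     ring.extend (R Quot I) (module.fields (\<lambda>c X. I <+>\<^bsub>R\<^esub> (\<lambda>x. c \<odot>\<^bsub>R\<^esub> x) ` X))"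

section \<open>Bimodules and Ext\<close>

record ('k, 'a, 'm) bimodule = "('k, 'm) module" +
  lact :: "'a \<Rightarrow> 'm \<Rightarrow> 'm"
  ract :: "'m \<Rightarrow> 'a \<Rightarrow> 'm"

text \<open>
  Bimodules over a \<open>'k\<close>-algebra are understood to be \<open>'k\<close>-central, i.e.\ they are the modules over
  the enveloping algebra.
\<close>

locale bimodule = vectorspace "class_ring :: 'k ring" M
  for A :: "('k::field, 'a) module" and M :: "('k, 'a, 'm) bimodule" +
  assumes lact_closed:
      "a \<in> carrier A \<Longrightarrow> x \<in> carrier M \<Longrightarrow> lact M a x \<in> carrier M"
    and ract_closed:
      "a \<in> carrier A \<Longrightarrow> x \<in> carrier M \<Longrightarrow> ract M x a \<in> carrier M"
    and lact_add_left:
      "a \<in> carrier A \<Longrightarrow> b \<in> carrier A \<Longrightarrow> x \<in> carrier M \<Longrightarrow>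
        lact M (a \<oplus>\<^bsub>A\<^esub> b) x = lact M a x \<oplus>\<^bsub>M\<^esub> lact M b x"
    and lact_add_right:
      "a \<in> carrier A \<Longrightarrow> x \<in> carrier M \<Longrightarrow> y \<in> carrier M \<Longrightarrow>
        lact M a (x \<oplus>\<^bsub>M\<^esub> y) = lact M a x \<oplus>\<^bsub>M\<^esub> lact M a y"
    and ract_add_right:
      "a \<in> carrier A \<Longrightarrow> b \<in> carrier A \<Longrightarrow> x \<in> carrier M \<Longrightarrow>
        ract M x (a \<oplus>\<^bsub>A\<^esub> b) = ract M x a \<oplus>\<^bsub>M\<^esub> ract M x b"
    and ract_add_left:
      "a \<in> carrier A \<Longrightarrow> x \<in> carrier M \<Longrightarrow> y \<in> carrier M \<Longrightarrow>
        ract M (x \<oplus>\<^bsub>M\<^esub> y) a = ract M x a \<oplus>\<^bsub>M\<^esub> ract M y a"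
    and lact_smult_left:
      "a \<in> carrier A \<Longrightarrow> x \<in> carrier M \<Longrightarrow> lact M (c \<odot>\<^bsub>A\<^esub> a) x = c \<odot>\<^bsub>M\<^esub> lact M a x"
    and lact_smult_right:
      "a \<in> carrier A \<Longrightarrow> x \<in> carrier M \<Longrightarrow> lact M a (c \<odot>\<^bsub>M\<^esub> x) = c \<odot>\<^bsub>M\<^esub> lact M a x"
    and ract_smult_right:
      "a \<in> carrier A \<Longrightarrow> x \<in> carrier M \<Longrightarrow> ract M x (c \<odot>\<^bsub>A\<^esub> a) = c \<odot>\<^bsub>M\<^esub> ract M x a"
    and ract_smult_left:
      "a \<in> carrier A \<Longrightarrow> x \<in> carrier M \<Longrightarrow> ract M (c \<odot>\<^bsub>M\<^esub> x) a = c \<odot>\<^bsub>M\<^esub> ract M x a"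
    and lact_one: "x \<in> carrier M \<Longrightarrow> lact M \<one>\<^bsub>A\<^esub> x = x"
    and ract_one: "x \<in> carrier M \<Longrightarrow> ract M x \<one>\<^bsub>A\<^esub> = x"
    and lact_mult:
      "a \<in> carrier A \<Longrightarrow> b \<in> carrier A \<Longrightarrow> x \<in> carrier M \<Longrightarrow>
        lact M (a \<otimes>\<^bsub>A\<^esub> b) x = lact M a (lact M b x)"
    and ract_mult:
      "a \<in> carrier A \<Longrightarrow> b \<in> carrier A \<Longrightarrow> x \<in> carrier M \<Longrightarrow>
        ract M x (a \<otimes>\<^bsub>A\<^esub> b) = ract M (ract M x a) b"
    and lact_ract:
      "a \<in> carrier A \<Longrightarrow> b \<in> carrier A \<Longrightarrow> x \<in> carrier M \<Longrightarrow>
        ract M (lact M a x) b = lact M a (ract M x b)"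

definition regular_bimodule :: "('k, 'a) module \<Rightarrow> ('k, 'a, 'a) bimodule" where
  "regular_bimodule A = module.extend A (bimodule.fields (mult A) (mult A))"

definition bimodule_hom ::
  "('k, 'a) module \<Rightarrow> ('k, 'a, 'm) bimodule \<Rightarrow> ('k, 'a, 'n) bimodule \<Rightarrow> ('m \<Rightarrow> 'n) set" where
  "bimodule_hom A M N = {f \<in> carrier M \<rightarrow>\<^sub>E carrier N.
     (\<forall>x\<in>carrier M. \<forall>y\<in>carrier M. f (x \<oplus>\<^bsub>M\<^esub> y) = f x \<oplus>\<^bsub>N\<^esub> f y) \<and>
     (\<forall>c. \<forall>x\<in>carrier M. f (c \<odot>\<^bsub>M\<^esub> x) = c \<odot>\<^bsub>N\<^esub> f x) \<and>
     (\<forall>a\<in>carrier A. \<forall>x\<in>carrier M. f (lact M a x) = lact N a (f x)) \<and>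
     (\<forall>a\<in>carrier A. \<forall>x\<in>carrier M. f (ract M x a) = ract N (f x) a)}"

definition hom_space ::
  "('k, 'a) module \<Rightarrow> ('k, 'a, 'm) bimodule \<Rightarrow> ('k, 'a, 'n) bimodule \<Rightarrow> ('k, 'm \<Rightarrow> 'n) module" where
  "hom_space A M N =
     \<lparr>carrier = bimodule_hom A M N, mult = undefined, one = undefined,
      zero = (\<lambda>x\<in>carrier M. \<zero>\<^bsub>N\<^esub>),
      add = (\<lambda>f g. \<lambda>x\<in>carrier M. f x \<oplus>\<^bsub>N\<^esub> g x),
      smult = (\<lambda>c f. \<lambda>x\<in>carrier M. c \<odot>\<^bsub>N\<^esub> f x)\<rparr>"

text \<open>
  Projectivity is the lifting property against surjections of bimodules. A definition in HOL cannot
  quantify over the carrier types of the test bimodules, so one type is fixed. It is large enough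
  to give the usual notion: the elements of the free bimodule on the set \<^term>\<open>carrier P\<close> are finite
  sums of terms \<open>a \<otimes> p \<otimes> b\<close>, so by choosing one such expression for each element
  this free bimodule, and also \<open>P\<close> itself, has an isomorphic copy whose carrier is a set of lists of
  triples; lifting the identity of \<open>P\<close> along the canonical surjection exhibits \<open>P\<close> as a
  direct summand of a free bimodule.
\<close>

definition projective_bimodule ::
  "('k::field, 'a) module \<Rightarrow> ('k, 'a, 'm) bimodule \<Rightarrow> bool" where
  "projective_bimodule A P \<longleftrightarrow> bimodule A P \<and>
     (\<forall>(M :: ('k, 'a, ('a \<times> 'm \<times> 'a) list) bimodule) (N :: ('k, 'a, ('a \<times> 'm \<times> 'a) list) bimodule) g f.
        bimodule A M \<longrightarrow> bimodule A N \<longrightarrow>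
        g \<in> bimodule_hom A M N \<longrightarrow> g ` carrier M = carrier N \<longrightarrow>
        f \<in> bimodule_hom A P N \<longrightarrow>
        (\<exists>h\<in>bimodule_hom A P M. \<forall>x\<in>carrier P. g (h x) = f x))"

text \<open>
  A projective resolution \<open>\<dots> \<rightarrow> P 1 \<rightarrow> P 0 \<rightarrow> M \<rightarrow> 0\<close>, with \<open>d n\<close> from \<open>P (n + 1)\<close> to \<open>P n\<close>.
\<close>

definition projective_resolution ::
  "('k::field, 'a) module \<Rightarrow> ('k, 'a, 'n) bimodule \<Rightarrow>
   (nat \<Rightarrow> ('k, 'a, 'm) bimodule) \<Rightarrow> (nat \<Rightarrow> 'm \<Rightarrow> 'm) \<Rightarrow> ('m \<Rightarrow> 'n) \<Rightarrow> bool" where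
  "projective_resolution A M P d \<epsilon> \<longleftrightarrow>
     (\<forall>n. projective_bimodule A (P n)) \<and>
     (\<forall>n. d n \<in> bimodule_hom A (P (Suc n)) (P n)) \<and>
     \<epsilon> \<in> bimodule_hom A (P 0) M \<and>
     \<epsilon> ` carrier (P 0) = carrier M \<and>
     d 0 ` carrier (P (Suc 0)) = {x \<in> carrier (P 0). \<epsilon> x = \<zero>\<^bsub>M\<^esub>} \<and>
     (\<forall>n. d (Suc n) ` carrier (P (Suc (Suc n))) = {x \<in> carrier (P (Suc n)). d n x = \<zero>\<^bsub>P n\<^esub>})"

definition ext_cocycles ::
  "('k, 'a) module \<Rightarrow> (nat \<Rightarrow> ('k, 'a, 'm) bimodule) \<Rightarrow> (nat \<Rightarrow> 'm \<Rightarrow> 'm) \<Rightarrow>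
   ('k, 'a, 'n) bimodule \<Rightarrow> nat \<Rightarrow> ('m \<Rightarrow> 'n) set" where
  "ext_cocycles A P d N n =
     {f \<in> bimodule_hom A (P n) N. \<forall>x\<in>carrier (P (Suc n)). f (d n x) = \<zero>\<^bsub>N\<^esub>}"

fun ext_coboundaries ::
  "('k, 'a) module \<Rightarrow> (nat \<Rightarrow> ('k, 'a, 'm) bimodule) \<Rightarrow> (nat \<Rightarrow> 'm \<Rightarrow> 'm) \<Rightarrow>
   ('k, 'a, 'n) bimodule \<Rightarrow> nat \<Rightarrow> ('m \<Rightarrow> 'n) set" where
  "ext_coboundaries A P d N 0 = {\<lambda>x\<in>carrier (P 0). \<zero>\<^bsub>N\<^esub>}"
| "ext_coboundaries A P d N (Suc n) =
     (\<lambda>f. \<lambda>x\<in>carrier (P (Suc n)). f (d n x)) ` bimodule_hom A (P n) N"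

text \<open>
  If \<open>(P, d)\<close> is a projective resolution of \<open>M\<close>, this is the vector space \<open>Ext\<close> from \<open>M\<close> to \<open>N\<close> in
  degree \<open>n\<close> over the enveloping algebra of \<open>A\<close>: the cohomology of the complex \<open>Hom (P, N)\<close>.
\<close>

definition ext_space ::
  "('k, 'a) module \<Rightarrow> (nat \<Rightarrow> ('k, 'a, 'm) bimodule) \<Rightarrow> (nat \<Rightarrow> 'm \<Rightarrow> 'm) \<Rightarrow>
   ('k, 'a, 'n) bimodule \<Rightarrow> nat \<Rightarrow> ('k, ('m \<Rightarrow> 'n) set) module" where
  "ext_space A P d N n =
     quotient_module ((hom_space A (P n) N)\<lparr>carrier := ext_cocycles A P d N n\<rparr>)
       (ext_coboundaries A P d N n)"

text \<open>
  Hochschild cohomology of \<open>A\<close>, for \<open>(P, d)\<close> a projective resolution of \<^term>\<open>regular_bimodule A\<close>.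
\<close>

definition HH ::
  "('k, 'a) module \<Rightarrow> (nat \<Rightarrow> ('k, 'a, 'm) bimodule) \<Rightarrow> (nat \<Rightarrow> 'm \<Rightarrow> 'm) \<Rightarrow>
   nat \<Rightarrow> ('k, ('m \<Rightarrow> 'a) set) module" where
  "HH A P d n = ext_space A P d (regular_bimodule A) n"

section \<open>Quivers and path algebras\<close>

text \<open>
  A quiver is a directed multigraph. A path is represented by its source together with the list of
  its arrows in the order in which they are written, so \<open>(x, [])\<close> is the trivial path at \<open>x\<close>.
\<close>

type_synonym ('v, 'e) path = "'v \<times> 'e list"

definition src :: "('v, 'e) path \<Rightarrow> 'v" where
  "src p = fst p"

definition tgt :: "('v, 'e) pre_digraph \<Rightarrow> ('v, 'e) path \<Rightarrow> 'v" where
  "tgt Q p = last (pre_digraph.awalk_verts Q (fst p) (snd p))"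

definition paths :: "('v, 'e) pre_digraph \<Rightarrow> ('v, 'e) path set" where
  "paths Q = {p. pre_digraph.awalk Q (src p) (snd p) (tgt Q p)}"

definition trivial_paths :: "('v, 'e) pre_digraph \<Rightarrow> ('v, 'e) path set" where
  "trivial_paths Q = {p \<in> paths Q. length (snd p) = 0}"

definition arrow_paths :: "('v, 'e) pre_digraph \<Rightarrow> ('v, 'e) path set" where
  "arrow_paths Q = {p \<in> paths Q. length (snd p) = 1}"

text \<open>
  The path algebra consists of the finitely supported coefficient functions on paths. In the product,
  the coefficient at a path is the sum over all ways of cutting it into two pieces.
\<close>

definition path_algebra :: "('v, 'e) pre_digraph \<Rightarrow> ('k::field, ('v, 'e) path \<Rightarrow> 'k) module" where
  "path_algebra Q =
     \<lparr>carrier = {f. finite {p. f p \<noteq> 0} \<and> {p. f p \<noteq> 0} \<subseteq> paths Q},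
      mult = (\<lambda>f g (u, p). \<Sum>i\<le>length p. f (u, take i p) * g (tgt Q (u, take i p), drop i p)),
      one = (\<lambda>p. if p \<in> trivial_paths Q then 1 else 0),
      zero = (\<lambda>p. 0),
      add = (\<lambda>f g p. f p + g p),
      smult = (\<lambda>c f p. c * f p)\<rparr>"

definition path_elem :: "('v, 'e) path \<Rightarrow> ('v, 'e) path \<Rightarrow> 'k::field" where
  "path_elem p = (\<lambda>q. if q = p then 1 else 0)"

definition arrow_ideal :: "('v, 'e) pre_digraph \<Rightarrow> (('v, 'e) path \<Rightarrow> 'k::field) set" where
  "arrow_ideal Q = Idl\<^bsub>path_algebra Q\<^esub> (path_elem ` arrow_paths Q)"

fun ideal_power :: "('a, 'b) ring_scheme \<Rightarrow> 'a set \<Rightarrow> nat \<Rightarrow> 'a set" where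
  "ideal_power R J 0 = carrier R"
| "ideal_power R J (Suc n) = ideal_prod R (ideal_power R J n) J"

definition admissible_ideal ::
  "('v, 'e) pre_digraph \<Rightarrow> (('v, 'e) path \<Rightarrow> 'k::field) set \<Rightarrow> bool" where
  "admissible_ideal Q I \<longleftrightarrow> ideal I (path_algebra Q) \<and>
     (\<exists>m\<ge>2. ideal_power (path_algebra Q) (arrow_ideal Q) m \<subseteq> I) \<and>
     I \<subseteq> ideal_power (path_algebra Q) (arrow_ideal Q) 2"

definition bound_quiver_algebra ::
  "('v, 'e) pre_digraph \<Rightarrow> (('v, 'e) path \<Rightarrow> 'k::field) set \<Rightarrow>
   ('k, (('v, 'e) path \<Rightarrow> 'k) set) module" where
  "bound_quiver_algebra Q I = quotient_module (path_algebra Q) I"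

section \<open>Quadratic string algebras\<close>

text \<open>Composability of the two arrows is part of both predicates.\<close>

definition arrows_in ::
  "('v, 'e) pre_digraph \<Rightarrow> (('v, 'e) path \<Rightarrow> 'k::field) set \<Rightarrow> 'e \<Rightarrow> 'e \<Rightarrow> bool" where
  "arrows_in Q I \<alpha> \<beta> \<longleftrightarrow> head Q \<alpha> = tail Q \<beta> \<and> path_elem (tail Q \<alpha>, [\<alpha>, \<beta>]) \<in> I"

definition arrows_notin ::
  "('v, 'e) pre_digraph \<Rightarrow> (('v, 'e) path \<Rightarrow> 'k::field) set \<Rightarrow> 'e \<Rightarrow> 'e \<Rightarrow> bool" where
  "arrows_notin Q I \<alpha> \<beta> \<longleftrightarrow> head Q \<alpha> = tail Q \<beta> \<and> path_elem (tail Q \<alpha>, [\<alpha>, \<beta>]) \<notin> I"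

definition quadratic_string ::
  "('v, 'e) pre_digraph \<Rightarrow> (('v, 'e) path \<Rightarrow> 'k::field) set \<Rightarrow> bool" where
  "quadratic_string Q I \<longleftrightarrow>
     fin_digraph Q \<and> Digraph_Component.connected Q \<and>
     admissible_ideal Q I \<and>
     (\<exists>R \<subseteq> {p \<in> paths Q. length (snd p) = 2}. I = Idl\<^bsub>path_algebra Q\<^esub> (path_elem ` R)) \<and>
     (\<forall>x\<in>verts Q. out_degree Q x \<le> 2 \<and> in_degree Q x \<le> 2) \<and>
     (\<forall>\<alpha>\<in>arcs Q. card {\<beta> \<in> arcs Q. arrows_notin Q I \<alpha> \<beta>} \<le> 1 \<and>
                 card {\<gamma> \<in> arcs Q. arrows_notin Q I \<gamma> \<alpha>} \<le> 1)"

definition nonzero_paths ::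
  "('v, 'e) pre_digraph \<Rightarrow> (('v, 'e) path \<Rightarrow> 'k::field) set \<Rightarrow> ('v, 'e) path set" where
  "nonzero_paths Q I = {p \<in> paths Q. path_elem p \<notin> I}"

definition nonzero_paths_ge ::
  "('v, 'e) pre_digraph \<Rightarrow> (('v, 'e) path \<Rightarrow> 'k::field) set \<Rightarrow> nat \<Rightarrow> ('v, 'e) path set" where
  "nonzero_paths_ge Q I m = {p \<in> nonzero_paths Q I. m \<le> length (snd p)}"

text \<open>\<open>parallel Q X Y\<close> is \<open>(X // Y)\<close>.\<close>

definition parallel ::
  "('v, 'e) pre_digraph \<Rightarrow> ('v, 'e) path set \<Rightarrow> ('v, 'e) path set \<Rightarrow>
   (('v, 'e) path \<times> ('v, 'e) path) set" where
  "parallel Q X Y = {(\<rho>, \<gamma>) \<in> X \<times> Y. src \<rho> = src \<gamma> \<and> tgt Q \<rho> = tgt Q \<gamma>}"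

text \<open>The set \<open>(0,0)\<close> in degree \<open>1\<close>.\<close>

definition zero_zero_1 ::
  "('v, 'e) pre_digraph \<Rightarrow> (('v, 'e) path \<Rightarrow> 'k::field) set \<Rightarrow>
   (('v, 'e) path \<times> ('v, 'e) path) set" where
  "zero_zero_1 Q I = {(\<rho>, \<gamma>) \<in> parallel Q (arrow_paths Q) (nonzero_paths Q I).
     \<not> (\<exists>r. snd \<gamma> = snd \<rho> @ r) \<and> \<not> (\<exists>r. snd \<gamma> = r @ snd \<rho>)}"

text \<open>The decorations \<open>-S\<close> and \<open>S-\<close> on a set \<open>S\<close> of pairs of paths.\<close>

definition left_ann ::
  "('v, 'e) pre_digraph \<Rightarrow> (('v, 'e) path \<Rightarrow> 'k::field) set \<Rightarrow>
   (('v, 'e) path \<times> ('v, 'e) path) set \<Rightarrow> (('v, 'e) path \<times> ('v, 'e) path) set" where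
  "left_ann Q I S = {(\<rho>, \<gamma>) \<in> S.
     \<not> (\<exists>\<beta>\<in>arcs Q. head Q \<beta> = src \<gamma> \<and> path_elem (tail Q \<beta>, \<beta> # snd \<gamma>) \<notin> I)}"

definition right_ann ::
  "('v, 'e) pre_digraph \<Rightarrow> (('v, 'e) path \<Rightarrow> 'k::field) set \<Rightarrow>
   (('v, 'e) path \<times> ('v, 'e) path) set \<Rightarrow> (('v, 'e) path \<times> ('v, 'e) path) set" where
  "right_ann Q I S = {(\<rho>, \<gamma>) \<in> S.
     \<not> (\<exists>\<beta>\<in>arcs Q. tail Q \<beta> = tgt Q \<gamma> \<and> path_elem (src \<gamma>, snd \<gamma> @ [\<beta>]) \<notin> I)}"

definition both_ann ::
  "('v, 'e) pre_digraph \<Rightarrow> (('v, 'e) path \<Rightarrow> 'k::field) set \<Rightarrow>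
   (('v, 'e) path \<times> ('v, 'e) path) set \<Rightarrow> (('v, 'e) path \<times> ('v, 'e) path) set" where
  "both_ann Q I S = left_ann Q I S \<inter> right_ann Q I S"

definition gentle_pairs_1 ::
  "('v, 'e) pre_digraph \<Rightarrow> (('v, 'e) path \<Rightarrow> 'k::field) set \<Rightarrow>
   (('v, 'e) path \<times> ('v, 'e) path) set" where
  "gentle_pairs_1 Q I = {((tail Q \<alpha>, [\<alpha>]), (tail Q \<alpha>, [])) | \<alpha>.
     \<alpha> \<in> arcs Q \<and> arrows_in Q I \<alpha> \<alpha> \<and>
     \<not> (\<exists>\<beta>\<in>arcs Q. \<beta> \<noteq> \<alpha> \<and> arrows_in Q I \<alpha> \<beta>) \<and>
     \<not> (\<exists>\<gamma>\<in>arcs Q. \<gamma> \<noteq> \<alpha> \<and> arrows_in Q I \<gamma> \<alpha>)}"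

end

theory Submission
  imports Defs
begin

text \<open>
  Three facts combine to give the dimensions.

  \<^bold>\<open>Degrees 0 and 1 for an arbitrary algebra.\<close> Let \<open>P\<close> be a projective resolution of an algebra \<open>A\<close> over
  its enveloping algebra, with augmentation \<open>\<epsilon>\<close>, and choose \<open>p\<close> in \<open>P 0\<close> with \<open>\<epsilon> p = 1\<close>. A 0-cocycle
  \<open>f\<close> is determined by the central element \<open>f p\<close>. A 1-cocycle \<open>f\<close> gives a derivation
  \<open>a \<mapsto> f q\<close>, where \<open>q\<close> is any element with boundary \<open>a p - p a\<close>. If this derivation is \<open>a \<mapsto> a u - u a\<close>,
  then \<open>f\<close> is the coboundary of \<open>x \<mapsto> f q + \<epsilon> x u\<close> with \<open>q\<close> now a lift of \<open>x - \<epsilon> x p\<close>. Conversely, a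
  derivation \<open>D\<close> twists the right action on \<open>A \<oplus> A\<close> so as to make it an extension of \<open>A\<close> by \<open>A\<close>;
  projectivity of \<open>P 0\<close> lifts \<open>\<epsilon>\<close> to it, and the second component of the lift restricts to a
  1-cocycle that realises \<open>D\<close> up to an inner derivation. So degree 0 is the centre and degree 1 is
  derivations modulo inner derivations, whatever the resolution is.

  \<^bold>\<open>A basis.\<close> The ideal is spanned by the paths that contain one of the generating relations,
  so the other paths form a basis of the algebra, and a path is nonzero as soon as
  any two consecutive arrows of it have nonzero product. As there are only finitely many nonzero paths,
  no word in the arrows is nonzero together with all its powers. In particular a
  nonzero path of length at least two does not begin and end with the same arrow.

  \<^bold>\<open>Coefficients.\<close> A central element has the same coefficient at all vertices, because the quiver is
  connected, and its other coefficients sit at cycles that no arrow prolongs.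
  A derivation can be changed by an inner one so as to vanish at the vertices; it is then given by its
  coefficients at pairs of an arrow \<open>\<alpha>\<close> and a parallel nonzero path \<open>\<gamma>\<close>, subject to the Leibniz rule for
  each zero product \<open>\<alpha>\<beta>\<close>. There are four kinds of pairs.
  \<^item> If \<open>\<gamma>\<close> is nontrivial and neither starts nor ends with \<open>\<alpha>\<close>, the rule forces the coefficient to
    vanish exactly when some arrow prolongs \<open>\<gamma>\<close>; this uses the uniqueness of nonzero prolongations.
  \<^item> If \<open>\<gamma> = \<alpha>\<delta>\<close> or \<open>\<gamma> = \<delta>\<alpha>\<close> with \<open>\<delta>\<close> a nontrivial cycle, the coefficient is removed by the commutator
    with a multiple of \<open>\<delta>\<close>. Should \<open>\<delta>\<close> be prolonged on both sides, the rule makes the two demands agree.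
  \<^item> The coefficients at \<open>\<gamma> = \<alpha>\<close> form a function on the arrows, and combinations of vertices change it by
    the differences of a potential. Modulo these it can be made to vanish on a spanning tree, which
    leaves \<open>|Q\<^sub>1| - |Q\<^sub>0| + 1\<close> free values.
  \<^item> If \<open>\<gamma>\<close> is trivial then \<open>\<alpha>\<close> is a loop, and the rule for \<open>\<alpha>\<alpha> = 0\<close> says that twice the coefficient is zero.
    In characteristic two the remaining rules leave exactly the gentle pairs.

  The surviving coefficients can be prescribed arbitrarily, and distinct choices differ by an outer
  derivation.
\<close>

section \<open>Vector spaces given by coordinates\<close>

definition coords :: "'s set \<Rightarrow> ('s \<Rightarrow> 'k::zero) set" where
  "coords S = {c. \<forall>s. s \<notin> S \<longrightarrow> c s = 0}"

lemma coords_outside: "c \<in> coords S \<Longrightarrow> s \<notin> S \<Longrightarrow> c s = 0"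
  by (simp add: coords_def)

lemma coords_zero: "(\<lambda>s. 0) \<in> coords S"
  and coords_add: "c \<in> coords S \<Longrightarrow> c' \<in> coords S \<Longrightarrow> (\<lambda>s. c s + c' s :: 'k::field) \<in> coords S"
  and coords_smult: "c \<in> coords S \<Longrightarrow> (\<lambda>s. r * c s :: 'k::field) \<in> coords S"
  by (auto simp: coords_def)

context
  fixes V :: "('k::field, 'v, 'z) module_scheme" and S :: "'s set" and \<phi> :: "('s \<Rightarrow> 'k) \<Rightarrow> 'v"
  assumes S: "finite S"
    and bij: "bij_betw \<phi> (coords S) (carrier V)"
    and add: "\<And>c c'. c \<in> coords S \<Longrightarrow> c' \<in> coords S \<Longrightarrow> \<phi> c \<oplus>\<^bsub>V\<^esub> \<phi> c' = \<phi> (\<lambda>s. c s + c' s)"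
    and smult: "\<And>r c. c \<in> coords S \<Longrightarrow> r \<odot>\<^bsub>V\<^esub> \<phi> c = \<phi> (\<lambda>s. r * c s)"
    and zero: "\<zero>\<^bsub>V\<^esub> = \<phi> (\<lambda>s. 0)"
begin

text \<open>
  Coordinates transport the whole structure: every vector space axiom for \<open>V\<close> is a pointwise identity
  between coefficient functions, and none has to be checked for \<open>V\<close> itself.
\<close>

lemma vectorspace_by_coordinates: "vectorspace class_ring V"
proof -
  have ex: "\<exists>c\<in>coords S. x = \<phi> c" if "x \<in> carrier V" for x
    using bij that by (auto simp: bij_betw_def)
  have cl: "\<phi> c \<in> carrier V" if "c \<in> coords S" for c
    using bij that by (auto simp: bij_betw_def)
  note cs = coords_zero coords_add coords_smult
  have "abelian_group V"
  proof (rule abelian_groupI)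
    fix x assume "x \<in> carrier V"
    then obtain c where c: "c \<in> coords S" "x = \<phi> c" using ex by blast
    have "\<phi> (\<lambda>s. - 1 * c s) \<oplus>\<^bsub>V\<^esub> x = \<zero>\<^bsub>V\<^esub>"
      using c cs(3)[OF c(1), of "-1"] by (simp add: add zero)
    thus "\<exists>y\<in>carrier V. y \<oplus>\<^bsub>V\<^esub> x = \<zero>\<^bsub>V\<^esub>" using cl cs(3)[OF c(1)] by blast
  qed (auto dest!: ex simp: add zero cs cl algebra_simps)
  moreover have "cring (class_ring :: 'k ring)"
    using class_field field_def domain_def by blast
  ultimately have "module class_ring V"
    by (intro moduleI) (auto dest!: ex simp: add smult cs cl algebra_simps)
  thus ?thesis by (simp add: vectorspace_def class_field)
qed

lemma dim_by_coordinates: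
  "vectorspace.fin_dim class_ring V" "vectorspace.dim class_ring V = card S"
proof -
  let ?n = "card S"
  obtain h where h: "bij_betw h S {0..<?n}" using S ex_bij_betw_finite_nat by blast
  define of_vec where "of_vec v = (\<lambda>s. if s \<in> S then v $ h s else (0::'k))" for v :: "'k vec"
  have hn: "h s < ?n" if "s \<in> S" for s using h that by (auto simp: bij_betw_def)
  have of_vec_coords: "of_vec v \<in> coords S" for v by (auto simp: of_vec_def coords_def)
  have of_vec_bij: "bij_betw of_vec (carrier_vec ?n) (coords S)"
  proof (rule bij_betwI')
    fix v w :: "'k vec" assume v: "v \<in> carrier_vec ?n" and w: "w \<in> carrier_vec ?n"
    show "of_vec v = of_vec w \<longleftrightarrow> v = w"
    proof
      assume eq: "of_vec v = of_vec w"
      show "v = w"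
      proof (rule eq_vecI)
        fix i assume i: "i < dim_vec w"
        then obtain s where s: "s \<in> S" "h s = i" using h w
          by (metis atLeastLessThan_iff bij_betw_iff_bijections carrier_vecD le0)
        show "v $ i = w $ i" using fun_cong[OF eq, of s] s by (simp add: of_vec_def)
      qed (use v w in auto)
    qed simp
  next
    fix c :: "'s \<Rightarrow> 'k" assume c: "c \<in> coords S"
    have "c = of_vec (Matrix.vec ?n (\<lambda>i. c (inv_into S h i)))"
      using h hn c by (auto simp: of_vec_def coords_def bij_betw_def inv_into_f_f fun_eq_iff)
    thus "\<exists>v\<in>carrier_vec ?n. c = of_vec v" using vec_carrier by blast
  qed (rule of_vec_coords)
  have T: "bij_betw (\<phi> \<circ> of_vec) (carrier_vec ?n) (carrier V)"
    by (rule bij_betw_trans[OF of_vec_bij bij])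
  interpret N: vec_space "TYPE('k)" ?n .
  interpret V: vectorspace class_ring V by (rule vectorspace_by_coordinates)
  have "(\<phi> \<circ> of_vec) \<in> module_hom class_ring (module_vec TYPE('k) ?n) V"
  proof -
    have "\<phi> (of_vec (v + w)) = \<phi> (of_vec v) \<oplus>\<^bsub>V\<^esub> \<phi> (of_vec w)"
      if "v \<in> carrier_vec ?n" "w \<in> carrier_vec ?n" for v w
    proof -
      have "of_vec (v + w) = (\<lambda>s. of_vec v s + of_vec w s)"
        using that hn by (auto simp: of_vec_def fun_eq_iff)
      thus ?thesis by (simp add: add of_vec_coords)
    qed
    moreover have "\<phi> (of_vec (r \<cdot>\<^sub>v v)) = r \<odot>\<^bsub>V\<^esub> \<phi> (of_vec v)" if "v \<in> carrier_vec ?n" for r v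
    proof -
      have "of_vec (r \<cdot>\<^sub>v v) = (\<lambda>s. r * of_vec v s)"
        using that hn by (auto simp: of_vec_def fun_eq_iff)
      thus ?thesis by (simp add: smult of_vec_coords)
    qed
    ultimately show ?thesis using T
      by (auto simp: module_hom_def module_vec_simps bij_betw_def)
  qed
  hence "linear_map class_ring (module_vec TYPE('k) ?n) V (\<phi> \<circ> of_vec)"
    unfolding linear_map_def mod_hom_def mod_hom_axioms_def
    using N.vectorspace_axioms N.module_axioms V.vectorspace_axioms V.module_axioms by blast
  then interpret T: linear_map class_ring "module_vec TYPE('k) ?n" V "\<phi> \<circ> of_vec" .
  have img: "(\<phi> \<circ> of_vec) ` carrier (module_vec TYPE('k) ?n) = carrier V"
    and inj: "inj_on (\<phi> \<circ> of_vec) (carrier (module_vec TYPE('k) ?n))"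
    using T by (auto simp: bij_betw_def module_vec_simps)
  show "V.fin_dim" by (rule T.surj_fin_dim[OF N.fin_dim img])
  show "V.dim = card S" using T.dim_eq[OF N.fin_dim inj img] N.dim_is_n by simp
qed

end

text \<open>
  A cohomology group is a quotient of cocycles, and the normal form of a cocycle is unique while the
  coboundary that brings it there is not. So coordinates enter as a linear relation \<open>R z c\<close>, to be read as
  ``\<open>z\<close> is cohomologous to the cocycle with coordinates \<open>c\<close>'', and linearity needs no
  linear choice of normal forms. The cosets of \<open>B\<close> are the fibres of \<open>R\<close>.
\<close>

lemma quotient_by_linear_relation:
  fixes Z :: "('k::field, 'v) module" and S :: "'s set" and R :: "'v \<Rightarrow> ('s \<Rightarrow> 'k) \<Rightarrow> bool"
  assumes S: "finite S"
    and Z: "vectorspace class_ring Z"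
    and R_add: "\<And>z c z' c'. z \<in> carrier Z \<Longrightarrow> z' \<in> carrier Z \<Longrightarrow> R z c \<Longrightarrow> R z' c' \<Longrightarrow>
                  R (z \<oplus>\<^bsub>Z\<^esub> z') (\<lambda>s. c s + c' s)"
    and R_smult: "\<And>r z c. z \<in> carrier Z \<Longrightarrow> R z c \<Longrightarrow> R (r \<odot>\<^bsub>Z\<^esub> z) (\<lambda>s. r * c s)"
    and R_total: "\<And>z. z \<in> carrier Z \<Longrightarrow> \<exists>c\<in>coords S. R z c"
    and R_surj: "\<And>c. c \<in> coords S \<Longrightarrow> \<exists>z\<in>carrier Z. R z c"
    and R_kernel: "\<And>z. z \<in> carrier Z \<Longrightarrow> R z (\<lambda>s. 0) \<longleftrightarrow> z \<in> B"
    and R_unique: "\<And>c. c \<in> coords S \<Longrightarrow> R \<zero>\<^bsub>Z\<^esub> c \<Longrightarrow> c = (\<lambda>s. 0)"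
    and B: "B \<subseteq> carrier Z"
  shows "vectorspace.fin_dim class_ring (quotient_module Z B) \<and>
    vectorspace.dim class_ring (quotient_module Z B) = card S"
proof -
  interpret Z: vectorspace class_ring Z by fact
  have Z_smult: "r \<odot>\<^bsub>Z\<^esub> z \<in> carrier Z" if "z \<in> carrier Z" for r z
    using Z.smult_closed that by simp
  have R_neg: "R (\<ominus>\<^bsub>Z\<^esub> z) (\<lambda>s. - c s)" if "z \<in> carrier Z" "R z c" for z c
  proof -
    have "\<ominus>\<^bsub>(class_ring :: 'k ring)\<^esub> \<one>\<^bsub>class_ring\<^esub> = - 1"
      by (simp add: class_ring_simps)
    hence "\<ominus>\<^bsub>Z\<^esub> z = (- 1) \<odot>\<^bsub>Z\<^esub> z" using Z.smult_minus_1[OF that(1)] by simp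
    thus ?thesis using R_smult[OF that, of "- 1"] by simp
  qed
  let ?V = "quotient_module Z B"
  define \<phi> where "\<phi> c = {z \<in> carrier Z. R z c}" for c
  note cs = coords_zero coords_add coords_smult
  have R_fun: "c = c'" if "z \<in> carrier Z" "R z c" "R z c'" "c \<in> coords S" "c' \<in> coords S" for z c c'
  proof -
    have "R (z \<oplus>\<^bsub>Z\<^esub> \<ominus>\<^bsub>Z\<^esub> z) (\<lambda>s. c s + - c' s)" using that by (intro R_add R_neg) auto
    hence "R \<zero>\<^bsub>Z\<^esub> (\<lambda>s. c s + - c' s)" using that by (simp add: Z.M.r_neg)
    moreover have "(\<lambda>s. c s + - c' s) \<in> coords S" using that by (auto simp: coords_def)
    ultimately have "(\<lambda>s. c s + - c' s) = (\<lambda>s. 0)" using R_unique by blast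
    thus ?thesis by (auto simp: fun_eq_iff)
  qed
  have coset: "B +>\<^bsub>Z\<^esub> z = \<phi> c" if z: "z \<in> carrier Z" "R z c" for z c
  proof
    show "B +>\<^bsub>Z\<^esub> z \<subseteq> \<phi> c"
    proof
      fix x assume "x \<in> B +>\<^bsub>Z\<^esub> z"
      then obtain b where b: "b \<in> B" "x = b \<oplus>\<^bsub>Z\<^esub> z" by (auto simp: a_r_coset_def')
      have bZ: "b \<in> carrier Z" using b B by blast
      hence "R b (\<lambda>s. 0)" using R_kernel b by blast
      from R_add[OF bZ z(1) this z(2)] show "x \<in> \<phi> c" using b bZ z by (simp add: \<phi>_def)
    qed
    show "\<phi> c \<subseteq> B +>\<^bsub>Z\<^esub> z"
    proof
      fix x assume "x \<in> \<phi> c"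
      hence x: "x \<in> carrier Z" "R x c" by (auto simp: \<phi>_def)
      have "R (x \<oplus>\<^bsub>Z\<^esub> \<ominus>\<^bsub>Z\<^esub> z) (\<lambda>s. c s + - c s)" using x z by (intro R_add R_neg) auto
      hence "x \<oplus>\<^bsub>Z\<^esub> \<ominus>\<^bsub>Z\<^esub> z \<in> B" using R_kernel x z by simp
      moreover have "x = (x \<oplus>\<^bsub>Z\<^esub> \<ominus>\<^bsub>Z\<^esub> z) \<oplus>\<^bsub>Z\<^esub> z" using x z by (simp add: Z.M.a_assoc Z.M.l_neg)
      ultimately show "x \<in> B +>\<^bsub>Z\<^esub> z" by (auto simp: a_r_coset_def')
    qed
  qed
  have carr: "carrier ?V = \<phi> ` coords S"
  proof -
    have "carrier ?V = (\<lambda>z. B +>\<^bsub>Z\<^esub> z) ` carrier Z"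
      by (auto simp: quotient_module_def ring.defs module.defs FactRing_def A_RCOSETS_def')
    also have "\<dots> = \<phi> ` coords S"
      using coset R_total R_surj by (auto simp: image_iff) metis+
    finally show ?thesis .
  qed
  have \<phi>_ne: "\<exists>z\<in>carrier Z. R z c \<and> \<phi> c = B +>\<^bsub>Z\<^esub> z" if "c \<in> coords S" for c
    using R_surj[OF that] coset by metis
  have inj: "inj_on \<phi> (coords S)"
  proof (rule inj_onI)
    fix c c' assume c: "c \<in> coords S" "c' \<in> coords S" "\<phi> c = \<phi> c'"
    then obtain z where "z \<in> \<phi> c" using R_surj by (auto simp: \<phi>_def)
    thus "c = c'" using c R_fun by (auto simp: \<phi>_def)
  qed
  have set_add_coset: "\<phi> c <+>\<^bsub>Z\<^esub> \<phi> c' = \<phi> (\<lambda>s. c s + c' s)" if c: "c \<in> coords S" "c' \<in> coords S" for c c'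
  proof
    show "\<phi> c <+>\<^bsub>Z\<^esub> \<phi> c' \<subseteq> \<phi> (\<lambda>s. c s + c' s)"
      using R_add by (auto simp: set_add_def' \<phi>_def)
    obtain z' where z': "z' \<in> carrier Z" "R z' c'" using R_surj c by blast
    show "\<phi> (\<lambda>s. c s + c' s) \<subseteq> \<phi> c <+>\<^bsub>Z\<^esub> \<phi> c'"
    proof
      fix x assume "x \<in> \<phi> (\<lambda>s. c s + c' s)"
      hence x: "x \<in> carrier Z" "R x (\<lambda>s. c s + c' s)" by (auto simp: \<phi>_def)
      have "R (x \<oplus>\<^bsub>Z\<^esub> \<ominus>\<^bsub>Z\<^esub> z') (\<lambda>s. c s + c' s + - c' s)" using x z' by (intro R_add R_neg) auto
      hence "x \<oplus>\<^bsub>Z\<^esub> \<ominus>\<^bsub>Z\<^esub> z' \<in> \<phi> c" using x z' by (simp add: \<phi>_def)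
      moreover have "z' \<in> \<phi> c'" using z' by (simp add: \<phi>_def)
      moreover have "x = (x \<oplus>\<^bsub>Z\<^esub> \<ominus>\<^bsub>Z\<^esub> z') \<oplus>\<^bsub>Z\<^esub> z'" using x z' by (simp add: Z.M.a_assoc Z.M.l_neg)
      ultimately show "x \<in> \<phi> c <+>\<^bsub>Z\<^esub> \<phi> c'" unfolding set_add_def' by blast
    qed
  qed
  have B0: "B = \<phi> (\<lambda>s. 0)" using R_kernel B by (auto simp: \<phi>_def)
  have bij: "bij_betw \<phi> (coords S) (carrier ?V)" using inj carr by (simp add: bij_betw_def)
  have add: "\<phi> c \<oplus>\<^bsub>?V\<^esub> \<phi> c' = \<phi> (\<lambda>s. c s + c' s)" if "c \<in> coords S" "c' \<in> coords S" for c c'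
    using set_add_coset[OF that] by (simp add: quotient_module_def ring.defs module.defs FactRing_def)
  have smult: "r \<odot>\<^bsub>?V\<^esub> \<phi> c = \<phi> (\<lambda>s. r * c s)" if c: "c \<in> coords S" for r c
  proof -
    have "B <+>\<^bsub>Z\<^esub> (\<lambda>x. r \<odot>\<^bsub>Z\<^esub> x) ` \<phi> c = \<phi> (\<lambda>s. r * c s)"
    proof
      show "B <+>\<^bsub>Z\<^esub> (\<lambda>x. r \<odot>\<^bsub>Z\<^esub> x) ` \<phi> c \<subseteq> \<phi> (\<lambda>s. r * c s)"
      proof
        fix x assume "x \<in> B <+>\<^bsub>Z\<^esub> (\<lambda>x. r \<odot>\<^bsub>Z\<^esub> x) ` \<phi> c"
        then obtain b z where bz: "b \<in> B" "z \<in> carrier Z" "R z c" "x = b \<oplus>\<^bsub>Z\<^esub> (r \<odot>\<^bsub>Z\<^esub> z)"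
          by (auto simp: set_add_def' \<phi>_def)
        have "b \<in> carrier Z" "R b (\<lambda>s. 0)" using bz R_kernel B by auto
        from R_add[OF this(1) Z_smult this(2) R_smult] show "x \<in> \<phi> (\<lambda>s. r * c s)"
          using bz \<open>b \<in> carrier Z\<close> Z_smult by (simp add: \<phi>_def)
      qed
      obtain z where z: "z \<in> carrier Z" "R z c" using R_surj c by blast
      have rz: "r \<odot>\<^bsub>Z\<^esub> z \<in> carrier Z" "R (r \<odot>\<^bsub>Z\<^esub> z) (\<lambda>s. r * c s)" using z Z_smult R_smult by auto
      show "\<phi> (\<lambda>s. r * c s) \<subseteq> B <+>\<^bsub>Z\<^esub> (\<lambda>x. r \<odot>\<^bsub>Z\<^esub> x) ` \<phi> c"
        using z by (auto simp: coset[OF rz, symmetric] a_r_coset_def' set_add_def' \<phi>_def)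
    qed
    thus ?thesis by (simp add: quotient_module_def ring.defs module.defs)
  qed
  have zero: "\<zero>\<^bsub>?V\<^esub> = \<phi> (\<lambda>s. 0)"
    using B0 by (simp add: quotient_module_def ring.defs module.defs FactRing_def)
  show "vectorspace.fin_dim class_ring ?V \<and> vectorspace.dim class_ring ?V = card S"
    using dim_by_coordinates[OF S bij add smult zero] by blast+
qed

section \<open>Bimodules\<close>

lemma regular_bimodule_simps [simp]:
  "carrier (regular_bimodule A) = carrier A"
  "add (regular_bimodule A) = add A"
  "zero (regular_bimodule A) = zero A"
  "module.smult (regular_bimodule A) = module.smult A"
  "lact (regular_bimodule A) = monoid.mult A"
  "ract (regular_bimodule A) = monoid.mult A"
  by (simp_all add: regular_bimodule_def module.defs bimodule.defs)

lemma a_inv_cong: "carrier M = carrier N \<Longrightarrow> add M = add N \<Longrightarrow> zero M = zero N \<Longrightarrow> a_inv M x = a_inv N x"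
  by (simp add: a_inv_def m_inv_def)

text \<open>
  Scaling by \<open>- 1\<close> provides the additive inverses, so that all closure conditions concern addition
  and scaling only.
\<close>

lemma vectorspaceI:
  fixes V :: "('k::field, 'v, 'z) module_scheme"
  assumes "\<And>x y. x \<in> carrier V \<Longrightarrow> y \<in> carrier V \<Longrightarrow> x \<oplus>\<^bsub>V\<^esub> y \<in> carrier V"
    and "\<zero>\<^bsub>V\<^esub> \<in> carrier V"
    and "\<And>x y z. x \<in> carrier V \<Longrightarrow> y \<in> carrier V \<Longrightarrow> z \<in> carrier V \<Longrightarrow>
           (x \<oplus>\<^bsub>V\<^esub> y) \<oplus>\<^bsub>V\<^esub> z = x \<oplus>\<^bsub>V\<^esub> (y \<oplus>\<^bsub>V\<^esub> z)"
    and "\<And>x y. x \<in> carrier V \<Longrightarrow> y \<in> carrier V \<Longrightarrow> x \<oplus>\<^bsub>V\<^esub> y = y \<oplus>\<^bsub>V\<^esub> x"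
    and "\<And>x. x \<in> carrier V \<Longrightarrow> \<zero>\<^bsub>V\<^esub> \<oplus>\<^bsub>V\<^esub> x = x"
    and "\<And>x. x \<in> carrier V \<Longrightarrow> (- 1) \<odot>\<^bsub>V\<^esub> x \<oplus>\<^bsub>V\<^esub> x = \<zero>\<^bsub>V\<^esub>"
    and "\<And>c x. x \<in> carrier V \<Longrightarrow> c \<odot>\<^bsub>V\<^esub> x \<in> carrier V"
    and "\<And>a b x. x \<in> carrier V \<Longrightarrow> (a + b) \<odot>\<^bsub>V\<^esub> x = a \<odot>\<^bsub>V\<^esub> x \<oplus>\<^bsub>V\<^esub> b \<odot>\<^bsub>V\<^esub> x"
    and "\<And>a x y. x \<in> carrier V \<Longrightarrow> y \<in> carrier V \<Longrightarrow>
           a \<odot>\<^bsub>V\<^esub> (x \<oplus>\<^bsub>V\<^esub> y) = a \<odot>\<^bsub>V\<^esub> x \<oplus>\<^bsub>V\<^esub> a \<odot>\<^bsub>V\<^esub> y"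
    and "\<And>a b x. x \<in> carrier V \<Longrightarrow> (a * b) \<odot>\<^bsub>V\<^esub> x = a \<odot>\<^bsub>V\<^esub> (b \<odot>\<^bsub>V\<^esub> x)"
    and "\<And>x. x \<in> carrier V \<Longrightarrow> 1 \<odot>\<^bsub>V\<^esub> x = x"
  shows "vectorspace class_ring V"
proof -
  have "abelian_group V"
  proof (rule abelian_groupI)
    fix x assume "x \<in> carrier V"
    thus "\<exists>y\<in>carrier V. y \<oplus>\<^bsub>V\<^esub> x = \<zero>\<^bsub>V\<^esub>" using assms(6,7) by blast
  qed (use assms in auto)
  moreover have "cring (class_ring :: 'k ring)"
    using class_field field_def domain_def by blast
  ultimately have "module class_ring V"
    by (intro moduleI) (use assms in auto)
  thus ?thesis by (simp add: vectorspace_def class_field)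
qed

lemma (in abelian_group) minus_minus_cancel:
  assumes "x \<in> carrier G" "y \<in> carrier G" "z \<in> carrier G"
  shows "(x \<ominus> y) \<ominus> (z \<ominus> y) = x \<ominus> z"
  using assms by (simp add: a_minus_def minus_add a_ac r_neg1 r_neg2)

lemma (in abelian_group) minus_add_minus:
  assumes "x \<in> carrier G" "y \<in> carrier G" "z \<in> carrier G"
  shows "(x \<ominus> y) \<oplus> (y \<ominus> z) = x \<ominus> z"
  using assms by (simp add: a_minus_def minus_add a_ac r_neg1 r_neg2)

lemma (in abelian_group) minus_eq_zero_iff:
  assumes "x \<in> carrier G" "y \<in> carrier G"
  shows "x \<ominus> y = \<zero> \<longleftrightarrow> x = y"
proof
  assume "x \<ominus> y = \<zero>"
  hence "\<ominus> (\<ominus> y) = x" using assms by (intro minus_equality) (auto simp: a_minus_def)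
  thus "x = y" using assms by simp
qed (use assms in \<open>simp add: a_minus_def r_neg\<close>)

lemma (in abelian_group) add_minus_add:
  assumes "x \<in> carrier G" "y \<in> carrier G" "z \<in> carrier G" "w \<in> carrier G"
  shows "(x \<oplus> y) \<ominus> (z \<oplus> w) = (x \<ominus> z) \<oplus> (y \<ominus> w)"
  using assms by (simp add: a_minus_def minus_add a_ac)

context bimodule
begin

lemma scale_closed [simp]: "x \<in> carrier M \<Longrightarrow> c \<odot>\<^bsub>M\<^esub> x \<in> carrier M"
  using smult_closed by simp

lemma scale_add: "x \<in> carrier M \<Longrightarrow> y \<in> carrier M \<Longrightarrow> c \<odot>\<^bsub>M\<^esub> (x \<oplus>\<^bsub>M\<^esub> y) = c \<odot>\<^bsub>M\<^esub> x \<oplus>\<^bsub>M\<^esub> c \<odot>\<^bsub>M\<^esub> y"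
  using smult_r_distr by simp

lemma scale_minus_1: "x \<in> carrier M \<Longrightarrow> (- 1) \<odot>\<^bsub>M\<^esub> x = \<ominus>\<^bsub>M\<^esub> x"
proof -
  have "\<ominus>\<^bsub>(class_ring :: 'k ring)\<^esub> \<one>\<^bsub>class_ring\<^esub> = - 1"
    by (simp add: class_ring_simps)
  thus "x \<in> carrier M \<Longrightarrow> ?thesis" using smult_minus_1[of x] by simp
qed

lemma scale_minus:
  assumes "x \<in> carrier M" "y \<in> carrier M"
  shows "c \<odot>\<^bsub>M\<^esub> (x \<ominus>\<^bsub>M\<^esub> y) = c \<odot>\<^bsub>M\<^esub> x \<ominus>\<^bsub>M\<^esub> c \<odot>\<^bsub>M\<^esub> y"
  using smult_assoc1[of c "-1" y] smult_assoc1[of "-1" c y] scale_minus_1[of "c \<odot>\<^bsub>M\<^esub> y"]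
    scale_minus_1[of y] assms
  by (simp add: a_minus_def scale_add mult.commute)

lemma scale_0: "x \<in> carrier M \<Longrightarrow> 0 \<odot>\<^bsub>M\<^esub> x = \<zero>\<^bsub>M\<^esub>"
  using lmult_0[of x] by simp

lemma lact_zero: "a \<in> carrier A \<Longrightarrow> lact M a \<zero>\<^bsub>M\<^esub> = \<zero>\<^bsub>M\<^esub>"
  using lact_smult_right[of a "\<zero>\<^bsub>M\<^esub>" 0] by (simp add: scale_0 lact_closed)

lemma ract_zero: "a \<in> carrier A \<Longrightarrow> ract M \<zero>\<^bsub>M\<^esub> a = \<zero>\<^bsub>M\<^esub>"
  using ract_smult_left[of a "\<zero>\<^bsub>M\<^esub>" 0] by (simp add: scale_0 ract_closed)

lemma lact_neg: "a \<in> carrier A \<Longrightarrow> x \<in> carrier M \<Longrightarrow> lact M a (\<ominus>\<^bsub>M\<^esub> x) = \<ominus>\<^bsub>M\<^esub> lact M a x"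
  using lact_smult_right[of a x "- 1"] by (simp add: scale_minus_1 lact_closed)

lemma ract_neg: "a \<in> carrier A \<Longrightarrow> x \<in> carrier M \<Longrightarrow> ract M (\<ominus>\<^bsub>M\<^esub> x) a = \<ominus>\<^bsub>M\<^esub> ract M x a"
  using ract_smult_left[of a x "- 1"] by (simp add: scale_minus_1 ract_closed)

lemma lact_minus: "a \<in> carrier A \<Longrightarrow> x \<in> carrier M \<Longrightarrow> y \<in> carrier M \<Longrightarrow>
    lact M a (x \<ominus>\<^bsub>M\<^esub> y) = lact M a x \<ominus>\<^bsub>M\<^esub> lact M a y"
  by (simp add: a_minus_def lact_add_right lact_neg)

lemma ract_minus: "a \<in> carrier A \<Longrightarrow> x \<in> carrier M \<Longrightarrow> y \<in> carrier M \<Longrightarrow>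
    ract M (x \<ominus>\<^bsub>M\<^esub> y) a = ract M x a \<ominus>\<^bsub>M\<^esub> ract M y a"
  by (simp add: a_minus_def ract_add_left ract_neg)

end

locale bimodule_map = M: bimodule A M + N: bimodule A N
  for A :: "('k::field, 'a) module" and M :: "('k, 'a, 'm) bimodule" and N :: "('k, 'a, 'n) bimodule" +
  fixes f :: "'m \<Rightarrow> 'n"
  assumes hom: "f \<in> bimodule_hom A M N"
begin

lemma closed [simp]: "x \<in> carrier M \<Longrightarrow> f x \<in> carrier N"
  and add: "x \<in> carrier M \<Longrightarrow> y \<in> carrier M \<Longrightarrow> f (x \<oplus>\<^bsub>M\<^esub> y) = f x \<oplus>\<^bsub>N\<^esub> f y"
  and smult: "x \<in> carrier M \<Longrightarrow> f (c \<odot>\<^bsub>M\<^esub> x) = c \<odot>\<^bsub>N\<^esub> f x"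
  and left: "a \<in> carrier A \<Longrightarrow> x \<in> carrier M \<Longrightarrow> f (lact M a x) = lact N a (f x)"
  and right: "a \<in> carrier A \<Longrightarrow> x \<in> carrier M \<Longrightarrow> f (ract M x a) = ract N (f x) a"
  and ext: "x \<notin> carrier M \<Longrightarrow> f x = undefined"
  using hom by (auto simp: bimodule_hom_def PiE_def extensional_def)

lemma zero: "f \<zero>\<^bsub>M\<^esub> = \<zero>\<^bsub>N\<^esub>"
  using smult[of "\<zero>\<^bsub>M\<^esub>" 0] by (simp add: M.scale_0 N.scale_0)

lemma neg: "x \<in> carrier M \<Longrightarrow> f (\<ominus>\<^bsub>M\<^esub> x) = \<ominus>\<^bsub>N\<^esub> f x"
  using smult[of x "- 1"] by (simp add: M.scale_minus_1 N.scale_minus_1)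

lemma minus: "x \<in> carrier M \<Longrightarrow> y \<in> carrier M \<Longrightarrow> f (x \<ominus>\<^bsub>M\<^esub> y) = f x \<ominus>\<^bsub>N\<^esub> f y"
  by (simp add: a_minus_def add neg)

end

lemma hom_space_simps:
  "f \<oplus>\<^bsub>hom_space A M N\<^esub> g = (\<lambda>x\<in>carrier M. f x \<oplus>\<^bsub>N\<^esub> g x)"
  "c \<odot>\<^bsub>hom_space A M N\<^esub> f = (\<lambda>x\<in>carrier M. c \<odot>\<^bsub>N\<^esub> f x)"
  "\<zero>\<^bsub>hom_space A M N\<^esub> = (\<lambda>x\<in>carrier M. \<zero>\<^bsub>N\<^esub>)"
  by (simp_all add: hom_space_def)

lemma ext_cocycles_vectorspace:
  fixes N :: "('k::field, 'a, 'n) bimodule" and P :: "nat \<Rightarrow> ('k, 'a, 'm) bimodule"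
  assumes P: "\<And>n. bimodule A (P n)" and N: "bimodule A N"
    and d: "\<And>n. d n \<in> bimodule_hom A (P (Suc n)) (P n)"
  shows "vectorspace class_ring ((hom_space A (P n) N)\<lparr>carrier := ext_cocycles A P d N n\<rparr>)"
proof -
  interpret P: bimodule A "P n" by (rule P)
  interpret N: bimodule A N by (rule N)
  interpret d: bimodule_map A "P (Suc n)" "P n" "d n"
    using P d by (simp add: bimodule_map_def bimodule_map_axioms_def)
  have map: "bimodule_map A (P n) N f" if "f \<in> ext_cocycles A P d N n" for f
    using that P N by (simp add: bimodule_map_def bimodule_map_axioms_def ext_cocycles_def)
  have cocycle: "f (d n x) = \<zero>\<^bsub>N\<^esub>" if "f \<in> ext_cocycles A P d N n" "x \<in> carrier (P (Suc n))" for f x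
    using that by (simp add: ext_cocycles_def)
  have add_closed: "(\<lambda>x\<in>carrier (P n). f x \<oplus>\<^bsub>N\<^esub> g x) \<in> ext_cocycles A P d N n"
    if f: "f \<in> ext_cocycles A P d N n" and g: "g \<in> ext_cocycles A P d N n" for f g
  proof -
    interpret f: bimodule_map A "P n" N f by (rule map[OF f])
    interpret g: bimodule_map A "P n" N g by (rule map[OF g])
    show ?thesis
      unfolding ext_cocycles_def bimodule_hom_def
      by (auto simp: f.add g.add f.smult g.smult f.left g.left f.right g.right cocycle f g
          N.M.a_ac N.scale_add N.lact_add_right N.ract_add_left P.lact_closed P.ract_closed
          N.lact_closed N.ract_closed)
  qed
  have smult_closed: "(\<lambda>x\<in>carrier (P n). c \<odot>\<^bsub>N\<^esub> f x) \<in> ext_cocycles A P d N n"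
    if f: "f \<in> ext_cocycles A P d N n" for f c
  proof -
    interpret f: bimodule_map A "P n" N f by (rule map[OF f])
    have "c \<odot>\<^bsub>N\<^esub> \<zero>\<^bsub>N\<^esub> = \<zero>\<^bsub>N\<^esub>" using N.rmult_0[of c] by simp
    moreover have "c \<odot>\<^bsub>N\<^esub> (r \<odot>\<^bsub>N\<^esub> y) = r \<odot>\<^bsub>N\<^esub> (c \<odot>\<^bsub>N\<^esub> y)" if "y \<in> carrier N" for r y
      using N.smult_assoc1[of c r y] N.smult_assoc1[of r c y] that by (simp add: mult.commute)
    ultimately show ?thesis
      unfolding ext_cocycles_def bimodule_hom_def
      by (auto simp: f.add f.smult f.left f.right cocycle f
          N.scale_add N.lact_smult_right N.ract_smult_left P.lact_closed P.ract_closed)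
  qed
  have zero_closed: "(\<lambda>x\<in>carrier (P n). \<zero>\<^bsub>N\<^esub>) \<in> ext_cocycles A P d N n"
    using N.rmult_0
    unfolding ext_cocycles_def bimodule_hom_def
    by (auto simp: N.lact_zero N.ract_zero P.lact_closed P.ract_closed)
  have ext_eq: "f = g" if "f \<in> ext_cocycles A P d N n" "g \<in> ext_cocycles A P d N n"
    "\<And>x. x \<in> carrier (P n) \<Longrightarrow> f x = g x" for f g
    using that by (auto simp: ext_cocycles_def bimodule_hom_def intro: PiE_ext)
  have restrict_self: "restrict f (carrier (P n)) = f" if "f \<in> ext_cocycles A P d N n" for f
    using that by (auto simp: ext_cocycles_def bimodule_hom_def extensional_restrict PiE_def)
  have val: "f x \<in> carrier N" if "f \<in> ext_cocycles A P d N n" "x \<in> carrier (P n)" for f x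
    using that by (auto simp: ext_cocycles_def bimodule_hom_def)
  show ?thesis
    using add_closed smult_closed zero_closed
    by (intro vectorspaceI)
      (auto simp: hom_space_def intro!: ext_eq restrict_ext
         simp: restrict_self N.M.a_ac N.scale_add N.scale_minus_1 N.M.l_neg N.M.r_neg val
           N.smult_l_distr[simplified] N.smult_assoc1[simplified] N.smult_one[simplified]
         cong: restrict_cong)
qed

section \<open>Projectivity against bimodules over other types\<close>

text \<open>
  Projectivity speaks about test bimodules over one fixed type. Renaming the elements of a bimodule along
  an injection brings any small enough bimodule into that type.
\<close>

definition copy_bimodule :: "('m \<Rightarrow> 'n) \<Rightarrow> ('k, 'a, 'm) bimodule \<Rightarrow> ('k, 'a, 'n) bimodule" where
  "copy_bimodule e M = (let i = inv_into (carrier M) e in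
     \<lparr>carrier = e ` carrier M, mult = undefined, one = undefined, zero = e \<zero>\<^bsub>M\<^esub>,
      add = (\<lambda>x y. e (i x \<oplus>\<^bsub>M\<^esub> i y)), smult = (\<lambda>c x. e (c \<odot>\<^bsub>M\<^esub> i x)),
      lact = (\<lambda>a x. e (lact M a (i x))), ract = (\<lambda>x a. e (ract M (i x) a))\<rparr>)"

lemma copy_bimodule_simps:
  assumes "inj_on e (carrier M)"
  shows "carrier (copy_bimodule e M) = e ` carrier M"
    "zero (copy_bimodule e M) = e \<zero>\<^bsub>M\<^esub>"
    "x \<in> carrier M \<Longrightarrow> y \<in> carrier M \<Longrightarrow> add (copy_bimodule e M) (e x) (e y) = e (x \<oplus>\<^bsub>M\<^esub> y)"
    "x \<in> carrier M \<Longrightarrow> module.smult (copy_bimodule e M) c (e x) = e (c \<odot>\<^bsub>M\<^esub> x)"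
    "x \<in> carrier M \<Longrightarrow> lact (copy_bimodule e M) a (e x) = e (lact M a x)"
    "x \<in> carrier M \<Longrightarrow> ract (copy_bimodule e M) (e x) a = e (ract M x a)"
  using assms by (simp_all add: copy_bimodule_def Let_def)

lemma bimodule_copy:
  assumes M: "bimodule A M" and e: "inj_on e (carrier M)"
  shows "bimodule A (copy_bimodule e M)"
proof -
  interpret M: bimodule A M by fact
  note cs = copy_bimodule_simps[OF e]
  have "vectorspace class_ring (copy_bimodule e M)"
    by (rule vectorspaceI) (auto simp: cs M.M.a_ac M.scale_add M.scale_minus_1 M.M.l_neg M.M.r_neg
       M.smult_l_distr[simplified] M.smult_assoc1[simplified] M.smult_one[simplified])
  thus ?thesis
    unfolding bimodule_def bimodule_axioms_def
    by (auto simp: cs M.lact_closed M.ract_closed M.lact_add_left M.lact_add_right M.ract_add_left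
      M.ract_add_right M.lact_smult_left M.lact_smult_right M.ract_smult_left M.ract_smult_right
      M.lact_one M.ract_one M.lact_mult M.ract_mult M.lact_ract)
qed

lemma projective_bimodule_lift:
  fixes P :: "('k::field, 'a, 'm) bimodule" and M :: "('k, 'a, 'x) bimodule" and N :: "('k, 'a, 'y) bimodule"
    and e :: "'x \<Rightarrow> ('a \<times> 'm \<times> 'a) list" and e' :: "'y \<Rightarrow> ('a \<times> 'm \<times> 'a) list"
  assumes P: "projective_bimodule A P" and M: "bimodule A M" and N: "bimodule A N"
    and e: "inj_on e (carrier M)" and e': "inj_on e' (carrier N)"
    and g: "g \<in> bimodule_hom A M N" "g ` carrier M = carrier N"
    and f: "f \<in> bimodule_hom A P N"
  shows "\<exists>h\<in>bimodule_hom A P M. \<forall>x\<in>carrier P. g (h x) = f x"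
proof -
  let ?M = "copy_bimodule e M" and ?N = "copy_bimodule e' N"
  let ?i = "inv_into (carrier M) e"
  have PB: "bimodule A P" using P by (simp add: projective_bimodule_def)
  interpret P: bimodule A P by (rule PB)
  interpret M: bimodule A M by fact
  interpret N: bimodule A N by fact
  interpret f: bimodule_map A P N f
    using PB N f by (simp add: bimodule_map_def bimodule_map_axioms_def)
  interpret g: bimodule_map A M N g
    using M N g by (simp add: bimodule_map_def bimodule_map_axioms_def)
  note cs = copy_bimodule_simps[OF e] copy_bimodule_simps[OF e']
  let ?g = "\<lambda>x\<in>carrier ?M. e' (g (?i x))" and ?f = "\<lambda>x\<in>carrier P. e' (f x)"
  have g': "?g \<in> bimodule_hom A ?M ?N"
    unfolding bimodule_hom_def
    by (auto simp: cs e g.add g.smult g.left g.right M.lact_closed M.ract_closed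
       N.lact_closed N.ract_closed)
  have g'_surj: "?g ` carrier ?M = carrier ?N"
  proof -
    have "?g ` carrier ?M = e' ` (g ` carrier M)" by (auto simp: cs e image_iff)
    thus ?thesis using g(2) by (simp add: cs)
  qed
  have f': "?f \<in> bimodule_hom A P ?N"
    unfolding bimodule_hom_def
    by (auto simp: cs f.add f.smult f.left f.right P.lact_closed P.ract_closed)
  obtain h where h: "h \<in> bimodule_hom A P ?M" "\<And>x. x \<in> carrier P \<Longrightarrow> ?g (h x) = ?f x"
    using P bimodule_copy[OF M e] bimodule_copy[OF N e'] g' g'_surj f'
    unfolding projective_bimodule_def by blast
  interpret h: bimodule_map A P ?M h
    using PB bimodule_copy[OF M e] h by (simp add: bimodule_map_def bimodule_map_axioms_def)
  have hx: "\<exists>y\<in>carrier M. h x = e y" if "x \<in> carrier P" for x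
    using h.closed[OF that] by (auto simp: cs)
  let ?h = "\<lambda>x\<in>carrier P. ?i (h x)"
  have hM: "?i (h x) \<in> carrier M" "e (?i (h x)) = h x" if "x \<in> carrier P" for x
    using hx[OF that] e by auto
  have "?i (h (x \<oplus>\<^bsub>P\<^esub> y)) = ?i (h x) \<oplus>\<^bsub>M\<^esub> ?i (h y)" if "x \<in> carrier P" "y \<in> carrier P" for x y
    using hx[OF that(1)] hx[OF that(2)] that by (auto simp: h.add cs e)
  moreover have "?i (h (c \<odot>\<^bsub>P\<^esub> x)) = c \<odot>\<^bsub>M\<^esub> ?i (h x)" if "x \<in> carrier P" for c x
    using hx[OF that] that by (auto simp: h.smult cs e)
  moreover have "?i (h (lact P a x)) = lact M a (?i (h x))" if "a \<in> carrier A" "x \<in> carrier P" for a x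
    using hx[OF that(2)] that by (auto simp: h.left cs e M.lact_closed)
  moreover have "?i (h (ract P x a)) = ract M (?i (h x)) a" if "a \<in> carrier A" "x \<in> carrier P" for a x
    using hx[OF that(2)] that by (auto simp: h.right cs e M.ract_closed)
  ultimately have "?h \<in> bimodule_hom A P M"
    unfolding bimodule_hom_def using hM(1) by (auto simp: P.lact_closed P.ract_closed)
  moreover have "g (?h x) = f x" if "x \<in> carrier P" for x
  proof -
    have "h x \<in> carrier ?M" using that by simp
    hence "e' (g (?i (h x))) = e' (f x)" using h(2)[OF that] that by simp
    hence "g (?i (h x)) = f x" using e' hM(1)[OF that] that by (simp add: inj_on_eq_iff)
    thus ?thesis using that by simp
  qed
  ultimately show ?thesis by blast
qed

section \<open>Hochschild cohomology in degrees 0 and 1\<close>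

locale associative_algebra = A: ring A for A :: "('k::field, 'a) module" (structure) +
  assumes vectorspace_A: "vectorspace class_ring A"
    and smult_mult_left: "x \<in> carrier A \<Longrightarrow> y \<in> carrier A \<Longrightarrow> (c \<odot> x) \<otimes> y = c \<odot> (x \<otimes> y)"
    and smult_mult_right: "x \<in> carrier A \<Longrightarrow> y \<in> carrier A \<Longrightarrow> x \<otimes> (c \<odot> y) = c \<odot> (x \<otimes> y)"
begin

definition centre :: "'a set" where
  "centre = {z \<in> carrier A. \<forall>a\<in>carrier A. a \<otimes> z = z \<otimes> a}"

definition derivations :: "('a \<Rightarrow> 'a) set" where
  "derivations = {D \<in> carrier A \<rightarrow> carrier A.
     (\<forall>a\<in>carrier A. \<forall>b\<in>carrier A. D (a \<oplus> b) = D a \<oplus> D b) \<and>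
     (\<forall>c. \<forall>a\<in>carrier A. D (c \<odot> a) = c \<odot> D a) \<and>
     (\<forall>a\<in>carrier A. \<forall>b\<in>carrier A. D (a \<otimes> b) = D a \<otimes> b \<oplus> a \<otimes> D b)}"

definition commutator :: "'a \<Rightarrow> 'a \<Rightarrow> 'a" where
  "commutator a u = a \<otimes> u \<ominus> u \<otimes> a"

lemma bimodule_regular: "bimodule A (regular_bimodule A)"
proof -
  interpret V: vectorspace class_ring A by (rule vectorspace_A)
  have "vectorspace class_ring (regular_bimodule A)"
  proof (rule vectorspaceI)
    have "\<ominus>\<^bsub>(class_ring :: 'k ring)\<^esub> \<one>\<^bsub>class_ring\<^esub> = - 1" by (simp add: class_ring_simps)
    thus "(- 1) \<odot>\<^bsub>regular_bimodule A\<^esub> x \<oplus>\<^bsub>regular_bimodule A\<^esub> x = \<zero>\<^bsub>regular_bimodule A\<^esub>"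
      if "x \<in> carrier (regular_bimodule A)" for x
      using V.smult_minus_1[of x] that by (simp add: A.l_neg)
  qed (use V.smult_closed V.smult_l_distr V.smult_r_distr V.smult_assoc1 V.smult_one
       in \<open>auto simp: A.a_ac\<close>)
  thus ?thesis
    unfolding bimodule_def bimodule_axioms_def
    by (auto simp: A.l_distr A.r_distr A.m_assoc smult_mult_left smult_mult_right)
qed

sublocale reg: bimodule A "regular_bimodule A" by (rule bimodule_regular)

lemma regular_simps:
  "x \<in> carrier A \<Longrightarrow> c \<odot> x \<in> carrier A"
  "a_inv (regular_bimodule A) x = \<ominus> x"
  "a_minus (regular_bimodule A) x y = x \<ominus> y"
  "x \<in> carrier A \<Longrightarrow> y \<in> carrier A \<Longrightarrow> c \<odot> (x \<oplus> y) = c \<odot> x \<oplus> c \<odot> y"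
  "x \<in> carrier A \<Longrightarrow> 0 \<odot> x = \<zero>"
  "c \<odot> \<zero> = \<zero>"
proof -
  show inv: "a_inv (regular_bimodule A) x = \<ominus> x" for x by (rule a_inv_cong) auto
  show "a_minus (regular_bimodule A) x y = x \<ominus> y" by (simp add: a_minus_def inv)
qed (use reg.scale_closed reg.scale_add reg.scale_0 reg.rmult_0 in auto)

lemma commutator_closed [simp]: "a \<in> carrier A \<Longrightarrow> u \<in> carrier A \<Longrightarrow> commutator a u \<in> carrier A"
  by (simp add: commutator_def)

lemma commutator_add_right:
  "a \<in> carrier A \<Longrightarrow> u \<in> carrier A \<Longrightarrow> v \<in> carrier A \<Longrightarrow>
    commutator a (u \<oplus> v) = commutator a u \<oplus> commutator a v"
  by (simp add: commutator_def A.r_distr A.l_distr A.add_minus_add)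

lemma smult_minus:
  "x \<in> carrier A \<Longrightarrow> y \<in> carrier A \<Longrightarrow> c \<odot> (x \<ominus> y) = c \<odot> x \<ominus> c \<odot> y"
  using reg.scale_minus[of x y c] by (simp add: regular_simps)

lemma commutator_smult_right:
  "a \<in> carrier A \<Longrightarrow> u \<in> carrier A \<Longrightarrow> commutator a (c \<odot> u) = c \<odot> commutator a u"
  by (simp add: commutator_def smult_mult_left smult_mult_right smult_minus)

text \<open>
  The extension of \<open>A\<close> by \<open>A\<close> with class \<open>D\<close>: the right action differs from that on the direct sum by
  the term \<open>x \<otimes> D a\<close>, and compatibility with products is the Leibniz rule. The sign is chosen so that a
  lift of \<open>\<epsilon>\<close> to this extension yields \<open>D\<close> and not its negative.
\<close>

definition derivation_extension :: "('a \<Rightarrow> 'a) \<Rightarrow> ('k, 'a, 'a \<times> 'a) bimodule" where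
  "derivation_extension D =
     \<lparr>carrier = carrier A \<times> carrier A, mult = undefined, one = undefined, zero = (\<zero>, \<zero>),
      add = (\<lambda>(x, y) (x', y'). (x \<oplus> x', y \<oplus> y')), smult = (\<lambda>c (x, y). (c \<odot> x, c \<odot> y)),
      lact = (\<lambda>a (x, y). (a \<otimes> x, a \<otimes> y)),
      ract = (\<lambda>(x, y) a. (x \<otimes> a, y \<otimes> a \<ominus> x \<otimes> D a))\<rparr>"

lemma derivation_one: "D \<in> derivations \<Longrightarrow> D \<one> = \<zero>"
proof -
  assume D: "D \<in> derivations"
  have c: "D \<one> \<in> carrier A" using D by (auto simp: derivations_def)
  have "D (\<one> \<otimes> \<one>) = D \<one> \<otimes> \<one> \<oplus> \<one> \<otimes> D \<one>" using D unfolding derivations_def by blast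
  hence "D \<one> = D \<one> \<oplus> D \<one>" using c by simp
  thus "D \<one> = \<zero>" using c by (simp add: A.add.l_cancel_one')
qed

lemma bimodule_derivation_extension:
  assumes D: "D \<in> derivations"
  shows "bimodule A (derivation_extension D)"
proof -
  have Dc [simp]: "D a \<in> carrier A" if "a \<in> carrier A" for a using D that by (auto simp: derivations_def)
  have D_add: "D (a \<oplus> b) = D a \<oplus> D b" if "a \<in> carrier A" "b \<in> carrier A" for a b
    using D that by (auto simp: derivations_def)
  have D_smult: "D (c \<odot> a) = c \<odot> D a" if "a \<in> carrier A" for a c
    using D that by (auto simp: derivations_def)
  have D_mult: "D (a \<otimes> b) = D a \<otimes> b \<oplus> a \<otimes> D b" if "a \<in> carrier A" "b \<in> carrier A" for a b
    using D that by (auto simp: derivations_def)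
  have V: "vectorspace class_ring (derivation_extension D)"
    using reg.scale_minus_1 reg.smult_l_distr reg.smult_assoc1 reg.smult_one
    by (intro vectorspaceI) (auto simp: derivation_extension_def regular_simps A.add.m_ac A.l_neg A.r_neg)
  have assoc: "(y \<otimes> a \<ominus> x \<otimes> D a) \<otimes> b \<ominus> x \<otimes> a \<otimes> D b = y \<otimes> (a \<otimes> b) \<ominus> x \<otimes> D (a \<otimes> b)"
    if "x \<in> carrier A" "y \<in> carrier A" "a \<in> carrier A" "b \<in> carrier A" for x y a b
    using that by (simp add: D_mult a_minus_def A.l_distr A.r_distr A.m_assoc A.l_minus A.minus_add A.a_ac)
  have add_minus_swap: "(x \<oplus> y) \<ominus> (z \<oplus> w) = (x \<ominus> z) \<oplus> (y \<ominus> w)"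
    if "x \<in> carrier A" "y \<in> carrier A" "z \<in> carrier A" "w \<in> carrier A" for x y z w
    using that by (rule A.add_minus_add)
  have r_minus': "x \<otimes> (y \<ominus> z) = x \<otimes> y \<ominus> x \<otimes> z"
    if "x \<in> carrier A" "y \<in> carrier A" "z \<in> carrier A" for x y z
    using that by (simp add: a_minus_def A.r_distr A.r_minus)
  have minus_zero: "x \<ominus> \<zero> = x" if "x \<in> carrier A" for x
    using that by (simp add: a_minus_def)
  show ?thesis
    unfolding bimodule_def bimodule_axioms_def
    using V assoc
    by (auto simp: derivation_extension_def regular_simps A.l_distr A.r_distr A.m_assoc smult_mult_left
       smult_mult_right D_add D_smult A.add_minus_add smult_minus derivation_one[OF D]
       minus_zero r_minus')
qed

end

locale hochschild_resolution = associative_algebra A for A :: "('k::field, 'a) module" (structure) +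
  fixes P :: "nat \<Rightarrow> ('k, 'a, 'm) bimodule" and d :: "nat \<Rightarrow> 'm \<Rightarrow> 'm" and \<epsilon> :: "'m \<Rightarrow> 'a"
  assumes resolution: "projective_resolution A (regular_bimodule A) P d \<epsilon>"
begin

lemma P: "bimodule A (P n)" and d: "d n \<in> bimodule_hom A (P (Suc n)) (P n)"
  using resolution by (auto simp: projective_resolution_def projective_bimodule_def)

sublocale P0: bimodule A "P 0" by (rule P)
sublocale P1: bimodule A "P (Suc 0)" by (rule P)
sublocale d0: bimodule_map A "P (Suc 0)" "P 0" "d 0"
  using P d by (simp add: bimodule_map_def bimodule_map_axioms_def)
sublocale eps: bimodule_map A "P 0" "regular_bimodule A" \<epsilon>
  using resolution P bimodule_regular
  by (simp add: bimodule_map_def bimodule_map_axioms_def projective_resolution_def)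

text \<open>
  Exactness in the two places that degrees 0 and 1 involve.
\<close>

lemma eps_d0: "q \<in> carrier (P (Suc 0)) \<Longrightarrow> \<epsilon> (d 0 q) = \<zero>"
  and ker_eps: "x \<in> carrier (P 0) \<Longrightarrow> \<epsilon> x = \<zero> \<Longrightarrow> \<exists>q\<in>carrier (P (Suc 0)). d 0 q = x"
  and d0_d1: "y \<in> carrier (P (Suc (Suc 0))) \<Longrightarrow> d 0 (d (Suc 0) y) = \<zero>\<^bsub>P 0\<^esub>"
  and ker_d0: "q \<in> carrier (P (Suc 0)) \<Longrightarrow> d 0 q = \<zero>\<^bsub>P 0\<^esub> \<Longrightarrow> \<exists>y\<in>carrier (P (Suc (Suc 0))). d (Suc 0) y = q"
proof -
  have r: "d 0 ` carrier (P (Suc 0)) = {x \<in> carrier (P 0). \<epsilon> x = \<zero>}"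
    "d (Suc 0) ` carrier (P (Suc (Suc 0))) = {x \<in> carrier (P (Suc 0)). d 0 x = \<zero>\<^bsub>P 0\<^esub>}"
    using resolution by (simp_all add: projective_resolution_def)
  show "\<epsilon> (d 0 q) = \<zero>" if "q \<in> carrier (P (Suc 0))"
  proof -
    have "d 0 q \<in> d 0 ` carrier (P (Suc 0))" using that by (rule imageI)
    thus ?thesis unfolding r(1) by simp
  qed
  show "\<exists>q\<in>carrier (P (Suc 0)). d 0 q = x" if "x \<in> carrier (P 0)" "\<epsilon> x = \<zero>"
  proof -
    have "x \<in> d 0 ` carrier (P (Suc 0))" using that unfolding r(1) by simp
    thus ?thesis by (metis imageE)
  qed
  show "d 0 (d (Suc 0) y) = \<zero>\<^bsub>P 0\<^esub>" if "y \<in> carrier (P (Suc (Suc 0)))"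
  proof -
    have "d (Suc 0) y \<in> d (Suc 0) ` carrier (P (Suc (Suc 0)))" using that by (rule imageI)
    thus ?thesis unfolding r(2) by simp
  qed
  show "\<exists>y\<in>carrier (P (Suc (Suc 0))). d (Suc 0) y = q"
    if "q \<in> carrier (P (Suc 0))" "d 0 q = \<zero>\<^bsub>P 0\<^esub>"
  proof -
    have "q \<in> d (Suc 0) ` carrier (P (Suc (Suc 0)))" using that unfolding r(2) by simp
    thus ?thesis by (metis imageE)
  qed
qed

text \<open>
  Any element over the unit. It plays the role that \<open>1 \<otimes> 1\<close> has in the bar resolution: the commutators
  of \<open>p\<close> with \<open>A\<close> lie in the kernel of \<open>\<epsilon>\<close>, and \<open>x - \<epsilon> x p\<close> lies there for every \<open>x\<close>.
\<close>

definition p :: 'm where "p = (SOME x. x \<in> carrier (P 0) \<and> \<epsilon> x = \<one>)"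

lemma p [simp]: "p \<in> carrier (P 0)" "\<epsilon> p = \<one>"
proof -
  have "\<epsilon> ` carrier (P 0) = carrier A" using resolution by (auto simp: projective_resolution_def)
  hence "\<exists>x. x \<in> carrier (P 0) \<and> \<epsilon> x = \<one>" by (metis A.one_closed imageE)
  from someI_ex[OF this] show "p \<in> carrier (P 0)" "\<epsilon> p = \<one>" by (auto simp: p_def)
qed

lemma eps_closed [simp]: "x \<in> carrier (P 0) \<Longrightarrow> \<epsilon> x \<in> carrier A"
  using eps.closed by simp

lemmas P0_closed [simp] = P0.lact_closed P0.ract_closed
lemmas P1_closed [simp] = P1.lact_closed P1.ract_closed

lemmas eps_rules = eps.add eps.smult eps.left eps.right eps.minus eps.neg eps.zero

abbreviation "cocycle_space n \<equiv>
  (hom_space A (P n) (regular_bimodule A))\<lparr>carrier := ext_cocycles A P d (regular_bimodule A) n\<rparr>"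

lemma cocycle_space_vectorspace: "vectorspace class_ring (cocycle_space n)"
  by (rule ext_cocycles_vectorspace[where P = P]) (rule P d bimodule_regular)+

text \<open>
  A 0-cocycle vanishes on the kernel of \<open>\<epsilon>\<close>, hence on \<open>x - \<epsilon> x p\<close>, so \<open>f x = \<epsilon> x \<otimes> f p\<close>. It vanishes on
  \<open>a p - p a\<close> as well, which makes \<open>f p\<close> central.
\<close>

theorem dim_HH0:
  fixes S :: "'s set" and \<zeta> :: "('s \<Rightarrow> 'k) \<Rightarrow> 'a"
  assumes S: "finite S"
    and centre: "\<zeta> ` coords S = centre"
    and add: "\<And>c c'. c \<in> coords S \<Longrightarrow> c' \<in> coords S \<Longrightarrow> \<zeta> (\<lambda>s. c s + c' s) = \<zeta> c \<oplus> \<zeta> c'"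
    and smult: "\<And>r c. c \<in> coords S \<Longrightarrow> \<zeta> (\<lambda>s. r * c s) = r \<odot> \<zeta> c"
    and inj: "\<And>c. c \<in> coords S \<Longrightarrow> \<zeta> c = \<zero> \<Longrightarrow> c = (\<lambda>s. 0)"
  shows "vectorspace.fin_dim class_ring (HH A P d 0)" "vectorspace.dim class_ring (HH A P d 0) = card S"
proof -
  let ?N = "regular_bimodule A"
  define R where "R f c \<longleftrightarrow> c \<in> coords S \<and> f p = \<zeta> c" for f :: "'m \<Rightarrow> 'a" and c
  have map: "bimodule_map A (P 0) ?N f" if "f \<in> ext_cocycles A P d ?N 0" for f
    using that P bimodule_regular by (simp add: bimodule_map_def bimodule_map_axioms_def ext_cocycles_def)
  have \<zeta>_centre: "\<zeta> c \<in> centre" if "c \<in> coords S" for c using centre that by blast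
  have \<zeta>0: "\<zeta> (\<lambda>s. 0) = \<zero>"
    using smult[OF coords_zero, of 0] \<zeta>_centre[OF coords_zero] by (simp add: regular_simps centre_def)
  have cocycle_value: "f x = \<epsilon> x \<otimes> f p" if f: "f \<in> ext_cocycles A P d ?N 0" and x: "x \<in> carrier (P 0)" for f x
  proof -
    interpret f: bimodule_map A "P 0" ?N f by (rule map[OF f])
    have "\<epsilon> (x \<ominus>\<^bsub>P 0\<^esub> lact (P 0) (\<epsilon> x) p) = \<zero>"
      using x by (simp add: eps_rules regular_simps A.r_neg a_minus_def)
    then obtain q where q: "q \<in> carrier (P (Suc 0))" "d 0 q = x \<ominus>\<^bsub>P 0\<^esub> lact (P 0) (\<epsilon> x) p"
      using ker_eps x by (metis P0.M.minus_closed P0_closed(1) eps_closed p(1))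
    have "f (d 0 q) = \<zero>" using f q(1) by (simp add: ext_cocycles_def)
    hence "f x \<ominus> \<epsilon> x \<otimes> f p = \<zero>" using q x by (simp add: f.minus f.left regular_simps)
    thus ?thesis using x f.closed by (simp add: A.minus_eq_zero_iff)
  qed
  have central: "f p \<in> centre" if f: "f \<in> ext_cocycles A P d ?N 0" for f
  proof -
    interpret f: bimodule_map A "P 0" ?N f by (rule map[OF f])
    have "a \<otimes> f p = f p \<otimes> a" if "a \<in> carrier A" for a
      using cocycle_value[OF f, of "ract (P 0) p a"] that by (simp add: f.right eps_rules)
    thus ?thesis using f.closed[of p] by (simp add: centre_def)
  qed
  have "vectorspace.fin_dim class_ring (quotient_module (cocycle_space 0) {\<lambda>x\<in>carrier (P 0). \<zero>}) \<and>
    vectorspace.dim class_ring (quotient_module (cocycle_space 0) {\<lambda>x\<in>carrier (P 0). \<zero>}) = card S"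
  proof (rule quotient_by_linear_relation[where R = R and S = S])
    show "\<exists>z\<in>carrier (cocycle_space 0). R z c" if c: "c \<in> coords S" for c
    proof -
      let ?f = "\<lambda>x\<in>carrier (P 0). \<epsilon> x \<otimes> \<zeta> c"
      have z: "\<zeta> c \<in> carrier A" "\<And>a. a \<in> carrier A \<Longrightarrow> a \<otimes> \<zeta> c = \<zeta> c \<otimes> a"
        using \<zeta>_centre[OF c] by (auto simp: centre_def)
      have "?f \<in> ext_cocycles A P d ?N 0"
        unfolding ext_cocycles_def bimodule_hom_def
        by (auto simp: eps_rules z(1) z(2)[symmetric] A.l_distr A.m_assoc smult_mult_left eps_d0)
      moreover have "R ?f c" using z c by (simp add: R_def)
      ultimately show ?thesis by auto
    qed
    show "\<exists>c\<in>coords S. R z c" if "z \<in> carrier (cocycle_space 0)" for z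
      using central[of z] that centre by (force simp: R_def)
    show "R (z \<oplus>\<^bsub>cocycle_space 0\<^esub> z') (\<lambda>s. c s + c' s)" if "R z c" "R z' c'" for z c z' c'
      using that p(1) by (auto simp: R_def hom_space_simps add coords_add)
    show "R (r \<odot>\<^bsub>cocycle_space 0\<^esub> z) (\<lambda>s. r * c s)" if "R z c" for r z c
      using that by (auto simp: R_def hom_space_simps smult coords_smult)
    show "R z (\<lambda>s. 0) = (z \<in> {\<lambda>x\<in>carrier (P 0). \<zero>})" if z: "z \<in> carrier (cocycle_space 0)" for z
    proof
      assume "R z (\<lambda>s. 0)"
      hence "z x = \<zero>" if "x \<in> carrier (P 0)" for x
        using cocycle_value[of z x] z that by (simp add: R_def \<zeta>0)
      moreover have "z \<in> extensional (carrier (P 0))"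
        using z by (auto simp: ext_cocycles_def bimodule_hom_def PiE_def)
      ultimately show "z \<in> {\<lambda>x\<in>carrier (P 0). \<zero>}" by (auto simp: fun_eq_iff extensional_def)
    qed (simp add: R_def \<zeta>0 coords_zero)
    show "c = (\<lambda>s. 0)" if "c \<in> coords S" "R \<zero>\<^bsub>cocycle_space 0\<^esub> c" for c
      using that inj[of c] by (simp add: R_def hom_space_simps)
    have "\<zero>\<^bsub>cocycle_space 0\<^esub> \<in> carrier (cocycle_space 0)"
    proof -
      interpret Z: vectorspace class_ring "cocycle_space 0" by (rule cocycle_space_vectorspace)
      show ?thesis by (rule Z.M.zero_closed)
    qed
    thus "{\<lambda>x\<in>carrier (P 0). \<zero>} \<subseteq> carrier (cocycle_space 0)" by (simp add: hom_space_simps)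
  qed (rule S cocycle_space_vectorspace)+
  thus "vectorspace.fin_dim class_ring (HH A P d 0)" "vectorspace.dim class_ring (HH A P d 0) = card S"
    by (simp_all add: HH_def ext_space_def)
qed

end

context hochschild_resolution
begin

abbreviation cocycle1 :: "('m \<Rightarrow> 'a) \<Rightarrow> bool" where
  "cocycle1 f \<equiv> f \<in> ext_cocycles A P d (regular_bimodule A) (Suc 0)"

abbreviation boundary_of :: "'a \<Rightarrow> 'm \<Rightarrow> bool" where
  "boundary_of a q \<equiv> q \<in> carrier (P (Suc 0)) \<and> d 0 q = lact (P 0) a p \<ominus>\<^bsub>P 0\<^esub> ract (P 0) p a"

lemma boundary_of_exists: "a \<in> carrier A \<Longrightarrow> \<exists>q. boundary_of a q"
  using ker_eps[of "lact (P 0) a p \<ominus>\<^bsub>P 0\<^esub> ract (P 0) p a"]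
  by (auto simp: eps_rules regular_simps A.r_neg a_minus_def)

lemma cocycle1_map: "cocycle1 f \<Longrightarrow> bimodule_map A (P (Suc 0)) (regular_bimodule A) f"
  using P bimodule_regular by (simp add: bimodule_map_def bimodule_map_axioms_def ext_cocycles_def)

text \<open>
  Two lifts of the same boundary differ by a boundary, on which a cocycle vanishes.
\<close>

lemma cocycle1_cong:
  assumes f: "cocycle1 f" and q: "q \<in> carrier (P (Suc 0))" "q' \<in> carrier (P (Suc 0))"
    and eq: "d 0 q = d 0 q'"
  shows "f q = f q'"
proof -
  interpret f: bimodule_map A "P (Suc 0)" "regular_bimodule A" f by (rule cocycle1_map[OF f])
  have "d 0 (q \<ominus>\<^bsub>P (Suc 0)\<^esub> q') = \<zero>\<^bsub>P 0\<^esub>" using q eq by (simp add: d0.minus P0.M.minus_eq_zero_iff)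
  then obtain y where y: "y \<in> carrier (P (Suc (Suc 0)))" "d (Suc 0) y = q \<ominus>\<^bsub>P (Suc 0)\<^esub> q'"
    using ker_d0 q P1.M.minus_closed by metis
  have "f (d (Suc 0) y) = \<zero>" using f y(1) by (simp add: ext_cocycles_def)
  hence "f q \<ominus> f q' = \<zero>" using y q by (simp add: f.minus regular_simps)
  thus ?thesis using q f.closed by (simp add: A.minus_eq_zero_iff)
qed

definition derivation_of :: "('m \<Rightarrow> 'a) \<Rightarrow> 'a \<Rightarrow> 'a" where
  "derivation_of f a = f (SOME q. boundary_of a q)"

lemma derivation_of_eq:
  assumes f: "cocycle1 f" and a: "a \<in> carrier A" and q: "boundary_of a q"
  shows "derivation_of f a = f q"
proof -
  have "boundary_of a (SOME q. boundary_of a q)" using boundary_of_exists[OF a] by (rule someI_ex)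
  thus ?thesis unfolding derivation_of_def using q by (intro cocycle1_cong[OF f]) auto
qed

text \<open>
  The Leibniz rule is the identity \<open>a b p - p a b = (a p - p a) b + a (b p - p b)\<close>: if \<open>q\<close> and \<open>r\<close> have
  boundaries \<open>a p - p a\<close> and \<open>b p - p b\<close>, then \<open>q b + a r\<close> has boundary \<open>a b p - p a b\<close>.
\<close>

lemma derivation_of_derivation:
  assumes f: "cocycle1 f"
  shows "derivation_of f \<in> derivations"
proof -
  interpret f: bimodule_map A "P (Suc 0)" "regular_bimodule A" f by (rule cocycle1_map[OF f])
  have closed: "derivation_of f a \<in> carrier A" if a: "a \<in> carrier A" for a
  proof -
    obtain q where "boundary_of a q" using boundary_of_exists[OF a] by blast
    thus ?thesis using derivation_of_eq[OF f a] f.closed[of q] by simp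
  qed
  have add: "derivation_of f (a \<oplus> b) = derivation_of f a \<oplus> derivation_of f b"
    if a: "a \<in> carrier A" and b: "b \<in> carrier A" for a b
  proof -
    obtain q r where qr: "boundary_of a q" "boundary_of b r"
      using boundary_of_exists a b by blast
    have "boundary_of (a \<oplus> b) (q \<oplus>\<^bsub>P (Suc 0)\<^esub> r)"
      using qr a b by (simp add: d0.add P0.lact_add_left P0.ract_add_right P0.M.add_minus_add)
    from derivation_of_eq[OF f _ this] show ?thesis
      using derivation_of_eq[OF f a qr(1)] derivation_of_eq[OF f b qr(2)] qr a b
      by (simp add: f.add)
  qed
  have smult: "derivation_of f (c \<odot> a) = c \<odot> derivation_of f a" if a: "a \<in> carrier A" for a c
  proof -
    obtain q where q: "boundary_of a q" using boundary_of_exists a by blast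
    have "boundary_of (c \<odot> a) (c \<odot>\<^bsub>P (Suc 0)\<^esub> q)"
      using q a by (simp add: d0.smult P0.lact_smult_left P0.ract_smult_right P0.scale_minus)
    from derivation_of_eq[OF f _ this] show ?thesis
      using derivation_of_eq[OF f a q] q a by (simp add: f.smult regular_simps)
  qed
  have mult: "derivation_of f (a \<otimes> b) = derivation_of f a \<otimes> b \<oplus> a \<otimes> derivation_of f b"
    if a: "a \<in> carrier A" and b: "b \<in> carrier A" for a b
  proof -
    obtain q r where qr: "boundary_of a q" "boundary_of b r"
      using boundary_of_exists a b by blast
    have "d 0 (ract (P (Suc 0)) q b \<oplus>\<^bsub>P (Suc 0)\<^esub> lact (P (Suc 0)) a r) =
      (ract (P 0) (lact (P 0) a p) b \<ominus>\<^bsub>P 0\<^esub> ract (P 0) (ract (P 0) p a) b) \<oplus>\<^bsub>P 0\<^esub>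
      (lact (P 0) a (lact (P 0) b p) \<ominus>\<^bsub>P 0\<^esub> lact (P 0) a (ract (P 0) p b))"
      using qr a b by (simp add: d0.add d0.left d0.right P0.lact_minus P0.ract_minus)
    also have "\<dots> = (lact (P 0) a (lact (P 0) b p) \<ominus>\<^bsub>P 0\<^esub> lact (P 0) a (ract (P 0) p b)) \<oplus>\<^bsub>P 0\<^esub>
      (lact (P 0) a (ract (P 0) p b) \<ominus>\<^bsub>P 0\<^esub> ract (P 0) (ract (P 0) p a) b)"
      using a b by (simp add: P0.lact_ract P0.M.a_comm P0.M.minus_closed)
    also have "\<dots> = lact (P 0) (a \<otimes> b) p \<ominus>\<^bsub>P 0\<^esub> ract (P 0) p (a \<otimes> b)"
      using a b by (simp add: P0.M.minus_add_minus P0.lact_mult P0.ract_mult)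
    finally have "boundary_of (a \<otimes> b) (ract (P (Suc 0)) q b \<oplus>\<^bsub>P (Suc 0)\<^esub> lact (P (Suc 0)) a r)"
      using qr a b by simp
    from derivation_of_eq[OF f _ this] show ?thesis
      using derivation_of_eq[OF f a qr(1)] derivation_of_eq[OF f b qr(2)] qr a b
      by (simp add: f.add f.left f.right)
  qed
  show ?thesis using closed add smult mult by (auto simp: derivations_def)
qed

text \<open>
  The map \<open>x \<mapsto> f q + \<epsilon> x \<otimes> u\<close>, with \<open>q\<close> a lift of \<open>x - \<epsilon> x p\<close>, extends \<open>f\<close> to \<open>P 0\<close>. It visibly respects
  the left action. For the right action, a lift of \<open>x a - \<epsilon> x a p\<close> is \<open>q a - \<epsilon> x r\<close> with \<open>r\<close> over
  \<open>a p - p a\<close>, and \<open>f r = a u - u a\<close> is exactly what turns \<open>\<epsilon> x a u\<close> into \<open>\<epsilon> x u a\<close>.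
\<close>

lemma coboundary_of_inner:
  assumes f: "cocycle1 f" and u: "u \<in> carrier A"
    and inner: "\<And>a. a \<in> carrier A \<Longrightarrow> derivation_of f a = commutator a u"
  shows "f \<in> ext_coboundaries A P d (regular_bimodule A) (Suc 0)"
proof -
  interpret f: bimodule_map A "P (Suc 0)" "regular_bimodule A" f by (rule cocycle1_map[OF f])
  let ?lifts = "\<lambda>x q. q \<in> carrier (P (Suc 0)) \<and> d 0 q = x \<ominus>\<^bsub>P 0\<^esub> lact (P 0) (\<epsilon> x) p"
  define g where "g = (\<lambda>x\<in>carrier (P 0). f (SOME q. ?lifts x q) \<oplus> \<epsilon> x \<otimes> u)"
  have lifts_ex: "\<exists>q. ?lifts x q" if "x \<in> carrier (P 0)" for x
    using ker_eps[of "x \<ominus>\<^bsub>P 0\<^esub> lact (P 0) (\<epsilon> x) p"] that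
    by (auto simp: eps_rules regular_simps A.r_neg a_minus_def)
  have g_eq: "g x = f q \<oplus> \<epsilon> x \<otimes> u" if x: "x \<in> carrier (P 0)" and q: "?lifts x q" for x q
  proof -
    have "?lifts x (SOME q. ?lifts x q)" using lifts_ex[OF x] by (rule someI_ex)
    hence "f (SOME q. ?lifts x q) = f q" using q by (intro cocycle1_cong[OF f]) auto
    thus ?thesis using x by (simp add: g_def)
  qed
  have "g \<in> bimodule_hom A (P 0) (regular_bimodule A)"
    unfolding bimodule_hom_def
  proof (intro CollectI conjI ballI allI)
    have "g x \<in> carrier A" if x: "x \<in> carrier (P 0)" for x
    proof -
      obtain q where q: "?lifts x q" using lifts_ex[OF x] by blast
      show ?thesis using g_eq[OF x q] q x u f.closed[of q] by simp
    qed
    thus "g \<in> carrier (P 0) \<rightarrow>\<^sub>E carrier (regular_bimodule A)" by (auto simp: g_def)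
  next
    fix x y assume x: "x \<in> carrier (P 0)" and y: "y \<in> carrier (P 0)"
    obtain q r where q: "?lifts x q" and r: "?lifts y r" using lifts_ex x y by blast
    have l: "?lifts (x \<oplus>\<^bsub>P 0\<^esub> y) (q \<oplus>\<^bsub>P (Suc 0)\<^esub> r)"
      using q r x y by (simp add: d0.add eps_rules P0.lact_add_left P0.M.add_minus_add)
    have c: "f q \<in> carrier A" "f r \<in> carrier A" using q r f.closed by auto
    show "g (x \<oplus>\<^bsub>P 0\<^esub> y) = g x \<oplus>\<^bsub>regular_bimodule A\<^esub> g y"
      using g_eq[OF _ l] g_eq[OF x q] g_eq[OF y r] q r x y u c
      by (simp add: f.add eps_rules A.l_distr A.a_ac)
  next
    fix c x assume x: "x \<in> carrier (P 0)"
    obtain q where q: "?lifts x q" using lifts_ex x by blast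
    have l: "?lifts (c \<odot>\<^bsub>P 0\<^esub> x) (c \<odot>\<^bsub>P (Suc 0)\<^esub> q)"
      using q x by (simp add: d0.smult eps_rules P0.lact_smult_left P0.scale_minus)
    have cl: "f q \<in> carrier A" using q f.closed by auto
    show "g (c \<odot>\<^bsub>P 0\<^esub> x) = c \<odot>\<^bsub>regular_bimodule A\<^esub> g x"
      using g_eq[OF _ l] g_eq[OF x q] q x u cl
      by (simp add: f.smult eps_rules regular_simps smult_mult_left)
  next
    fix a x assume a: "a \<in> carrier A" and x: "x \<in> carrier (P 0)"
    obtain q where q: "?lifts x q" using lifts_ex x by blast
    have l: "?lifts (lact (P 0) a x) (lact (P (Suc 0)) a q)"
      using q x a by (simp add: d0.left eps_rules P0.lact_minus P0.lact_mult)
    have cl: "f q \<in> carrier A" using q f.closed by auto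
    show "g (lact (P 0) a x) = lact (regular_bimodule A) a (g x)"
      using g_eq[OF _ l] g_eq[OF x q] q x a u cl
      by (simp add: f.left eps_rules A.r_distr A.m_assoc)
  next
    fix a x assume a: "a \<in> carrier A" and x: "x \<in> carrier (P 0)"
    obtain q where q: "?lifts x q" using lifts_ex x by blast
    obtain r where r: "boundary_of a r" using boundary_of_exists a by blast
    \<comment> \<open>a lift of \<open>x a - \<epsilon> x a p\<close>, assembled from lifts of \<open>x - \<epsilon> x p\<close> and \<open>a p - p a\<close>\<close>
    let ?q = "ract (P (Suc 0)) q a \<ominus>\<^bsub>P (Suc 0)\<^esub> lact (P (Suc 0)) (\<epsilon> x) r"
    have "d 0 ?q = (ract (P 0) x a \<ominus>\<^bsub>P 0\<^esub> lact (P 0) (\<epsilon> x) (ract (P 0) p a)) \<ominus>\<^bsub>P 0\<^esub>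
       (lact (P 0) (\<epsilon> x) (lact (P 0) a p) \<ominus>\<^bsub>P 0\<^esub> lact (P 0) (\<epsilon> x) (ract (P 0) p a))"
      using q r x a by (simp add: d0.minus d0.left d0.right P0.lact_minus P0.ract_minus P0.lact_ract)
    also have "\<dots> = ract (P 0) x a \<ominus>\<^bsub>P 0\<^esub> lact (P 0) (\<epsilon> (ract (P 0) x a)) p"
      using x a by (simp add: P0.M.minus_minus_cancel eps_rules P0.lact_mult)
    finally have l: "?lifts (ract (P 0) x a) ?q" using q r x a by (simp add: P1.M.minus_closed)
    have cl: "f q \<in> carrier A" using q f.closed by auto
    have cancel: "v \<oplus> (w \<oplus> \<ominus> v) = w" if "v \<in> carrier A" "w \<in> carrier A" for v w
      using that A.r_neg2[of v w] A.a_comm[of w "\<ominus> v"] by simp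
    have "f r = a \<otimes> u \<ominus> u \<otimes> a"
      using inner[OF a] derivation_of_eq[OF f a r] by (simp add: commutator_def)
    hence "g (ract (P 0) x a) = (f q \<otimes> a \<ominus> \<epsilon> x \<otimes> (a \<otimes> u \<ominus> u \<otimes> a)) \<oplus> \<epsilon> x \<otimes> (a \<otimes> u)"
      using g_eq[OF _ l] q r x a u by (simp add: f.minus f.left f.right eps_rules regular_simps A.m_assoc)
    also have "\<dots> = g x \<otimes> a"
      using g_eq[OF x q] cl x a u cancel[of "\<epsilon> x \<otimes> (a \<otimes> u)" "\<epsilon> x \<otimes> (u \<otimes> a)"]
      by (simp add: a_minus_def A.r_distr A.l_distr A.m_assoc A.r_minus A.minus_add A.a_ac A.r_neg1 A.r_neg2)
    finally show "g (ract (P 0) x a) = ract (regular_bimodule A) (g x) a" by simp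
  qed
  moreover have "f = (\<lambda>y\<in>carrier (P (Suc 0)). g (d 0 y))"
  proof
    fix y show "f y = (\<lambda>y\<in>carrier (P (Suc 0)). g (d 0 y)) y"
    proof (cases "y \<in> carrier (P (Suc 0))")
      case True
      have z: "lact (P 0) \<zero> p = \<zero>\<^bsub>P 0\<^esub>"
        using P0.lact_smult_left[of \<zero> p 0] by (simp add: regular_simps P0.scale_0)
      have "?lifts (d 0 y) y" using True by (simp add: eps_d0 z a_minus_def)
      from g_eq[OF _ this] show ?thesis using True u f.closed[OF True] by (simp add: eps_d0)
    qed (simp add: f.ext)
  qed
  ultimately show ?thesis by auto
qed

lemma inner_of_coboundary:
  assumes f: "f \<in> ext_coboundaries A P d (regular_bimodule A) (Suc 0)"
  shows "cocycle1 f" "\<exists>u\<in>carrier A. \<forall>a\<in>carrier A. derivation_of f a = commutator a u"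
proof -
  obtain g where g: "g \<in> bimodule_hom A (P 0) (regular_bimodule A)"
    and fg: "f = (\<lambda>y\<in>carrier (P (Suc 0)). g (d 0 y))" using f by auto
  interpret g: bimodule_map A "P 0" "regular_bimodule A" g
    using g P bimodule_regular by (simp add: bimodule_map_def bimodule_map_axioms_def)
  interpret d1: bimodule_map A "P (Suc (Suc 0))" "P (Suc 0)" "d (Suc 0)"
    using P d by (simp add: bimodule_map_def bimodule_map_axioms_def)
  show coc: "cocycle1 f"
    unfolding ext_cocycles_def bimodule_hom_def fg
    using g.closed
    by (auto simp: d0.add d0.smult d0.left d0.right g.add g.smult g.left g.right d0_d1 g.zero)
  have gp: "g p \<in> carrier A" using g.closed[of p] by simp
  have "derivation_of f a = commutator a (g p)" if a: "a \<in> carrier A" for a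
  proof -
    obtain q where q: "boundary_of a q" using boundary_of_exists[OF a] by blast
    have "derivation_of f a = f q" by (rule derivation_of_eq[OF coc a q])
    also have "\<dots> = g (d 0 q)" using q by (simp add: fg)
    also have "\<dots> = commutator a (g p)"
      using q a by (simp add: commutator_def g.minus g.left g.right regular_simps)
    finally show ?thesis .
  qed
  thus "\<exists>u\<in>carrier A. \<forall>a\<in>carrier A. derivation_of f a = commutator a u" using gp by blast
qed

text \<open>
  The lift of \<open>\<epsilon>\<close> to the extension of class \<open>D\<close> has components \<open>\<epsilon>\<close> and \<open>k\<close>. On the kernel of \<open>\<epsilon>\<close> the
  twist of the right action disappears, so \<open>k\<close> is a bimodule map there, and
  \<open>k (a p - p a) = a k p - k p a + D a\<close>.
\<close>

lemma cocycle_of_derivation: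
  assumes D: "D \<in> derivations"
  shows "\<exists>f u. cocycle1 f \<and> u \<in> carrier A \<and> (\<forall>a\<in>carrier A. derivation_of f a = D a \<oplus> commutator a u)"
proof -
  let ?E = "derivation_extension D"
  have Dc: "D a \<in> carrier A" if "a \<in> carrier A" for a using D that by (auto simp: derivations_def)
  have E: "bimodule A ?E" by (rule bimodule_derivation_extension[OF D])
  have proj: "projective_bimodule A (P 0)" using resolution by (simp add: projective_resolution_def)
  let ?fst = "\<lambda>x\<in>carrier ?E. fst x"
  have fst: "?fst \<in> bimodule_hom A ?E (regular_bimodule A)"
    by (auto simp: bimodule_hom_def derivation_extension_def regular_simps Dc)
  \<comment> \<open>a pair is stored as a list with one triple, whose middle component is a dummy\<close>
  have "\<exists>h\<in>bimodule_hom A (P 0) ?E. \<forall>x\<in>carrier (P 0). ?fst (h x) = \<epsilon> x"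
  proof (rule projective_bimodule_lift[where e = "\<lambda>(x, y). [(x, undefined, y)]" and
        e' = "\<lambda>x. [(x, undefined, x)]", OF proj E bimodule_regular _ _ fst])
    show "?fst ` carrier ?E = carrier (regular_bimodule A)"
      by (auto simp: derivation_extension_def image_iff)
    show "inj_on (\<lambda>(x, y). [(x, undefined, y)]) (carrier ?E)" by (auto simp: inj_on_def)
    show "inj_on (\<lambda>x. [(x, undefined, x)]) (carrier (regular_bimodule A))" by (auto simp: inj_on_def)
    show "\<epsilon> \<in> bimodule_hom A (P 0) (regular_bimodule A)" by (rule eps.hom)
  qed
  then obtain h where h: "h \<in> bimodule_hom A (P 0) ?E"
    and fst_h: "\<And>x. x \<in> carrier (P 0) \<Longrightarrow> ?fst (h x) = \<epsilon> x" by blast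
  interpret h: bimodule_map A "P 0" ?E h
    using P E h by (simp add: bimodule_map_def bimodule_map_axioms_def)
  interpret d1: bimodule_map A "P (Suc (Suc 0))" "P (Suc 0)" "d (Suc 0)"
    using P d by (simp add: bimodule_map_def bimodule_map_axioms_def)
  define k where "k x = snd (h x)" for x
  have fst_h': "fst (h x) = \<epsilon> x" if "x \<in> carrier (P 0)" for x
    using fst_h[OF that] h.closed[OF that] by simp
  have h_eq: "h x = (\<epsilon> x, k x)" if "x \<in> carrier (P 0)" for x
    by (simp add: k_def fst_h'[OF that, symmetric])
  have kc: "k x \<in> carrier A" if "x \<in> carrier (P 0)" for x
    using h.closed[OF that] by (auto simp: k_def derivation_extension_def)
  have k_add: "k (x \<oplus>\<^bsub>P 0\<^esub> y) = k x \<oplus> k y" if "x \<in> carrier (P 0)" "y \<in> carrier (P 0)" for x y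
    using h.add[OF that] that by (simp add: derivation_extension_def h_eq)
  have k_smult: "k (c \<odot>\<^bsub>P 0\<^esub> x) = c \<odot> k x" if "x \<in> carrier (P 0)" for c x
    using h.smult[OF that] that by (simp add: derivation_extension_def h_eq)
  have k_left: "k (lact (P 0) a x) = a \<otimes> k x" if "a \<in> carrier A" "x \<in> carrier (P 0)" for a x
    using h.left[OF that] that by (simp add: derivation_extension_def h_eq)
  have k_right: "k (ract (P 0) x a) = k x \<otimes> a \<ominus> \<epsilon> x \<otimes> D a" if "a \<in> carrier A" "x \<in> carrier (P 0)" for a x
    using h.right[OF that] that by (simp add: derivation_extension_def h_eq)
  have k_zero: "k \<zero>\<^bsub>P 0\<^esub> = \<zero>" using k_smult[of "\<zero>\<^bsub>P 0\<^esub>" 0] kc[of "\<zero>\<^bsub>P 0\<^esub>"] by (simp add: P0.scale_0 regular_simps)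
  have k_neg: "k (\<ominus>\<^bsub>P 0\<^esub> x) = \<ominus> k x" if "x \<in> carrier (P 0)" for x
    using k_smult[of x "-1"] kc[of x] that reg.scale_minus_1[of "k x"]
    by (simp add: P0.scale_minus_1 regular_simps)
  have k_minus: "k (x \<ominus>\<^bsub>P 0\<^esub> y) = k x \<ominus> k y" if "x \<in> carrier (P 0)" "y \<in> carrier (P 0)" for x y
    using that by (simp add: a_minus_def k_add k_neg)
  define f where "f = (\<lambda>q\<in>carrier (P (Suc 0)). k (d 0 q))"
  have coc: "cocycle1 f"
    unfolding ext_cocycles_def bimodule_hom_def f_def
    by (auto simp: d0_d1 k_zero kc d0.add d0.smult d0.left d0.right k_add k_smult k_left k_right eps_d0 Dc a_minus_def)
  have "derivation_of f a = D a \<oplus> commutator a (k p)" if a: "a \<in> carrier A" for a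
  proof -
    obtain q where q: "boundary_of a q" using boundary_of_exists[OF a] by blast
    have "derivation_of f a = f q" by (rule derivation_of_eq[OF coc a q])
    also have "\<dots> = k (d 0 q)" using q by (simp add: f_def)
    also have "\<dots> = a \<otimes> k p \<ominus> (k p \<otimes> a \<ominus> D a)"
      using q a by (simp add: k_minus k_left k_right Dc)
    also have "\<dots> = D a \<oplus> commutator a (k p)"
      using a kc[of p] Dc[OF a] by (simp add: commutator_def a_minus_def A.minus_add A.a_ac)
    finally show ?thesis .
  qed
  thus ?thesis using coc kc[of p] by auto
qed

text \<open>
  The relation between a cocycle and its coordinates is ``the derivation of \<open>f\<close> is \<open>\<Delta> c\<close> up to an inner
  derivation''. Its kernel consists of the coboundaries by the two lemmas on inner derivations.
\<close>

theorem dim_HH1: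
  fixes S :: "'s set" and \<Delta> :: "('s \<Rightarrow> 'k) \<Rightarrow> 'a \<Rightarrow> 'a"
  assumes S: "finite S"
    and derivation: "\<And>c. c \<in> coords S \<Longrightarrow> \<Delta> c \<in> derivations"
    and add: "\<And>c c' a. c \<in> coords S \<Longrightarrow> c' \<in> coords S \<Longrightarrow> a \<in> carrier A \<Longrightarrow>
               \<Delta> (\<lambda>s. c s + c' s) a = \<Delta> c a \<oplus> \<Delta> c' a"
    and smult: "\<And>r c a. c \<in> coords S \<Longrightarrow> a \<in> carrier A \<Longrightarrow> \<Delta> (\<lambda>s. r * c s) a = r \<odot> \<Delta> c a"
    and total: "\<And>D. D \<in> derivations \<Longrightarrow> \<exists>c\<in>coords S. \<exists>u\<in>carrier A. \<forall>a\<in>carrier A.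
                  D a = \<Delta> c a \<oplus> commutator a u"
    and inner: "\<And>c u. c \<in> coords S \<Longrightarrow> u \<in> carrier A \<Longrightarrow>
                  (\<And>a. a \<in> carrier A \<Longrightarrow> \<Delta> c a = commutator a u) \<Longrightarrow> c = (\<lambda>s. 0)"
  shows "vectorspace.fin_dim class_ring (HH A P d 1)" "vectorspace.dim class_ring (HH A P d 1) = card S"
proof -
  let ?N = "regular_bimodule A" and ?B = "ext_coboundaries A P d (regular_bimodule A) (Suc 0)"
  define R where "R f c \<longleftrightarrow> c \<in> coords S \<and> (\<exists>u\<in>carrier A. \<forall>a\<in>carrier A.
      derivation_of f a = \<Delta> c a \<oplus> commutator a u)" for f c
  have \<Delta>c: "\<Delta> c a \<in> carrier A" if "c \<in> coords S" "a \<in> carrier A" for c a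
    using derivation[OF that(1)] that(2) by (auto simp: derivations_def)
  have \<Delta>0: "\<Delta> (\<lambda>s. 0) a = \<zero>" if "a \<in> carrier A" for a
    using smult[OF coords_zero that, of 0] \<Delta>c[OF coords_zero that] by (simp add: regular_simps)
  interpret Z: vectorspace class_ring "cocycle_space (Suc 0)" by (rule cocycle_space_vectorspace)
  have "vectorspace.fin_dim class_ring (quotient_module (cocycle_space (Suc 0)) ?B) \<and>
    vectorspace.dim class_ring (quotient_module (cocycle_space (Suc 0)) ?B) = card S"
  proof (rule quotient_by_linear_relation[where R = R and S = S])
    show "R (f \<oplus>\<^bsub>cocycle_space (Suc 0)\<^esub> f') (\<lambda>s. c s + c' s)"
      if f: "f \<in> carrier (cocycle_space (Suc 0))" "f' \<in> carrier (cocycle_space (Suc 0))"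
        and R: "R f c" "R f' c'" for f c f' c'
    proof -
      obtain u u' where c: "c \<in> coords S" "c' \<in> coords S" and u: "u \<in> carrier A" "u' \<in> carrier A"
        and eq: "\<And>a. a \<in> carrier A \<Longrightarrow> derivation_of f a = \<Delta> c a \<oplus> commutator a u"
          "\<And>a. a \<in> carrier A \<Longrightarrow> derivation_of f' a = \<Delta> c' a \<oplus> commutator a u'"
        using R by (auto simp: R_def)
      let ?g = "f \<oplus>\<^bsub>cocycle_space (Suc 0)\<^esub> f'"
      have g: "cocycle1 ?g" using Z.M.a_closed[OF f] by simp
      have "derivation_of ?g a = \<Delta> (\<lambda>s. c s + c' s) a \<oplus> commutator a (u \<oplus> u')"
        if a: "a \<in> carrier A" for a
      proof -
        obtain q where q: "boundary_of a q" using boundary_of_exists[OF a] by blast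
        have "derivation_of ?g a = derivation_of f a \<oplus> derivation_of f' a"
          using derivation_of_eq[OF g a q] derivation_of_eq[OF _ a q] f q by (simp add: hom_space_simps)
        thus ?thesis
          using a c u by (simp add: eq add commutator_add_right \<Delta>c A.a_ac)
      qed
      thus ?thesis unfolding R_def using c u by (auto intro: coords_add)
    qed
    show "R (r \<odot>\<^bsub>cocycle_space (Suc 0)\<^esub> f) (\<lambda>s. r * c s)"
      if f: "f \<in> carrier (cocycle_space (Suc 0))" and R: "R f c" for r f c
    proof -
      obtain u where c: "c \<in> coords S" and u: "u \<in> carrier A"
        and eq: "\<And>a. a \<in> carrier A \<Longrightarrow> derivation_of f a = \<Delta> c a \<oplus> commutator a u"
        using R by (auto simp: R_def)
      let ?g = "r \<odot>\<^bsub>cocycle_space (Suc 0)\<^esub> f"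
      have g: "cocycle1 ?g" using Z.smult_closed[OF _ f] by simp
      have "derivation_of ?g a = \<Delta> (\<lambda>s. r * c s) a \<oplus> commutator a (r \<odot> u)"
        if a: "a \<in> carrier A" for a
      proof -
        obtain q where q: "boundary_of a q" using boundary_of_exists[OF a] by blast
        have "derivation_of ?g a = r \<odot> derivation_of f a"
          using derivation_of_eq[OF g a q] derivation_of_eq[OF _ a q] f q by (simp add: hom_space_simps)
        thus ?thesis using a c u by (simp add: eq smult commutator_smult_right \<Delta>c regular_simps)
      qed
      thus ?thesis unfolding R_def using c u regular_simps(1)[OF u] by (auto intro: coords_smult)
    qed
    show "\<exists>c\<in>coords S. R f c" if "f \<in> carrier (cocycle_space (Suc 0))" for f
      using total[OF derivation_of_derivation[of f]] that by (auto simp: R_def)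
    show "\<exists>f\<in>carrier (cocycle_space (Suc 0)). R f c" if c: "c \<in> coords S" for c
      using cocycle_of_derivation[OF derivation[OF c]] c by (auto simp: R_def)
    show "R f (\<lambda>s. 0) \<longleftrightarrow> f \<in> ?B" if f: "f \<in> carrier (cocycle_space (Suc 0))" for f
    proof
      assume "R f (\<lambda>s. 0)"
      then obtain u where "u \<in> carrier A" "\<And>a. a \<in> carrier A \<Longrightarrow> derivation_of f a = commutator a u"
        by (auto simp: R_def \<Delta>0)
      thus "f \<in> ?B" using coboundary_of_inner f by simp
    next
      assume "f \<in> ?B"
      thus "R f (\<lambda>s. 0)" using inner_of_coboundary(2)[of f] by (auto simp: R_def \<Delta>0 coords_zero)
    qed
    show "c = (\<lambda>s. 0)" if c: "c \<in> coords S" and R: "R \<zero>\<^bsub>cocycle_space (Suc 0)\<^esub> c" for c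
    proof -
      have z: "cocycle1 \<zero>\<^bsub>cocycle_space (Suc 0)\<^esub>" using Z.M.zero_closed by simp
      obtain u where u: "u \<in> carrier A"
        and eq: "\<And>a. a \<in> carrier A \<Longrightarrow> derivation_of \<zero>\<^bsub>cocycle_space (Suc 0)\<^esub> a = \<Delta> c a \<oplus> commutator a u"
        using R by (auto simp: R_def)
      have "\<Delta> c a = commutator a (\<ominus> u)" if a: "a \<in> carrier A" for a
      proof -
        obtain q where q: "boundary_of a q" using boundary_of_exists[OF a] by blast
        have "\<Delta> c a \<oplus> commutator a u = \<zero>"
          using derivation_of_eq[OF z a q] eq[OF a] q by (simp add: hom_space_simps)
        hence "\<ominus> commutator a u = \<Delta> c a" using a u c \<Delta>c by (intro A.minus_equality) auto
        thus ?thesis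
          using a u by (simp add: commutator_def A.r_minus A.l_minus a_minus_def A.minus_add A.a_ac)
      qed
      thus ?thesis using inner[OF c] u by blast
    qed
    show "?B \<subseteq> carrier (cocycle_space (Suc 0))" using inner_of_coboundary(1) by auto
  qed (rule S cocycle_space_vectorspace)+
  thus "vectorspace.fin_dim class_ring (HH A P d 1)" "vectorspace.dim class_ring (HH A P d 1) = card S"
    by (simp_all add: HH_def ext_space_def)
qed

end

section \<open>Spanning trees and potentials\<close>

lemma connected_crossing_arc:
  assumes "Digraph_Component.connected Q" and X: "X \<subseteq> verts Q" "x \<in> X" "X \<noteq> verts Q"
  shows "\<exists>a\<in>arcs Q. tail Q a \<in> X \<longleftrightarrow> head Q a \<notin> X"
proof (rule ccontr)
  assume no: "\<not> (\<exists>a\<in>arcs Q. tail Q a \<in> X \<longleftrightarrow> head Q a \<notin> X)"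
  obtain y where y: "y \<in> verts Q" "y \<notin> X" using X by blast
  have "x \<rightarrow>\<^sup>*\<^bsub>with_proj (mk_symmetric Q)\<^esub> y"
    using assms(1) X y unfolding Digraph_Component.connected_def
    by (auto simp: strongly_connected_def mk_symmetric_def)
  hence "(x, y) \<in> (arcs_ends (with_proj (mk_symmetric Q)))\<^sup>*"
    by (rule reachable_rtranclI)
  hence "y \<in> X"
  proof (induction rule: rtrancl_induct)
    case base
    show ?case by (rule X(2))
  next
    case (step y z)
    then obtain a where "a \<in> arcs Q" "(y, z) = (tail Q a, head Q a) \<or> (y, z) = (head Q a, tail Q a)"
      by (auto simp: arcs_ends_def mk_symmetric_def arc_to_ends_def)
    thus ?case using no step.IH by auto
  qed
  thus False using y by simp
qed

text \<open>
  Stated through what a spanning tree \<open>T\<close> is used for: every function on \<open>T\<close> is the difference of a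
  potential, and the potential is unique up to a constant. The tree grows one vertex at a time, along
  an arrow that leaves the part already reached; the new value of the potential is then forced.
\<close>

lemma spanning_tree_potential:
  fixes Q :: "('v, 'e) pre_digraph"
  assumes fin: "fin_digraph Q" and con: "Digraph_Component.connected Q"
  shows "\<exists>T\<subseteq>arcs Q. card T + 1 = card (verts Q) \<and>
    (\<forall>c :: 'e \<Rightarrow> 'k::field. \<exists>v. \<forall>a\<in>T. v (head Q a) - v (tail Q a) = c a) \<and>
    (\<forall>v :: 'v \<Rightarrow> 'k. (\<forall>a\<in>T. v (head Q a) = v (tail Q a)) \<longrightarrow> (\<exists>k. \<forall>x\<in>verts Q. v x = k))"
proof -
  interpret fin_digraph Q by fact
  define tree where "tree X T \<longleftrightarrow> X \<subseteq> verts Q \<and> X \<noteq> {} \<and> T \<subseteq> arcs Q \<and> card T + 1 = card X \<and>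
    (\<forall>a\<in>T. tail Q a \<in> X \<and> head Q a \<in> X) \<and>
    (\<forall>c :: 'e \<Rightarrow> 'k. \<exists>v. \<forall>a\<in>T. v (head Q a) - v (tail Q a) = c a) \<and>
    (\<forall>v :: 'v \<Rightarrow> 'k. (\<forall>a\<in>T. v (head Q a) = v (tail Q a)) \<longrightarrow> (\<exists>k. \<forall>x\<in>X. v x = k))" for X T
  have ne: "verts Q \<noteq> {}"
    using con by (auto simp: Digraph_Component.connected_def strongly_connected_def mk_symmetric_def)
  have "\<exists>X T. tree X T \<and> card X = Suc n" if "Suc n \<le> card (verts Q)" for n
    using that
  proof (induction n)
    case 0
    obtain x where "x \<in> verts Q" using ne by blast
    hence "tree {x} {}" by (auto simp: tree_def)
    thus ?case by (intro exI[of _ "{x}"] exI[of _ "{}"]) simp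
  next
    case (Suc n)
    then obtain X T where t: "tree X T" and cX: "card X = Suc n" by auto
    note t' = t[unfolded tree_def]
    note X = t'[THEN conjunct1] t'[THEN conjunct2, THEN conjunct1]
    note T = t'[THEN conjunct2, THEN conjunct2, THEN conjunct1]
      t'[THEN conjunct2, THEN conjunct2, THEN conjunct2, THEN conjunct1]
    note t'' = t'[THEN conjunct2, THEN conjunct2, THEN conjunct2, THEN conjunct2]
    note ends = t''[THEN conjunct1, THEN bspec]
    note potential = t''[THEN conjunct2, THEN conjunct1, THEN spec]
    note const_on = t''[THEN conjunct2, THEN conjunct2, THEN spec, THEN mp]
    have finX: "finite X" using X(1) by (rule finite_subset) simp
    have finT: "finite T" using T(1) by (rule finite_subset) simp
    have "X \<noteq> verts Q" using cX Suc.prems by auto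
    then obtain a where a: "a \<in> arcs Q" "tail Q a \<in> X \<longleftrightarrow> head Q a \<notin> X"
      using connected_crossing_arc[OF con X(1)] X(2) by blast
    \<comment> \<open>the end of \<open>a\<close> outside \<open>X\<close>\<close>
    define y where "y = (if tail Q a \<in> X then head Q a else tail Q a)"
    have y: "y \<in> verts Q" "y \<notin> X" using a by (auto simp: y_def)
    have aT: "a \<notin> T" using ends a by blast
    have "tree (insert y X) (insert a T)"
      unfolding tree_def
    proof (intro conjI allI impI)
      show "card (insert a T) + 1 = card (insert y X)"
        using T y aT finX finT by simp
      show "\<forall>b\<in>insert a T. tail Q b \<in> insert y X \<and> head Q b \<in> insert y X"
        using ends a by (auto simp: y_def)
    next
      fix c :: "'e \<Rightarrow> 'k"
      obtain v where v: "\<forall>b\<in>T. v (head Q b) - v (tail Q b) = c b"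
        using potential[of c] by (rule exE)
      let ?v = "v(y := if tail Q a \<in> X then v (tail Q a) + c a else v (head Q a) - c a)"
      have "?v (head Q b) - ?v (tail Q b) = c b" if "b \<in> T" for b
      proof -
        have "tail Q b \<in> X" "head Q b \<in> X" using ends that by auto
        hence "tail Q b \<noteq> y" "head Q b \<noteq> y" using y by auto
        thus ?thesis using v that by simp
      qed
      moreover have "?v (head Q a) - ?v (tail Q a) = c a"
      proof (cases "tail Q a \<in> X")
        case True
        hence "y = head Q a" "tail Q a \<noteq> y" using y(2) by (auto simp: y_def)
        thus ?thesis using True by simp
      next
        case False
        hence "y = tail Q a" "head Q a \<noteq> y" using y(2) a(2) by (auto simp: y_def)
        thus ?thesis using False by simp
      qed
      ultimately show "\<exists>v. \<forall>b\<in>insert a T. v (head Q b) - v (tail Q b) = c b"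
        by (intro exI[of _ ?v] ballI) (erule insertE, simp only:, assumption)
    next
      fix v :: "'v \<Rightarrow> 'k" assume v: "\<forall>b\<in>insert a T. v (head Q b) = v (tail Q b)"
      hence "\<forall>b\<in>T. v (head Q b) = v (tail Q b)" by simp
      from const_on[OF this] obtain k where k: "\<forall>x\<in>X. v x = k" by (rule exE)
      have "v y = k" using v k a by (auto simp: y_def)
      thus "\<exists>k. \<forall>x\<in>insert y X. v x = k" using k by blast
    qed (use T X y a in auto)
    thus ?case using y finX cX by (intro exI[of _ "insert y X"] exI[of _ "insert a T"]) simp
  qed
  from this[of "card (verts Q) - 1"] obtain X T where t: "tree X T" and "card X = card (verts Q)"
    using ne by (metis One_nat_def Suc_pred card_gt_0_iff finite_verts le_refl)
  moreover note t' = t[unfolded tree_def]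
  moreover have "X \<subseteq> verts Q" by (rule t'[THEN conjunct1])
  ultimately have X: "X = verts Q" using card_subset_eq[of "verts Q" X] by simp
  show ?thesis
    using t'[unfolded X, THEN conjunct2, THEN conjunct2]
    by (elim conjE) (intro exI[of _ T] conjI)
qed

section \<open>The algebra of nonzero paths\<close>

definition single :: "'p \<Rightarrow> 'p \<Rightarrow> 'k::field" where
  "single p = (\<lambda>q. if q = p then 1 else 0)"

lemma single_apply: "single p q = (if q = p then 1 else 0)"
  by (simp add: single_def)

text \<open>
  The combinatorial core of a quadratic string algebra: \<open>ok a b\<close> says that the arrows \<open>a\<close> and \<open>b\<close>
  compose to a nonzero path. Nonzero paths are those whose consecutive arrows are related by \<open>ok\<close>, and
  there are finitely many of them.
\<close>

locale string_quiver = fin_digraph Q for Q :: "('v, 'e) pre_digraph" +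
  fixes ok :: "'e \<Rightarrow> 'e \<Rightarrow> bool"
  assumes connected: "Digraph_Component.connected Q"
    and ok_arcs: "ok a b \<Longrightarrow> a \<in> arcs Q \<and> b \<in> arcs Q \<and> head Q a = tail Q b"
    and ok_right_unique: "ok a b \<Longrightarrow> ok a b' \<Longrightarrow> b = b'"
    and ok_left_unique: "ok a b \<Longrightarrow> ok a' b \<Longrightarrow> a = a'"
    and finite_ok: "finite {l. set l \<subseteq> arcs Q \<and> successively ok l}"
begin

definition endpoint :: "'v \<Rightarrow> 'e list \<Rightarrow> 'v" where
  "endpoint u l = (if l = [] then u else head Q (last l))"

text \<open>
  These paths represent a basis of the algebra.
\<close>

definition NP :: "('v \<times> 'e list) set" where
  "NP = {(u, l). u \<in> verts Q \<and> set l \<subseteq> arcs Q \<and> successively ok l \<and> (l \<noteq> [] \<longrightarrow> u = tail Q (hd l))}"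

text \<open>
  The product of the path algebra, cut off to nonzero paths. On coefficient functions supported in \<open>NP\<close>
  this is the product of the quotient by the paths outside \<open>NP\<close>.
\<close>

definition mul :: "('v \<times> 'e list \<Rightarrow> 'k::field) \<Rightarrow> ('v \<times> 'e list \<Rightarrow> 'k) \<Rightarrow> 'v \<times> 'e list \<Rightarrow> 'k" where
  "mul f g = (\<lambda>(u, l). if (u, l) \<in> NP
     then \<Sum>i\<le>length l. f (u, take i l) * g (endpoint u (take i l), drop i l) else 0)"

abbreviation vert :: "'v \<Rightarrow> 'v \<times> 'e list \<Rightarrow> 'k::field" where "vert x \<equiv> single (x, [])"
abbreviation arr :: "'e \<Rightarrow> 'v \<times> 'e list \<Rightarrow> 'k::field" where "arr a \<equiv> single (tail Q a, [a])"
abbreviation K :: "('v \<times> 'e list \<Rightarrow> 'k::field) set" where "K \<equiv> coords NP"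

lemma endpoint_simps [simp]: "endpoint u [] = u" "endpoint u (a # l) = endpoint (head Q a) l"
  "endpoint u (l @ [a]) = head Q a"
  by (auto simp: endpoint_def)

lemma endpoint_append: "endpoint u (l @ l') = endpoint (endpoint u l) l'"
  by (auto simp: endpoint_def)

lemma NP_Nil [simp]: "(u, []) \<in> NP \<longleftrightarrow> u \<in> verts Q" by (auto simp: NP_def)

lemma NP_Cons: "(u, a # l) \<in> NP \<longleftrightarrow>
    a \<in> arcs Q \<and> u = tail Q a \<and> (head Q a, l) \<in> NP \<and> (l \<noteq> [] \<longrightarrow> ok a (hd l))"
  using ok_arcs by (cases l) (auto simp: NP_def)

lemma NP_append: "(u, l @ l') \<in> NP \<longleftrightarrow>
    (u, l) \<in> NP \<and> (endpoint u l, l') \<in> NP \<and> (l \<noteq> [] \<longrightarrow> l' \<noteq> [] \<longrightarrow> ok (last l) (hd l'))"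
proof (induction l arbitrary: u)
  case Nil
  show ?case by (auto simp: NP_def)
next
  case (Cons a l)
  show ?case by (cases "l = []") (auto simp: NP_Cons Cons.IH)
qed

lemma NP_snoc: "(u, l @ [a]) \<in> NP \<longleftrightarrow>
    a \<in> arcs Q \<and> (u, l) \<in> NP \<and> endpoint u l = tail Q a \<and> (l \<noteq> [] \<longrightarrow> ok (last l) a)"
  by (auto simp: NP_append NP_Cons)

lemma NP_take: "(u, l) \<in> NP \<Longrightarrow> (u, take i l) \<in> NP"
  and NP_drop: "(u, l) \<in> NP \<Longrightarrow> (endpoint u (take i l), drop i l) \<in> NP"
  using NP_append[of u "take i l" "drop i l"] by auto

lemma finite_NP: "finite NP"
proof -
  have "NP \<subseteq> verts Q \<times> {l. set l \<subseteq> arcs Q \<and> successively ok l}" by (auto simp: NP_def)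
  thus ?thesis by (rule finite_subset) (simp add: finite_ok)
qed

text \<open>
  Otherwise all powers of the word \<open>l\<close> would be nonzero paths, and there would be infinitely many.
\<close>

lemma no_cycle:
  assumes "(u, l) \<in> NP" "l \<noteq> []" "ok (last l) (hd l)"
  shows False
proof -
  let ?L = "\<lambda>n. concat (replicate n l)"
  have l: "set l \<subseteq> arcs Q" "successively ok l" using assms(1) by (auto simp: NP_def)
  \<comment> \<open>the head of the power is carried along to check the junction with the next copy of \<open>l\<close>\<close>
  have good: "set (?L n) \<subseteq> arcs Q \<and> successively ok (?L n) \<and> (n > 0 \<longrightarrow> ?L n \<noteq> [] \<and> hd (?L n) = hd l)" for n
  proof (induction n)
    case 0
    show ?case by simp
  next
    case (Suc n)
    have "?L (Suc n) = l @ ?L n" by simp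
    moreover have "successively ok (l @ ?L n)"
      unfolding successively_append_iff
      using Suc.IH l assms(3) by (cases "n = 0") simp_all
    moreover have "set (l @ ?L n) \<subseteq> arcs Q"
      using Suc.IH l(1) by (simp only: set_append Un_least)
    ultimately show ?case using assms(2) by simp
  qed
  let ?G = "{l. set l \<subseteq> arcs Q \<and> successively ok l}"
  obtain N where N: "\<And>n. n \<in> length ` ?G \<Longrightarrow> n \<le> N"
    using finite_imageI[OF finite_ok, of length] by (meson finite_nat_set_iff_bounded_le)
  have "?L (Suc N) \<in> ?G" using good[of "Suc N"] by (intro CollectI) (elim conjE, intro conjI)
  hence "length (?L (Suc N)) \<le> N" by (intro N imageI)
  moreover have "length (?L n) = n * length l" for n by (induction n) simp_all
  moreover have "Suc N * length l \<ge> Suc N" using assms(2) by (cases l) simp_all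
  ultimately show False by simp
qed

lemma not_ok_self: "\<not> ok a a"
proof
  assume "ok a a"
  moreover from this have "(tail Q a, [a]) \<in> NP" using ok_arcs by (auto simp: NP_Cons)
  ultimately show False using no_cycle[of "tail Q a" "[a]"] by simp
qed

lemma starts_and_ends:
  assumes "(u, a # l) \<in> NP" "l \<noteq> []" shows "last l \<noteq> a"
proof
  assume "last l = a"
  moreover have "(head Q a, l) \<in> NP" "ok a (hd l)" using assms by (auto simp: NP_Cons)
  ultimately show False using no_cycle assms(2) by metis
qed

lemma ends_and_starts:
  assumes "(u, l @ [a]) \<in> NP" "l \<noteq> []" shows "hd l \<noteq> a"
proof
  assume "hd l = a"
  then obtain l' where l: "l = a # l'" using assms(2) by (cases l) auto
  show False using starts_and_ends[of u a "l' @ [a]"] assms(1) unfolding l by simp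
qed

lemma mul_coords [simp]: "mul f g \<in> K"
  by (auto simp: mul_def coords_def)

lemma single_coords [simp]: "p \<in> NP \<Longrightarrow> single p \<in> K"
  by (auto simp: single_def coords_def)

lemma arr_coords [simp]: "a \<in> arcs Q \<Longrightarrow> arr a \<in> K"
  by (rule single_coords) (simp add: NP_Cons)

lemma mul_add_left: "mul (\<lambda>p. f p + g p) h = (\<lambda>p. mul f h p + mul g h p)"
  and mul_add_right: "mul h (\<lambda>p. f p + g p) = (\<lambda>p. mul h f p + mul h g p)"
  by (simp_all add: mul_def fun_eq_iff distrib_left distrib_right sum.distrib)

lemma mul_smult_left: "mul (\<lambda>p. r * f p) h = (\<lambda>p. r * mul f h p)"
  and mul_smult_right: "mul h (\<lambda>p. r * f p) = (\<lambda>p. r * mul h f p)"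
  by (simp_all add: mul_def fun_eq_iff sum_distrib_left mult.assoc mult.left_commute)

lemma mul_zero_left [simp]: "mul (\<lambda>p. 0) h = (\<lambda>p. 0)"
  and mul_zero_right [simp]: "mul h (\<lambda>p. 0) = (\<lambda>p. 0)"
  by (auto simp: mul_def fun_eq_iff)

lemma mul_vert_left: "f \<in> K \<Longrightarrow> mul (vert x) f (u, l) = (if u = x then f (u, l) else 0)"
proof -
  assume f: "f \<in> K"
  have "(\<Sum>i\<le>length l. vert x (u, take i l) * f (endpoint u (take i l), drop i l)) =
    (\<Sum>i\<le>length l. if i = 0 then (if u = x then f (u, l) else 0) else 0)"
    by (intro sum.cong) (auto simp: single_def)
  thus ?thesis using f by (auto simp: mul_def coords_def)
qed

lemma mul_vert_right: "f \<in> K \<Longrightarrow> mul f (vert x) (u, l) = (if endpoint u l = x then f (u, l) else 0)"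
proof -
  assume f: "f \<in> K"
  have "(\<Sum>i\<le>length l. f (u, take i l) * vert x (endpoint u (take i l), drop i l)) =
    (\<Sum>i\<le>length l. if i = length l then (if endpoint u l = x then f (u, l) else 0) else 0)"
    by (intro sum.cong) (auto simp: single_def)
  thus ?thesis using f by (auto simp: mul_def coords_def)
qed

text \<open>
  Multiplying by an arrow shifts coefficients: only the cut after the first arrow contributes. All
  computations with derivations reduce to this lemma and its mirror image.
\<close>

lemma mul_arr_left: "mul (arr a) f (u, l) =
    (if (u, l) \<in> NP \<and> l \<noteq> [] \<and> hd l = a then f (head Q a, tl l) else 0)"
proof (cases l)
  case Nil
  thus ?thesis by (auto simp: mul_def single_def)
next
  case (Cons b l')
  have "(\<Sum>i\<le>length l. arr a (u, take i l) * f (endpoint u (take i l), drop i l)) =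
    (\<Sum>i\<le>length l'. arr a (u, b # take i l') * f (endpoint (head Q b) (take i l'), drop i l'))"
    unfolding Cons by (simp add: sum.atMost_Suc_shift single_def del: sum.atMost_Suc)
  also have "\<dots> = (\<Sum>i\<le>length l'. if i = 0 then (if u = tail Q a \<and> a = b then f (head Q a, l') else 0) else 0)"
    by (intro sum.cong) (auto simp: single_def)
  finally show ?thesis unfolding Cons by (auto simp: mul_def NP_Cons)
qed

lemma mul_arr_right: "mul f (arr a) (u, l) =
    (if (u, l) \<in> NP \<and> l \<noteq> [] \<and> last l = a then f (u, butlast l) else 0)"
proof (cases l rule: rev_cases)
  case Nil
  thus ?thesis by (auto simp: mul_def single_def)
next
  case (snoc l' b)
  let ?t = "\<lambda>i. f (u, take i l) * arr a (endpoint u (take i l), drop i l)"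
  have "?t (Suc (length l')) = 0" by (simp add: snoc single_def)
  hence "(\<Sum>i\<le>length l. ?t i) = (\<Sum>i\<le>length l'. ?t i)" by (simp only: snoc length_append_singleton sum.atMost_Suc add_0_right)
  also have "\<dots> = (\<Sum>i\<le>length l'. if i = length l' then
      (if endpoint u l' = tail Q a \<and> a = b then f (u, l') else 0) else 0)"
  proof (rule sum.cong[OF refl])
    fix i assume i: "i \<in> {..length l'}"
    have "take i l = take i l'" "drop i l = drop i l' @ [b]" using i by (simp_all add: snoc)
    thus "?t i = (if i = length l' then (if endpoint u l' = tail Q a \<and> a = b then f (u, l') else 0) else 0)"
      using i by (auto simp: single_def)
  qed
  also have "\<dots> = (if endpoint u l' = tail Q a \<and> a = b then f (u, l') else 0)" by simp
  finally have sum_eq: "(\<Sum>i\<le>length l. ?t i) = (if endpoint u l' = tail Q a \<and> a = b then f (u, l') else 0)" .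
  have "mul f (arr a) (u, l) = (if (u, l) \<in> NP then \<Sum>i\<le>length l. ?t i else 0)"
    by (simp add: mul_def)
  moreover have "endpoint u l' = tail Q b" if "(u, l) \<in> NP"
    using that unfolding snoc NP_snoc by blast
  ultimately show ?thesis unfolding sum_eq by (auto simp: snoc)
qed

lemma vert_mul_arr: "a \<in> arcs Q \<Longrightarrow> mul (vert (tail Q a)) (arr a) = arr a"
  and arr_mul_vert: "a \<in> arcs Q \<Longrightarrow> mul (arr a) (vert (head Q a)) = arr a"
  by (auto simp: fun_eq_iff mul_vert_left mul_arr_left single_apply NP_Cons neq_Nil_conv)

lemma mul_mismatch:
  assumes "\<And>u l. f (u, l) \<noteq> 0 \<Longrightarrow> endpoint u l = x" and "\<And>u l. g (u, l) \<noteq> 0 \<Longrightarrow> u \<noteq> x"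
  shows "mul f g = (\<lambda>p. 0)"
  using assms by (fastforce simp: mul_def fun_eq_iff intro: sum.neutral)

text \<open>
  Both sides sum over the ways of cutting a path into three pieces. Pieces of a nonzero path are nonzero,
  so the cut-off does not interfere.
\<close>

lemma mul_assoc: "mul (mul f g) h = mul f (mul g h)"
proof -
  have "mul (mul f g) h (u, l) = mul f (mul g h) (u, l)" if p: "(u, l) \<in> NP" for u l
  proof -
    let ?t = "\<lambda>i j. f (u, take i l) * g (endpoint u (take i l), take j (drop i l)) *
      h (endpoint u (take (i + j) l), drop (i + j) l)"
    have "mul (mul f g) h (u, l) = (\<Sum>j\<le>length l. \<Sum>i\<le>j. ?t i (j - i))"
    proof -
      have "mul f g (u, take j l) * h (endpoint u (take j l), drop j l) = (\<Sum>i\<le>j. ?t i (j - i))"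
        if "j \<le> length l" for j
        using that NP_take[OF p]
        by (auto simp: mul_def sum_distrib_right min_def take_drop intro!: sum.cong)
      thus ?thesis using p by (simp add: mul_def[of "mul f g" h])
    qed
    \<comment> \<open>\<open>i\<close> and \<open>j\<close> are the lengths of the first two pieces\<close>
    also have "\<dots> = (\<Sum>(i, j)\<in>{(i, j). i + j \<le> length l}. ?t i j)"
      by (rule sum.triangle_reindex_eq[symmetric])
    also have "\<dots> = (\<Sum>i\<le>length l. \<Sum>j\<le>length l - i. ?t i j)"
      by (auto simp: sum.Sigma intro!: sum.cong)
    also have "\<dots> = mul f (mul g h) (u, l)"
    proof -
      have "f (u, take i l) * mul g h (endpoint u (take i l), drop i l) = (\<Sum>j\<le>length l - i. ?t i j)"
        if "i \<le> length l" for i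
      proof -
        have "endpoint (endpoint u (take i l)) (take j (drop i l)) = endpoint u (take (i + j) l)" for j
          by (simp add: endpoint_append[symmetric] take_add)
        thus ?thesis using NP_drop[OF p, of i]
          by (auto simp: mul_def sum_distrib_left mult.assoc add.commute intro!: sum.cong)
      qed
      thus ?thesis using p by (simp add: mul_def[of f "mul g h"])
    qed
    finally show ?thesis .
  qed
  thus ?thesis by (force simp: fun_eq_iff mul_def)
qed

lemma single_Cons:
  assumes "(u, a # l) \<in> NP" shows "single (u, a # l) = mul (arr a) (single (head Q a, l))"
proof -
  have "u = tail Q a" using assms by (simp add: NP_Cons)
  moreover have "single (u, a # l) (x, m) = mul (arr a) (single (head Q a, l)) (x, m)" for x m
    unfolding mul_arr_left using assms \<open>u = tail Q a\<close> by (cases m) (auto simp: single_def NP_Cons)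
  ultimately show ?thesis by (auto simp: fun_eq_iff)
qed

lemma span_induct [consumes 1, case_names zero add smult single]:
  assumes f: "f \<in> (K :: ('v \<times> 'e list \<Rightarrow> 'k::field) set)"
    and "X (\<lambda>p. 0)"
    and "\<And>f g. f \<in> K \<Longrightarrow> g \<in> K \<Longrightarrow> X f \<Longrightarrow> X g \<Longrightarrow> X (\<lambda>p. f p + g p)"
    and "\<And>r f. f \<in> K \<Longrightarrow> X f \<Longrightarrow> X (\<lambda>p. r * f p)"
    and "\<And>p. p \<in> NP \<Longrightarrow> X (single p)"
  shows "X f"
proof -
  have "X f" if "finite S" "f \<in> coords S" "S \<subseteq> NP" for S and f :: "'v \<times> 'e list \<Rightarrow> 'k"
    using that
  proof (induction S arbitrary: f rule: finite_induct)
    case empty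
    hence "f = (\<lambda>p. 0)" by (auto simp: coords_def)
    thus ?case using assms(2) by simp
  next
    case (insert q S)
    let ?g = "\<lambda>p. if p = q then 0 else f p"
    have g: "?g \<in> coords S" using insert.prems by (auto simp: coords_def)
    hence gX: "X ?g" using insert by auto
    have "S \<subseteq> NP" using insert.prems by simp
    hence gK: "?g \<in> K" using g unfolding coords_def by blast
    have q: "q \<in> NP" using insert.prems by simp
    have "X (\<lambda>p. ?g p + f q * single q p)"
      using assms(3)[OF gK coords_smult[OF single_coords[OF q]] gX assms(4)[OF single_coords[OF q] assms(5)[OF q]]] .
    moreover have "(\<lambda>p. ?g p + f q * single q p) = f" by (auto simp: single_def)
    ultimately show ?case by simp
  qed
  thus ?thesis using f finite_NP by blast
qed

text \<open>
  The vertices and the arrows generate the algebra.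
\<close>

lemma generation_induct [consumes 1, case_names zero add smult mul vert arr]:
  assumes f: "f \<in> (K :: ('v \<times> 'e list \<Rightarrow> 'k::field) set)"
    and "X (\<lambda>p. 0)"
    and "\<And>f g. f \<in> K \<Longrightarrow> g \<in> K \<Longrightarrow> X f \<Longrightarrow> X g \<Longrightarrow> X (\<lambda>p. f p + g p)"
    and "\<And>r f. f \<in> K \<Longrightarrow> X f \<Longrightarrow> X (\<lambda>p. r * f p)"
    and mul: "\<And>f g. f \<in> K \<Longrightarrow> g \<in> K \<Longrightarrow> X f \<Longrightarrow> X g \<Longrightarrow> X (mul f g)"
    and vert: "\<And>x. x \<in> verts Q \<Longrightarrow> X (vert x)"
    and arr: "\<And>a. a \<in> arcs Q \<Longrightarrow> X (arr a)"
  shows "X f"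
  using f
proof (induction rule: span_induct)
  case (single p)
  have "X (single (u, l))" if "(u, l) \<in> NP" for u l
    using that
  proof (induction l arbitrary: u)
    case (Cons a l)
    have a: "a \<in> arcs Q" "(head Q a, l) \<in> NP" using Cons.prems by (auto simp: NP_Cons)
    show ?case unfolding single_Cons[OF Cons.prems]
      by (intro mul arr Cons.IH) (use a in auto)
  qed (simp add: vert)
  thus ?case using single by (cases p) auto
qed (use assms in blast)+

definition comm :: "('v \<times> 'e list \<Rightarrow> 'k::field) \<Rightarrow> ('v \<times> 'e list \<Rightarrow> 'k) \<Rightarrow> 'v \<times> 'e list \<Rightarrow> 'k" where
  "comm f u = (\<lambda>p. mul f u p - mul u f p)"

text \<open>
  In terms of the algebra: every arrow annihilates the path from the left, respectively from the right.
\<close>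

definition left_maximal :: "'v \<times> 'e list \<Rightarrow> bool" where
  "left_maximal p \<longleftrightarrow> \<not> (\<exists>b\<in>arcs Q. head Q b = fst p \<and> (tail Q b, b # snd p) \<in> NP)"

definition right_maximal :: "'v \<times> 'e list \<Rightarrow> bool" where
  "right_maximal p \<longleftrightarrow> \<not> (\<exists>b\<in>arcs Q. tail Q b = endpoint (fst p) (snd p) \<and> (fst p, snd p @ [b]) \<in> NP)"

lemma constant_on_verts:
  assumes "\<And>a. a \<in> arcs Q \<Longrightarrow> v (head Q a) = v (tail Q a)"
  shows "\<exists>k. \<forall>x\<in>verts Q. v x = k"
proof -
  have ne: "verts Q \<noteq> {}"
    using connected by (auto simp: Digraph_Component.connected_def strongly_connected_def mk_symmetric_def)
  then obtain x where x: "x \<in> verts Q" by blast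
  let ?X = "{y \<in> verts Q. v y = v x}"
  have "?X = verts Q"
  proof (rule ccontr)
    assume "?X \<noteq> verts Q"
    then obtain a where "a \<in> arcs Q" "tail Q a \<in> ?X \<longleftrightarrow> head Q a \<notin> ?X"
      using connected_crossing_arc[OF connected, of ?X x] x by auto
    thus False using assms[of a] by auto
  qed
  thus ?thesis by blast
qed

section \<open>The centre\<close>

definition central_cycles :: "('v \<times> 'e list) set" where
  "central_cycles = {p \<in> NP. snd p \<noteq> [] \<and> endpoint (fst p) (snd p) = fst p \<and> left_maximal p \<and> right_maximal p}"

text \<open>
  The coordinate \<open>None\<close> is the common coefficient of the vertices.
\<close>

definition central_elem :: "(('v \<times> 'e list) option \<Rightarrow> 'k::field) \<Rightarrow> 'v \<times> 'e list \<Rightarrow> 'k" where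
  "central_elem c p = (if p \<in> NP then if snd p = [] then c None else if p \<in> central_cycles then c (Some p) else 0 else 0)"

abbreviation "central_index \<equiv> insert None (Some ` central_cycles)"

lemma central_elem_coords: "central_elem c \<in> K"
  by (auto simp: central_elem_def coords_def)

text \<open>
  Only vertices and arrows have to be tested. An arrow is annihilated on both sides by a maximal
  cycle and commutes with the sum of all vertices.
\<close>

lemma central_elem_commutes:
  assumes f: "f \<in> (K :: ('v \<times> 'e list \<Rightarrow> 'k::field) set)"
  shows "mul f (central_elem c) = mul (central_elem c) f"
  using f
proof (induction rule: generation_induct)
  case (add f g)
  thus ?case by (simp add: mul_add_left mul_add_right)
next
  case (smult r f)
  thus ?case by (simp add: mul_smult_left mul_smult_right)
next
  case (mul f g)
  have "mul (mul f g) (central_elem c) = mul f (mul g (central_elem c))" by (rule mul_assoc)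
  also have "\<dots> = mul (mul f (central_elem c)) g" by (simp add: mul(4) mul_assoc)
  also have "\<dots> = mul (central_elem c) (mul f g)" by (simp add: mul(3) mul_assoc)
  finally show ?case .
next
  case (vert x)
  show ?case
    by (auto simp: fun_eq_iff mul_vert_left mul_vert_right central_elem_coords)
      (auto simp: central_elem_def central_cycles_def split: if_splits)
next
  case (arr a)
  have "mul (arr a) (central_elem c) (u, l) = (if (u, l) = (tail Q a, [a]) \<and> (u, l) \<in> NP then c None else 0)" for u l
    using arr by (cases l) (auto simp: mul_arr_left central_elem_def NP_Cons central_cycles_def left_maximal_def)
  moreover have "mul (central_elem c) (arr a) (u, l) = (if (u, l) = (tail Q a, [a]) \<and> (u, l) \<in> NP then c None else 0)" for u l
    using arr by (cases l rule: rev_cases)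
      (auto simp: mul_arr_right central_elem_def NP_Cons NP_snoc central_cycles_def right_maximal_def)
  ultimately show ?case by (auto simp: fun_eq_iff)
qed simp

text \<open>
  Comparing coefficients of \<open>a z = z a\<close> at \<open>a\<close> makes the coefficients at the two ends of \<open>a\<close> equal. At
  \<open>a l\<close> it removes the coefficient of \<open>l\<close>: the path \<open>a l\<close> does not end with \<open>a\<close>, so it does not occur in
  \<open>z a\<close>.
\<close>

lemma central_elem_surj:
  assumes z: "z \<in> (K :: ('v \<times> 'e list \<Rightarrow> 'k::field) set)"
    and central: "\<And>f. f \<in> K \<Longrightarrow> mul f z = mul z f"
  shows "\<exists>c\<in>coords central_index. z = central_elem c"
proof -
  have closed: "endpoint u l = u" if "z (u, l) \<noteq> 0" for u l
  proof -
    have "u \<in> verts Q" using z that by (auto simp: coords_def NP_def)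
    hence "vert u \<in> (K :: ('v \<times> 'e list \<Rightarrow> 'k) set)" by simp
    from fun_cong[OF central[OF this], of "(u, l)"] show ?thesis
      using that by (auto simp: mul_vert_left mul_vert_right z split: if_splits)
  qed
  have "z (head Q a, []) = z (tail Q a, [])" if a: "a \<in> arcs Q" for a
    using fun_cong[OF central[OF arr_coords[OF a]], of "(tail Q a, [a])"] a
    by (simp add: mul_arr_left mul_arr_right NP_Cons)
  then obtain k where k: "\<forall>x\<in>verts Q. z (x, []) = k"
    using constant_on_verts[of "\<lambda>x. z (x, [])"] by blast
  have left: "z (u, l) = 0" if l: "l \<noteq> []" and b: "(tail Q b, b # l) \<in> NP" "head Q b = u" for u l b
  proof -
    have "b \<in> arcs Q" using b by (simp add: NP_Cons)
    from fun_cong[OF central[OF arr_coords[OF this]], of "(tail Q b, b # l)"]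
    show ?thesis using b l starts_and_ends[OF b(1) l] by (simp add: mul_arr_left mul_arr_right)
  qed
  have right: "z (u, l) = 0" if l: "l \<noteq> []" and b: "(u, l @ [b]) \<in> NP" for u l b
  proof -
    have "b \<in> arcs Q" using b by (simp add: NP_snoc)
    moreover have "hd l \<noteq> b" using b l by (rule ends_and_starts)
    ultimately show ?thesis
      using fun_cong[OF central[OF arr_coords], of b "(u, l @ [b])"] b l
      by (simp add: mul_arr_left mul_arr_right)
  qed
  define c where "c s = (case s of None \<Rightarrow> k | Some p \<Rightarrow> if p \<in> central_cycles then z p else 0)" for s
  have "z p = central_elem c p" for p
  proof (cases p)
    case (Pair u l)
    show ?thesis
    proof (cases "p \<in> NP")
      case True
      have "z p = 0" if "p \<notin> central_cycles" "l \<noteq> []"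
        using that True closed[of u l] left[of l _ u] right[of l u] unfolding Pair
        by (auto simp: central_cycles_def left_maximal_def right_maximal_def)
      thus ?thesis using k True Pair by (auto simp: central_elem_def c_def)
    qed (use z in \<open>simp add: central_elem_def coords_outside\<close>)
  qed
  moreover have "c \<in> coords central_index" by (auto simp: coords_def c_def split: option.splits)
  ultimately show ?thesis by blast
qed

lemma central_elem_inj:
  assumes c: "c \<in> coords central_index" and z: "central_elem c = (\<lambda>p. 0)"
  shows "c = (\<lambda>s. 0)"
proof
  fix s
  obtain x where "x \<in> verts Q"
    using connected by (auto simp: Digraph_Component.connected_def strongly_connected_def mk_symmetric_def)
  hence "c None = 0" using fun_cong[OF z, of "(x, [])"] by (simp add: central_elem_def)
  moreover have "c (Some p) = 0" if "p \<in> central_cycles" for p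
    using fun_cong[OF z, of p] that by (auto simp: central_elem_def central_cycles_def)
  ultimately show "c s = 0" using coords_outside[OF c, of s] by (cases s) (auto simp: image_iff)
qed

end

context string_quiver
begin

section \<open>Derivations of the algebra of nonzero paths\<close>

definition derivation :: "(('v \<times> 'e list \<Rightarrow> 'k::field) \<Rightarrow> 'v \<times> 'e list \<Rightarrow> 'k) \<Rightarrow> bool" where
  "derivation D \<longleftrightarrow> (\<forall>f\<in>K. D f \<in> K) \<and>
     (\<forall>f\<in>K. \<forall>g\<in>K. D (\<lambda>p. f p + g p) = (\<lambda>p. D f p + D g p)) \<and>
     (\<forall>r. \<forall>f\<in>K. D (\<lambda>p. r * f p) = (\<lambda>p. r * D f p)) \<and>
     (\<forall>f\<in>K. \<forall>g\<in>K. D (mul f g) = (\<lambda>p. mul (D f) g p + mul f (D g) p))"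

lemma derivationD:
  assumes "derivation D"
  shows "f \<in> K \<Longrightarrow> D f \<in> K"
    "f \<in> K \<Longrightarrow> g \<in> K \<Longrightarrow> D (\<lambda>p. f p + g p) = (\<lambda>p. D f p + D g p)"
    "f \<in> K \<Longrightarrow> D (\<lambda>p. r * f p) = (\<lambda>p. r * D f p)"
    "f \<in> K \<Longrightarrow> g \<in> K \<Longrightarrow> D (mul f g) = (\<lambda>p. mul (D f) g p + mul f (D g) p)"
  using assms unfolding derivation_def by blast+

lemma derivation_zero: "derivation D \<Longrightarrow> D (\<lambda>p. 0) = (\<lambda>p. 0)"
  using derivationD(3)[of D "\<lambda>p. 0" 0] by (simp add: coords_zero)

lemma mul_diff_left: "mul (\<lambda>p. f p - g p) h = (\<lambda>p. mul f h p - mul g h p)"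
  and mul_diff_right: "mul h (\<lambda>p. f p - g p) = (\<lambda>p. mul h f p - mul h g p)"
  by (simp_all add: mul_def fun_eq_iff left_diff_distrib right_diff_distrib sum_subtractf)

lemma coords_diff: "f \<in> coords S \<Longrightarrow> g \<in> coords S \<Longrightarrow> (\<lambda>p. f p - g p :: 'k::field) \<in> coords S"
  by (simp add: coords_def)

lemma comm_coords [simp]: "comm f u \<in> K"
  unfolding comm_def by (intro coords_diff mul_coords)

lemma derivation_comm: "derivation (\<lambda>f. comm f u)"
  unfolding derivation_def
proof (intro conjI ballI allI)
  fix f g
  show "comm (mul f g) u = (\<lambda>p. mul (comm f u) g p + mul f (comm g u) p)"
    by (simp add: comm_def mul_diff_left mul_diff_right mul_assoc)
qed (simp, simp_all add: comm_def mul_add_left mul_add_right mul_smult_left mul_smult_right algebra_simps)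

lemma derivation_diff:
  assumes "derivation D" "derivation E"
  shows "derivation (\<lambda>f p. D f p - E f p)"
  unfolding derivation_def
  using derivationD[OF assms(1)] derivationD[OF assms(2)]
  by (simp add: coords_diff mul_diff_left mul_diff_right algebra_simps)

lemma derivation_eqI:
  assumes D: "derivation D" and E: "derivation E"
    and vert: "\<And>x. x \<in> verts Q \<Longrightarrow> D (vert x) = E (vert x)"
    and arr: "\<And>a. a \<in> arcs Q \<Longrightarrow> D (arr a) = E (arr a)"
    and f: "f \<in> K"
  shows "D f = E f"
  using f
proof (induction rule: generation_induct)
  case zero
  show ?case using derivation_zero[OF D] derivation_zero[OF E] by simp
qed (simp_all add: derivationD[OF D] derivationD[OF E] vert arr)

text \<open>
  A derivation that vanishes on the vertices commutes with multiplication by them, so it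
  preserves source and target.
\<close>

lemma derivation_arr_support:
  assumes D: "derivation D" and vert: "\<And>x. x \<in> verts Q \<Longrightarrow> D (vert x) = (\<lambda>p. 0)"
    and a: "a \<in> arcs Q" and nz: "D (arr a) (u, l) \<noteq> 0"
  shows "(u, l) \<in> NP" "u = tail Q a" "endpoint u l = head Q a"
proof -
  have K: "D (arr a) \<in> K" using derivationD(1)[OF D] a by simp
  show "(u, l) \<in> NP" using coords_outside[OF K] nz by blast
  have "D (arr a) = mul (vert (tail Q a)) (D (arr a))"
    using derivationD(4)[OF D, of "vert (tail Q a)" "arr a"] vert[of "tail Q a"] a
    by (simp add: vert_mul_arr)
  thus "u = tail Q a" using nz mul_vert_left[OF K, of "tail Q a" u l] by metis
  have "D (arr a) = mul (D (arr a)) (vert (head Q a))"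
    using derivationD(4)[OF D, of "arr a" "vert (head Q a)"] vert[of "head Q a"] a
    by (simp add: arr_mul_vert)
  thus "endpoint u l = head Q a" using nz mul_vert_right[OF K, of "head Q a" u l] by metis
qed

lemma arr_mul_arr_zero: "\<not> ok a b \<Longrightarrow> mul (arr a) (arr b) = (\<lambda>p. 0)"
proof -
  assume "\<not> ok a b"
  hence "mul (arr a) (arr b) (u, l) = 0" for u l
    by (cases l) (auto simp: mul_arr_left single_apply NP_Cons)
  thus ?thesis by (auto simp: fun_eq_iff)
qed

lemma derivation_relation:
  assumes D: "derivation D" and ab: "a \<in> arcs Q" "b \<in> arcs Q" "\<not> ok a b"
  shows "mul (D (arr a)) (arr b) p + mul (arr a) (D (arr b)) p = 0"
proof -
  have "(\<lambda>p. mul (D (arr a)) (arr b) p + mul (arr a) (D (arr b)) p) = (\<lambda>p. 0)"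
    using derivationD(4)[OF D, of "arr a" "arr b"] ab by (simp add: arr_mul_arr_zero derivation_zero[OF D])
  thus ?thesis by (rule fun_cong)
qed

subsection \<open>Extending values on arrows to a derivation\<close>

text \<open>
  The Leibniz rule, unfolded along a path whose arrow \<open>a\<close> is sent to \<open>\<lambda>q. m (a, q)\<close>.
\<close>

fun path_derivation :: "('e \<times> 'v \<times> 'e list \<Rightarrow> 'k::field) \<Rightarrow> 'v \<Rightarrow> 'e list \<Rightarrow> 'v \<times> 'e list \<Rightarrow> 'k" where
  "path_derivation m u [] = (\<lambda>p. 0)"
| "path_derivation m u (a # l) = (\<lambda>p. mul (\<lambda>q. m (a, q)) (single (head Q a, l)) p +
     mul (arr a) (path_derivation m (head Q a) l) p)"

definition extension :: "('e \<times> 'v \<times> 'e list \<Rightarrow> 'k::field) \<Rightarrow> ('v \<times> 'e list \<Rightarrow> 'k) \<Rightarrow> 'v \<times> 'e list \<Rightarrow> 'k" where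
  "extension m f = (\<lambda>q. \<Sum>p\<in>NP. f p * path_derivation m (fst p) (snd p) q)"

lemma path_derivation_coords [simp]: "path_derivation m u l \<in> K"
proof (cases l)
  case Nil
  thus ?thesis by (simp add: coords_zero)
next
  case (Cons a l')
  show ?thesis unfolding Cons path_derivation.simps by (intro coords_add mul_coords)
qed

lemma extension_coords [simp]: "extension m f \<in> K"
  unfolding coords_def extension_def
  by (auto simp: coords_outside[OF path_derivation_coords])

lemma extension_add: "extension m (\<lambda>p. f p + g p) = (\<lambda>p. extension m f p + extension m g p)"
  and extension_smult: "extension m (\<lambda>p. r * f p) = (\<lambda>p. r * extension m f p)"
  by (simp_all add: extension_def fun_eq_iff distrib_right sum.distrib sum_distrib_left mult.assoc)

lemma extension_zero: "extension m (\<lambda>p. 0) = (\<lambda>p. 0)" by (simp add: extension_def)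

lemma extension_single: "(u, l) \<in> NP \<Longrightarrow> extension m (single (u, l)) = path_derivation m u l"
proof -
  assume p: "(u, l) \<in> NP"
  have "extension m (single (u, l)) q = (\<Sum>p\<in>NP. if p = (u, l) then path_derivation m u l q else 0)" for q
    unfolding extension_def by (intro sum.cong) (auto simp: single_apply)
  thus ?thesis using p finite_NP by (simp add: fun_eq_iff)
qed

lemma path_derivation_add:
  "path_derivation (\<lambda>s. m s + n s) u l = (\<lambda>p. path_derivation m u l p + path_derivation n u l p)"
  by (induction l arbitrary: u) (simp_all add: mul_add_left mul_add_right algebra_simps)

lemma path_derivation_smult:
  "path_derivation (\<lambda>s. r * m s) u l = (\<lambda>p. r * path_derivation m u l p)"
  by (induction l arbitrary: u) (simp_all add: mul_smult_left mul_smult_right algebra_simps)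

lemma extension_add_values: "extension (\<lambda>s. m s + n s) f = (\<lambda>p. extension m f p + extension n f p)"
  and extension_smult_values: "extension (\<lambda>s. r * m s) f = (\<lambda>p. r * extension m f p)"
  by (simp_all add: extension_def fun_eq_iff path_derivation_add path_derivation_smult distrib_left
      sum.distrib sum_distrib_left mult.left_commute)

text \<open>
  The first condition is forced on a derivation that vanishes at the vertices. The second is the Leibniz
  rule for the relations; given the first, it is the only obstruction to extending the values \<open>m\<close> on
  the arrows to such a derivation.
\<close>

definition extendable :: "('e \<times> 'v \<times> 'e list \<Rightarrow> 'k::field) \<Rightarrow> bool" where
  "extendable m \<longleftrightarrow> (\<forall>a\<in>arcs Q. \<forall>u l. m (a, u, l) \<noteq> 0 \<longrightarrow>
       (u, l) \<in> NP \<and> u = tail Q a \<and> endpoint u l = head Q a) \<and>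
     (\<forall>a\<in>arcs Q. \<forall>b\<in>arcs Q. head Q a = tail Q b \<longrightarrow> \<not> ok a b \<longrightarrow>
       (\<lambda>p. mul (\<lambda>q. m (a, q)) (arr b) p + mul (arr a) (\<lambda>q. m (b, q)) p) = (\<lambda>p. 0))"

lemma extendable_support:
  assumes "extendable m" "a \<in> arcs Q" "m (a, u, l) \<noteq> 0"
  shows "(u, l) \<in> NP" "u = tail Q a" "endpoint u l = head Q a"
  using assms unfolding extendable_def by blast+

lemma extendable_relation:
  assumes "extendable m" "a \<in> arcs Q" "b \<in> arcs Q" "head Q a = tail Q b" "\<not> ok a b"
  shows "(\<lambda>p. mul (\<lambda>q. m (a, q)) (arr b) p + mul (arr a) (\<lambda>q. m (b, q)) p) = (\<lambda>p. 0)"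
  using assms unfolding extendable_def by blast

lemma extendable_coords:
  assumes "extendable m" "a \<in> arcs Q" shows "(\<lambda>q. m (a, q)) \<in> K"
  using extendable_support[OF assms] by (auto simp: coords_def)

lemma path_derivation_source:
  assumes m: "extendable m" and p: "(u, l) \<in> NP" and nz: "path_derivation m u l (v, k) \<noteq> 0"
  shows "v = u"
proof (cases l)
  case Nil
  thus ?thesis using nz by simp
next
  case (Cons a l')
  have a: "a \<in> arcs Q" "u = tail Q a" using p by (auto simp: Cons NP_Cons)
  have "mul (\<lambda>q. m (a, q)) (single (head Q a, l')) (v, k) = 0 \<or> v = u"
  proof (cases "v = u")
    case False
    have "m (a, v, k') = 0" for k' using extendable_support(2)[OF m a(1), of v k'] False a(2) by auto
    thus ?thesis by (simp add: mul_def)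
  qed simp
  moreover have "mul (arr a) (path_derivation m (head Q a) l') (v, k) = 0 \<or> v = u"
    by (cases k) (auto simp: mul_arr_left NP_Cons a)
  ultimately show ?thesis using nz by (auto simp: Cons)
qed

lemma extension_vert_mul:
  fixes m :: "'e \<times> 'v \<times> 'e list \<Rightarrow> 'k::field"
  assumes m: "extendable m" and g: "g \<in> K"
  shows "extension m (mul (vert x) g) = mul (vert x) (extension m g)"
  using g
proof (induction rule: span_induct)
  case (single p)
  obtain u l where p: "p = (u, l)" by (cases p)
  have "mul (vert x) (single (u, l)) = (if u = x then single (u, l) else (\<lambda>p. 0 :: 'k))"
    using single by (auto simp: p fun_eq_iff mul_vert_left single_apply)
  moreover have "mul (vert x) (path_derivation m u l) = (if u = x then path_derivation m u l else (\<lambda>p. 0))"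
    using path_derivation_source[OF m single[unfolded p]] mul_vert_left[OF path_derivation_coords, of x m u l]
    by (auto simp: fun_eq_iff)
  ultimately show ?case using single
    by (cases "u = x") (simp_all add: p extension_single extension_zero)
qed (simp_all add: extension_zero extension_add extension_smult mul_add_right mul_smult_right)

text \<open>
  For a path \<open>g = b l'\<close> with \<open>a b = 0\<close> the left side is zero, while the right side is
  \<open>(m a \<cdot> b + a \<cdot> m b) \<cdot> l' + a b \<cdot> D l'\<close> and vanishes by the condition for the relation \<open>a b\<close>. In all
  other cases the equation is the recursion for paths, or both sides vanish for lack of composability.
\<close>

lemma extension_arr_mul:
  fixes m :: "'e \<times> 'v \<times> 'e list \<Rightarrow> 'k::field"
  assumes m: "extendable m" and a: "a \<in> arcs Q" and g: "g \<in> K"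
  shows "extension m (mul (arr a) g) = (\<lambda>p. mul (\<lambda>q. m (a, q)) g p + mul (arr a) (extension m g) p)"
  using g
proof (induction rule: span_induct)
  case (single p)
  obtain u l where p: "p = (u, l)" by (cases p)
  have ext: "extension m (single (u, l)) = path_derivation m u l"
    using single by (simp add: p extension_single)
  show ?case
  proof (cases "(tail Q a, a # l) \<in> NP \<and> u = head Q a")
    case True
    hence c: "(tail Q a, a # l) \<in> NP" and u: "u = head Q a" by auto
    have "mul (arr a) (single (u, l)) = (single (tail Q a, a # l) :: _ \<Rightarrow> 'k)"
      unfolding u by (rule single_Cons[OF c, symmetric])
    thus ?thesis using extension_single[OF c, of m] by (simp add: p ext) (simp add: u)
  next
    case False
    have zero: "mul (arr a) (single (u, l)) = (\<lambda>p. 0 :: 'k)"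
    proof -
      have "mul (arr a) (single (u, l)) (v, k) = (0 :: 'k)" for v k
        using False by (cases k) (auto simp: mul_arr_left single_apply NP_Cons)
      thus ?thesis by (auto simp: fun_eq_iff)
    qed
    have "(\<lambda>p. mul (\<lambda>q. m (a, q)) (single (u, l)) p + mul (arr a) (path_derivation m u l) p) = (\<lambda>p. 0)"
    proof (cases "u = head Q a")
      case False
      have "mul (\<lambda>q. m (a, q)) (single (u, l)) = (\<lambda>p. 0)"
        by (rule mul_mismatch[where x = "head Q a"])
          (use False extendable_support(3)[OF m a] in \<open>auto simp: single_apply split: if_splits\<close>)
      moreover have "mul (arr a) (path_derivation m u l) = (\<lambda>p. 0)"
        by (rule mul_mismatch[where x = "head Q a"])
          (use False path_derivation_source[OF m single[unfolded p]] in \<open>auto simp: single_apply split: if_splits\<close>)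
      ultimately show ?thesis by simp
    next
      case True
      hence nin: "(tail Q a, a # l) \<notin> NP" using False by simp
      have "l \<noteq> []" using nin a by (auto simp: NP_Cons)
      then obtain b l' where l: "l = b # l'" by (cases l) auto
      have b: "b \<in> arcs Q" "head Q a = tail Q b" and nok: "\<not> ok a b"
        and s: "single (u, l) = mul (arr b) (single (head Q b, l') :: _ \<Rightarrow> 'k)"
        using single nin a True single_Cons[of u b l'] by (auto simp: p l NP_Cons)
      let ?s = "single (head Q b, l') :: _ \<Rightarrow> 'k"
      have "mul (\<lambda>q. m (a, q)) (single (u, l)) = mul (mul (\<lambda>q. m (a, q)) (arr b)) ?s"
        by (simp add: s mul_assoc)
      moreover have "mul (arr a) (path_derivation m u l) = (\<lambda>p. mul (mul (arr a) (\<lambda>q. m (b, q))) ?s p +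
          mul (mul (arr a) (arr b)) (path_derivation m (head Q b) l') p)"
        by (simp add: l mul_add_right mul_assoc)
      moreover have "(\<lambda>p. mul (mul (\<lambda>q. m (a, q)) (arr b)) ?s p + mul (mul (arr a) (\<lambda>q. m (b, q))) ?s p) = (\<lambda>p. 0)"
        using extendable_relation[OF m a b nok] by (simp add: mul_add_left[symmetric])
      ultimately show ?thesis by (simp add: arr_mul_arr_zero[OF nok])
    qed
    thus ?thesis by (simp add: p ext zero extension_zero)
  qed
next
  case (add f g)
  thus ?case by (simp add: mul_add_right extension_add algebra_simps)
next
  case (smult r f)
  thus ?case by (simp add: mul_smult_right extension_smult algebra_simps)
qed (simp add: extension_zero)

lemma extension_vert: "x \<in> verts Q \<Longrightarrow> extension m (vert x) = (\<lambda>p. 0)"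
  by (simp add: extension_single)

lemma extension_arr:
  fixes m :: "'e \<times> 'v \<times> 'e list \<Rightarrow> 'k::field"
  assumes m: "extendable m" and a: "a \<in> arcs Q"
  shows "extension m (arr a) = (\<lambda>q. m (a, q))"
proof -
  have v: "vert (head Q a) \<in> (K :: (_ \<Rightarrow> 'k) set)" using a by simp
  have "mul (\<lambda>q. m (a, q)) (vert (head Q a)) (u, l) = m (a, u, l)" for u l
    using extendable_support(3)[OF m a, of u l] mul_vert_right[OF extendable_coords[OF m a]] by auto
  thus ?thesis
    using extension_arr_mul[OF m a v] a by (auto simp: arr_mul_vert extension_vert fun_eq_iff)
qed

text \<open>
  The elements \<open>f\<close> such that the Leibniz rule holds for \<open>mul f g\<close> with every \<open>g\<close> are closed under
  products, so it is enough to know the rule for \<open>f\<close> a vertex or an arrow.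
\<close>

theorem derivation_extension:
  fixes m :: "'e \<times> 'v \<times> 'e list \<Rightarrow> 'k::field"
  assumes m: "extendable m"
  shows "derivation (extension m)"
proof -
  have "\<forall>g\<in>K. extension m (mul f g) = (\<lambda>p. mul (extension m f) g p + mul f (extension m g) p)"
    if "f \<in> K" for f :: "'v \<times> 'e list \<Rightarrow> 'k"
    using that
  proof (induction rule: generation_induct)
    case (mul f g)
    show ?case
    proof
      fix h :: "'v \<times> 'e list \<Rightarrow> 'k" assume h: "h \<in> K"
      have "extension m (mul (mul f g) h) = extension m (mul f (mul g h))" by (simp add: mul_assoc)
      also have "\<dots> = (\<lambda>p. mul (extension m f) (mul g h) p + mul f (extension m (mul g h)) p)"
        using mul(3) by simp
      also have "\<dots> = (\<lambda>p. mul (mul (extension m f) g) h p +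
          (mul (mul f (extension m g)) h p + mul (mul f g) (extension m h) p))"
        using mul(4) h by (simp add: mul_add_right mul_assoc)
      also have "\<dots> = (\<lambda>p. mul (extension m (mul f g)) h p + mul (mul f g) (extension m h) p)"
        using mul(2,3) by (simp add: mul_add_left algebra_simps)
      finally show "extension m (mul (mul f g) h) =
          (\<lambda>p. mul (extension m (mul f g)) h p + mul (mul f g) (extension m h) p)" .
    qed
  next
    case (add f g)
    thus ?case by (simp add: mul_add_left extension_add algebra_simps)
  next
    case (smult r f)
    thus ?case by (simp add: mul_smult_left extension_smult algebra_simps)
  next
    case (vert x)
    thus ?case by (simp add: extension_vert_mul[OF m] extension_vert)
  next
    case (arr a)
    thus ?case by (simp add: extension_arr_mul[OF m] extension_arr[OF m])
  qed (simp add: extension_zero)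
  thus ?thesis unfolding derivation_def by (simp add: extension_add extension_smult)
qed

end

context string_quiver
begin

section \<open>Outer derivations\<close>

text \<open>
  The index \<open>(a, \<gamma>)\<close> stands for the derivation that sends the arrow \<open>a\<close> to the parallel path \<open>\<gamma>\<close> and the
  other arrows to zero. The three index sets cover the maximal paths \<open>\<gamma>\<close> unrelated to \<open>a\<close>, the
  trivial paths at gentle loops, and the paths \<open>\<gamma> = a\<close> for arrows outside the tree \<open>T\<close>.
\<close>

definition parallel_index :: "('e \<times> 'v \<times> 'e list) set" where
  "parallel_index = {(a, p). a \<in> arcs Q \<and> p \<in> NP \<and> fst p = tail Q a \<and>
     endpoint (fst p) (snd p) = head Q a \<and>
     \<not> (\<exists>r. snd p = a # r) \<and> \<not> (\<exists>r. snd p = r @ [a]) \<and> left_maximal p \<and> right_maximal p}"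

definition gentle_index :: "('e \<times> 'v \<times> 'e list) set" where
  "gentle_index = {(a, tail Q a, []) | a. a \<in> arcs Q \<and> head Q a = tail Q a \<and>
     (\<forall>b\<in>arcs Q. b \<noteq> a \<longrightarrow> (tail Q b = head Q a \<longrightarrow> ok a b) \<and> (head Q b = tail Q a \<longrightarrow> ok b a))}"

definition scaling_index :: "'e set \<Rightarrow> ('e \<times> 'v \<times> 'e list) set" where
  "scaling_index T = (\<lambda>a. (a, tail Q a, [a])) ` (arcs Q - T)"

definition outer_index :: "'e set \<Rightarrow> bool \<Rightarrow> ('e \<times> 'v \<times> 'e list) set" where
  "outer_index T two_zero = parallel_index \<union> scaling_index T \<union> (if two_zero then gentle_index else {})"

text \<open>
  A trivial path parallel to \<open>a\<close> is prolonged by the loop \<open>a\<close> itself, hence not maximal.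
\<close>

lemma parallel_index_nontrivial: "(a, u, l) \<in> parallel_index \<Longrightarrow> l \<noteq> []"
proof
  assume p: "(a, u, l) \<in> parallel_index" and l: "l = []"
  hence "a \<in> arcs Q" "head Q a = u" "tail Q a = u" "left_maximal (u, [])"
    by (auto simp: parallel_index_def)
  thus False by (auto simp: left_maximal_def NP_Cons)
qed

lemma finite_indices: "finite parallel_index" "finite gentle_index" "finite (scaling_index T)"
proof -
  have "parallel_index \<subseteq> arcs Q \<times> NP" "gentle_index \<subseteq> arcs Q \<times> NP"
    by (auto simp: parallel_index_def gentle_index_def)
  thus "finite parallel_index" "finite gentle_index"
    by (auto intro: finite_subset simp: finite_NP)
  show "finite (scaling_index T)" by (simp add: scaling_index_def)
qed

lemma card_outer_index:
  assumes T: "T \<subseteq> arcs Q" "card T + 1 = card (verts Q)"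
  shows "int (card (outer_index T two_zero)) =
    int (card parallel_index) + int (card (arcs Q)) - int (card (verts Q)) + 1 +
    (if two_zero then int (card gentle_index) else 0)"
proof -
  have "card (scaling_index T) = card (arcs Q - T)"
    unfolding scaling_index_def by (rule card_image) (auto simp: inj_on_def)
  also have "\<dots> = card (arcs Q) - card T" using T(1) by (simp add: card_Diff_subset finite_subset)
  finally have "int (card (scaling_index T)) = int (card (arcs Q)) - int (card T)"
    using card_mono[OF finite_arcs T(1)] by simp
  moreover have "parallel_index \<inter> scaling_index T = {}"
    by (auto simp: parallel_index_def scaling_index_def)
  moreover have "(parallel_index \<union> scaling_index T) \<inter> gentle_index = {}"
    using parallel_index_nontrivial by (auto simp: scaling_index_def gentle_index_def)
  ultimately show ?thesis
    using T(2) finite_indices by (auto simp: outer_index_def card_Un_disjoint)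
qed

text \<open>
  For a zero product \<open>a b\<close>, a term \<open>\<gamma> b\<close> with \<open>\<gamma>\<close> parallel to \<open>a\<close> vanishes when \<open>\<gamma>\<close> is maximal or equal to
  \<open>a\<close>, and likewise on the other side. What remains is a gentle loop \<open>a = b\<close> with trivial \<open>\<gamma>\<close>; there both
  terms equal \<open>a\<close>, and their sum is zero in characteristic two.
\<close>

lemma outer_index_extendable:
  fixes c :: "'e \<times> 'v \<times> 'e list \<Rightarrow> 'k::field"
  assumes c: "c \<in> coords (outer_index T ((2 :: 'k) = 0))"
  shows "extendable c"
proof -
  have index: "(a, u, l) \<in> parallel_index \<or> (u = tail Q a \<and> l = [a]) \<or>
      ((a, u, l) \<in> gentle_index \<and> (2 :: 'k) = 0)"
    if "c (a, u, l) \<noteq> 0" for a u l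
  proof -
    have "(a, u, l) \<in> outer_index T ((2 :: 'k) = 0)" using coords_outside[OF c] that by blast
    thus ?thesis by (auto simp: outer_index_def scaling_index_def split: if_splits)
  qed
  have support: "(u, l) \<in> NP \<and> u = tail Q a \<and> endpoint u l = head Q a"
    if a: "a \<in> arcs Q" and nz: "c (a, u, l) \<noteq> 0" for a u l
    using index[OF nz] a by (auto simp: parallel_index_def gentle_index_def NP_Cons)
  have relation: "mul (\<lambda>q. c (a, q)) (arr b) (u, l) + mul (arr a) (\<lambda>q. c (b, q)) (u, l) = 0"
    if a: "a \<in> arcs Q" and b: "b \<in> arcs Q" and ab: "head Q a = tail Q b" and nok: "\<not> ok a b" for a b u l
  proof -
    have right: "l = [a] \<and> a = b \<and> (2 :: 'k) = 0"
      if nz: "mul (\<lambda>q. c (a, q)) (arr b) (u, l) \<noteq> 0"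
    proof -
      have p: "(u, l) \<in> NP" "l \<noteq> []" "last l = b" and cz: "c (a, u, butlast l) \<noteq> 0"
        using nz by (auto simp: mul_arr_right split: if_splits)
      define k where "k = butlast l"
      have l: "l = k @ [b]" using p(2,3) by (auto simp: k_def)
      have ck: "c (a, u, k) \<noteq> 0" using cz by (simp add: k_def)
      have "endpoint u k = tail Q b" using support[OF a ck] ab by metis
      hence "\<not> right_maximal (u, k)" using p(1) b unfolding l by (auto simp: right_maximal_def)
      moreover have "k \<noteq> [a]" using p(1) nok unfolding l by (auto simp: NP_snoc)
      ultimately have g: "(a, u, k) \<in> gentle_index" "(2 :: 'k) = 0"
        using index[OF ck] by (auto simp: parallel_index_def)
      hence "k = []" "b = a" using ab b nok by (auto simp: gentle_index_def)
      thus ?thesis using g l by simp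
    qed
    have left: "l = [a] \<and> a = b \<and> (2 :: 'k) = 0"
      if nz: "mul (arr a) (\<lambda>q. c (b, q)) (u, l) \<noteq> 0"
    proof -
      have p: "(u, l) \<in> NP" "l \<noteq> []" "hd l = a" and cz: "c (b, head Q a, tl l) \<noteq> 0"
        using nz by (auto simp: mul_arr_left split: if_splits)
      define k where "k = tl l"
      have l: "l = a # k" using p(2,3) by (auto simp: k_def)
      have u: "u = tail Q a" using p(1) unfolding l by (simp add: NP_Cons)
      have ck: "c (b, head Q a, k) \<noteq> 0" using cz by (simp add: k_def)
      have "\<not> left_maximal (head Q a, k)" using p(1) a u unfolding l by (auto simp: left_maximal_def)
      moreover have "k \<noteq> [b]" using p(1) nok unfolding l by (auto simp: NP_Cons)
      ultimately have g: "(b, head Q a, k) \<in> gentle_index" "(2 :: 'k) = 0"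
        using index[OF ck] by (auto simp: parallel_index_def)
      hence "k = []" "a = b" using ab a nok by (auto simp: gentle_index_def)
      thus ?thesis using g l by simp
    qed
    show ?thesis
    proof (cases "l = [a] \<and> a = b \<and> (2 :: 'k) = 0")
      case True
      have loop: "head Q a = tail Q a" using True ab by simp
      have "mul (\<lambda>q. c (a, q)) (arr b) (u, l) + mul (arr a) (\<lambda>q. c (b, q)) (u, l) =
          (if (u, [a]) \<in> NP then 2 * c (a, tail Q a, []) else 0)"
        using True loop by (auto simp: mul_arr_left mul_arr_right NP_Cons)
      thus ?thesis using True by simp
    next
      case False
      thus ?thesis using left right by fastforce
    qed
  qed
  show ?thesis
    unfolding extendable_def using support relation by (auto simp: fun_eq_iff)
qed

lemma comm_arr:
  assumes "(u, l) \<in> NP"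
  shows "comm (arr a) w (u, l) = (if l \<noteq> [] \<and> hd l = a then w (head Q a, tl l) else 0) -
     (if l \<noteq> [] \<and> last l = a then w (u, butlast l) else 0)"
  using assms by (simp add: comm_def mul_arr_left mul_arr_right)

text \<open>
  The coefficient of \<open>b \<gamma>\<close> in \<open>D b \<cdot> a + b \<cdot> D a\<close> is that of \<open>\<gamma>\<close> in \<open>D a\<close> if \<open>b \<gamma>\<close> does not end with \<open>a\<close>. When
  \<open>b \<gamma>\<close> is nonzero and \<open>\<gamma>\<close> does not start with \<open>a\<close>, the product \<open>b a\<close> is zero by uniqueness
  of prolongations, so this coefficient vanishes. Hence \<open>\<gamma>\<close> is maximal. For trivial \<open>\<gamma>\<close> the same comparison,
  with \<open>b = a\<close> and then with the other arrows at the vertex, yields characteristic two and the gentle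
  condition.
\<close>

lemma normalised_derivation_coords:
  fixes E :: "('v \<times> 'e list \<Rightarrow> 'k::field) \<Rightarrow> 'v \<times> 'e list \<Rightarrow> 'k"
  assumes E: "derivation E" and vert: "\<And>x. x \<in> verts Q \<Longrightarrow> E (vert x) = (\<lambda>p. 0)"
    and tree: "\<And>a. a \<in> T \<Longrightarrow> E (arr a) (tail Q a, [a]) = 0"
    and starts: "\<And>a l. a \<in> arcs Q \<Longrightarrow> l \<noteq> [] \<Longrightarrow> E (arr a) (tail Q a, a # l) = 0"
    and ends: "\<And>a l. a \<in> arcs Q \<Longrightarrow> l \<noteq> [] \<Longrightarrow> E (arr a) (tail Q a, l @ [a]) = 0"
    and a: "a \<in> arcs Q" and nz: "E (arr a) (u, l) \<noteq> 0"
  shows "(a, u, l) \<in> outer_index T ((2 :: 'k) = 0)"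
proof -
  note supp = derivation_arr_support[OF E vert a nz]
  note rel = derivation_relation[OF E]
  consider "l = [a]" | "l = []" | "l \<noteq> []" "l \<noteq> [a]" by blast
  thus ?thesis
  proof cases
    case 1
    hence "a \<notin> T" using tree nz supp by auto
    thus ?thesis using a 1 supp by (auto simp: outer_index_def scaling_index_def)
  next
    case 2
    have loop: "head Q a = tail Q a" using supp 2 by simp
    have nz': "E (arr a) (tail Q a, []) \<noteq> 0" using nz supp 2 by simp
    have "E (arr a) (tail Q a, []) + E (arr a) (tail Q a, []) = 0"
      using rel[OF a a not_ok_self, of "(tail Q a, [a])"] a loop
      by (simp add: mul_arr_left mul_arr_right NP_Cons)
    hence "2 * E (arr a) (tail Q a, []) = 0" by (simp only: mult_2)
    hence two: "(2 :: 'k) = 0" using nz' by simp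
    have "ok a b" if b: "b \<in> arcs Q" "b \<noteq> a" "tail Q b = head Q a" for b
    proof (rule ccontr)
      assume "\<not> ok a b"
      from rel[OF a b(1) this, of "(tail Q b, [b])", unfolded mul_arr_left mul_arr_right] show False
        using nz' b loop by (simp add: NP_Cons)
    qed
    moreover have "ok b a" if b: "b \<in> arcs Q" "b \<noteq> a" "head Q b = tail Q a" for b
    proof (rule ccontr)
      assume "\<not> ok b a"
      from rel[OF b(1) a this, of "(tail Q b, [b])", unfolded mul_arr_left mul_arr_right] show False
        using nz' b loop tail_in_verts[OF a] by (simp add: NP_Cons)
    qed
    ultimately have "(a, u, l) \<in> gentle_index" using a loop supp 2 by (auto simp: gentle_index_def)
    thus ?thesis using two by (simp add: outer_index_def)
  next
    case 3
    have hd: "hd l \<noteq> a"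
    proof
      assume "hd l = a"
      hence l: "l = a # tl l" using 3 by (cases l) auto
      hence "tl l \<noteq> []" using 3 by metis
      from starts[OF a this] show False using nz supp l by simp
    qed
    have last: "last l \<noteq> a"
    proof
      assume "last l = a"
      hence l: "l = butlast l @ [a]" using 3 append_butlast_last_id by metis
      hence "butlast l \<noteq> []" using 3 by (metis append_Nil)
      from ends[OF a this] show False using nz supp l by simp
    qed
    have "left_maximal (u, l)"
    proof (rule ccontr)
      assume "\<not> left_maximal (u, l)"
      then obtain b where b: "b \<in> arcs Q" "head Q b = u" "(tail Q b, b # l) \<in> NP"
        by (auto simp: left_maximal_def)
      have "ok b (hd l)" using b 3 by (simp add: NP_Cons)
      hence "\<not> ok b a" using hd ok_right_unique by blast
      from rel[OF b(1) a this, of "(tail Q b, b # l)", unfolded mul_arr_left mul_arr_right] show False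
        using b nz 3 last by simp
    qed
    moreover have "right_maximal (u, l)"
    proof (rule ccontr)
      assume "\<not> right_maximal (u, l)"
      then obtain b where b: "b \<in> arcs Q" "tail Q b = endpoint u l" "(u, l @ [b]) \<in> NP"
        by (auto simp: right_maximal_def)
      have "ok (last l) b" using b 3 by (simp add: NP_snoc)
      hence "\<not> ok a b" using last ok_left_unique by blast
      from rel[OF a b(1) this, of "(u, l @ [b])", unfolded mul_arr_left mul_arr_right] show False
        using b nz 3 hd by simp
    qed
    ultimately have "(a, u, l) \<in> parallel_index"
      using a supp hd last by (auto simp: parallel_index_def)
    thus ?thesis by (simp add: outer_index_def)
  qed
qed

text \<open>
  The coefficient of \<open>D x\<close> at a path is nonzero only if exactly one end of the path is \<open>x\<close>, and for a path from
  \<open>x\<close> to \<open>y \<noteq> x\<close> the coefficients in \<open>D x\<close> and \<open>D y\<close> are opposite, since \<open>x y = 0\<close>. So the element whose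
  coefficient at each path is read off from \<open>D\<close> of its endpoint works for all vertices at once.
\<close>

lemma inner_on_vertices:
  fixes D :: "('v \<times> 'e list \<Rightarrow> 'k::field) \<Rightarrow> 'v \<times> 'e list \<Rightarrow> 'k"
  assumes D: "derivation D"
  shows "\<exists>u\<in>K. \<forall>x\<in>verts Q. D (vert x) = comm (vert x) u"
proof -
  define w where "w = (\<lambda>(s, l). if (s, l) \<in> NP then - D (vert (endpoint s l)) (s, l) else 0)"
  have wK: "w \<in> K" by (auto simp: w_def coords_def)
  have DK: "D (vert x) \<in> K" if "x \<in> verts Q" for x using derivationD(1)[OF D, of "vert x"] that by simp
  have endpoint_verts: "endpoint s l \<in> verts Q" "s \<in> verts Q" if "(s, l) \<in> NP" for s l
    using NP_drop[OF that, of "length l"] that by (auto simp: NP_def)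
  have prod: "(if s = x then D (vert y) (s, l) else 0) + (if endpoint s l = y then D (vert x) (s, l) else 0) =
      (if x = y then D (vert x) (s, l) else 0)" if x: "x \<in> verts Q" and y: "y \<in> verts Q" for x y s l
  proof -
    have "mul (vert x) (vert y) = (if x = y then vert x else (\<lambda>p. 0 :: 'k))"
      using x y by (auto simp: fun_eq_iff mul_vert_left single_apply)
    hence "D (if x = y then vert x else (\<lambda>p. 0)) (s, l) = D (mul (vert x) (vert y)) (s, l)" by simp
    also have "\<dots> = mul (D (vert x)) (vert y) (s, l) + mul (vert x) (D (vert y)) (s, l)"
      using derivationD(4)[OF D, of "vert x" "vert y"] x y by simp
    finally have "D (if x = y then vert x else (\<lambda>p. 0)) (s, l) =
        (if s = x then D (vert y) (s, l) else 0) + (if endpoint s l = y then D (vert x) (s, l) else 0)"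
      by (simp only: mul_vert_left[OF DK[OF y]] mul_vert_right[OF DK[OF x]] add.commute)
    moreover have "D (if x = y then vert x else (\<lambda>p. 0)) (s, l) = (if x = y then D (vert x) (s, l) else 0)"
      using derivation_zero[OF D] by simp
    ultimately show ?thesis by simp
  qed
  have "D (vert x) (s, l) = comm (vert x) w (s, l)" if x: "x \<in> verts Q" for x s l
  proof (cases "(s, l) \<in> NP")
    case True
    let ?e = "D (vert (endpoint s l)) (s, l)"
    have w: "w (s, l) = - ?e" using True by (simp add: w_def)
    have "comm (vert x) w (s, l) = (if s = x then - ?e else 0) - (if endpoint s l = x then - ?e else 0)"
      by (simp only: comm_def mul_vert_left[OF wK] mul_vert_right[OF wK] w)
    moreover have "?e + D (vert x) (s, l) = 0" if "s = x" "endpoint s l \<noteq> x"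
      using prod[OF x endpoint_verts(1)[OF True], of s l] that by simp
    moreover have "?e = 0" if "s = x" "endpoint s l = x"
    proof -
      have "D (vert x) (s, l) + D (vert x) (s, l) = D (vert x) (s, l) + 0"
        using prod[OF x x, of s l] unfolding if_P[OF that(1)] if_P[OF that(2)] by (simp only: if_True refl add_0_right)
      hence "D (vert x) (s, l) = 0" by (rule add_left_imp_eq)
      thus ?thesis using that by simp
    qed
    moreover have "D (vert x) (s, l) = 0" if "s \<noteq> x" "endpoint s l \<noteq> x"
      using prod[OF x x, of s l] that by simp
    ultimately show ?thesis by (auto simp: eq_neg_iff_add_eq_0 add.commute)
  next
    case False
    thus ?thesis using coords_outside[OF DK[OF x]] coords_outside[OF comm_coords] by metis
  qed
  thus ?thesis using wK by (auto simp: fun_eq_iff)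
qed

text \<open>
  After the vertices, an element \<open>w\<close> is chosen whose commutators cancel the coefficients at \<open>(a, a)\<close> for \<open>a\<close>
  in the tree and at \<open>(a, a \<delta>)\<close> and \<open>(a, \<delta> a)\<close> for cycles \<open>\<delta>\<close>. At most one arrow prolongs \<open>\<delta>\<close> on each
  side, so \<open>w\<close> has one coefficient to satisfy at most two demands.
\<close>

theorem derivation_decomposition:
  fixes D :: "('v \<times> 'e list \<Rightarrow> 'k::field) \<Rightarrow> 'v \<times> 'e list \<Rightarrow> 'k"
  assumes D: "derivation D" and T: "T \<subseteq> arcs Q"
    and potential: "\<And>c :: 'e \<Rightarrow> 'k. \<exists>v. \<forall>a\<in>T. v (head Q a) - v (tail Q a) = c a"
  shows "\<exists>c\<in>coords (outer_index T ((2 :: 'k) = 0)). \<exists>u\<in>K. \<forall>f\<in>K. D f = (\<lambda>p. extension c f p + comm f u p)"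
proof -
  obtain u where u: "u \<in> K" and Du: "\<And>x. x \<in> verts Q \<Longrightarrow> D (vert x) = comm (vert x) u"
    using inner_on_vertices[OF D] by blast
  define D' where "D' = (\<lambda>f p. D f p - comm f u p)"
  have D': "derivation D'" unfolding D'_def by (rule derivation_diff[OF D derivation_comm])
  have D'_vert: "D' (vert x) = (\<lambda>p. 0)" if "x \<in> verts Q" for x using Du[OF that] by (simp add: D'_def)
  note supp = derivation_arr_support[OF D' D'_vert]
  obtain pot where pot: "\<And>a. a \<in> T \<Longrightarrow> pot (head Q a) - pot (tail Q a) = D' (arr a) (tail Q a, [a])"
    using potential[of "\<lambda>a. D' (arr a) (tail Q a, [a])"] by blast
  define before where "before = (\<lambda>s l. THE b. (tail Q b, b # l) \<in> NP \<and> head Q b = s)"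
  define after where "after = (\<lambda>s l. THE b. (s, l @ [b]) \<in> NP)"
  have before: "before (head Q b) l = b" if "(tail Q b, b # l) \<in> NP" "l \<noteq> []" for b l
    unfolding before_def
    by (rule the_equality) (use that ok_left_unique in \<open>auto simp: NP_Cons\<close>)
  have after: "after s l = b" if "(s, l @ [b]) \<in> NP" "l \<noteq> []" for s l b
    unfolding after_def
    by (rule the_equality) (use that ok_right_unique in \<open>auto simp: NP_snoc\<close>)
  \<comment> \<open>the demand from an arrow before the cycle takes precedence; the one from an arrow after it then holds by the Leibniz rule for the product of the two arrows\<close>
  define w where "w = (\<lambda>(s, l). if (s, l) \<notin> NP then 0 else if l = [] then pot s
     else if \<not> left_maximal (s, l) then D' (arr (before s l)) (tail Q (before s l), before s l # l)
     else if \<not> right_maximal (s, l) then - D' (arr (after s l)) (s, l @ [after s l]) else 0)"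
  have wK: "w \<in> K" by (auto simp: w_def coords_def)
  have w_before: "w (head Q b, l) = D' (arr b) (tail Q b, b # l)"
    if "(tail Q b, b # l) \<in> NP" "l \<noteq> []" for b l
  proof -
    have "(head Q b, l) \<in> NP" "b \<in> arcs Q" using that by (auto simp: NP_Cons)
    moreover from this have "\<not> left_maximal (head Q b, l)" using that by (auto simp: left_maximal_def)
    ultimately show ?thesis using that before[OF that] by (simp add: w_def)
  qed
  have w_after: "w (s, l) = - D' (arr b) (s, l @ [b])"
    if "(s, l @ [b]) \<in> NP" "l \<noteq> []" "left_maximal (s, l)" for s l b
  proof -
    have "(s, l) \<in> NP" "b \<in> arcs Q" "endpoint s l = tail Q b" using that by (auto simp: NP_snoc)
    moreover from this have "\<not> right_maximal (s, l)" using that by (auto simp: right_maximal_def)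
    ultimately show ?thesis using that after[OF that(1,2)] by (simp add: w_def)
  qed
  have w_cycle: "endpoint s l = s" if nz: "w (s, l) \<noteq> 0" for s l
  proof (cases "l = []")
    case False
    have p: "(s, l) \<in> NP" using nz by (auto simp: w_def split: if_splits)
    show ?thesis
    proof (cases "left_maximal (s, l)")
      case False
      then obtain b where b: "b \<in> arcs Q" "head Q b = s" "(tail Q b, b # l) \<in> NP"
        by (auto simp: left_maximal_def)
      have "D' (arr b) (tail Q b, b # l) \<noteq> 0" using w_before[OF b(3) \<open>l \<noteq> []\<close>] b(2) nz by simp
      from supp(3)[OF _ b(1) this] b(2) show ?thesis by simp
    next
      case True
      hence "\<not> right_maximal (s, l)" using nz \<open>l \<noteq> []\<close> p by (auto simp: w_def)
      then obtain b where b: "b \<in> arcs Q" "tail Q b = endpoint s l" "(s, l @ [b]) \<in> NP"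
        by (auto simp: right_maximal_def)
      have "D' (arr b) (s, l @ [b]) \<noteq> 0" using w_after[OF b(3) \<open>l \<noteq> []\<close> True] nz by simp
      from supp(2)[OF _ b(1) this] b(2) show ?thesis by simp
    qed
  qed simp
  define E where "E = (\<lambda>f p. D' f p - comm f w p)"
  have E: "derivation E" unfolding E_def by (rule derivation_diff[OF D' derivation_comm])
  have E_vert: "E (vert x) = (\<lambda>p. 0)" if x: "x \<in> verts Q" for x
  proof -
    have "comm (vert x) w (s, l) = 0" for s l
      using w_cycle[of s l] wK
      by (cases "w (s, l) = 0") (auto simp: comm_def mul_vert_left mul_vert_right)
    thus ?thesis using D'_vert[OF x] by (auto simp: E_def fun_eq_iff)
  qed
  have E_tree: "E (arr a) (tail Q a, [a]) = 0" if a: "a \<in> T" for a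
  proof -
    have "(tail Q a, [a]) \<in> NP" using a T by (auto simp: NP_Cons)
    thus ?thesis using pot[OF a] a T by (auto simp: E_def comm_arr w_def)
  qed
  have E_outside: "E (arr a) p = 0" if "a \<in> arcs Q" "p \<notin> NP" for a p
    using coords_outside[OF derivationD(1)[OF E arr_coords[OF that(1)]] that(2)] .
  have E_starts: "E (arr a) (tail Q a, a # l) = 0" if a: "a \<in> arcs Q" and l: "l \<noteq> []" for a l
  proof (cases "(tail Q a, a # l) \<in> NP")
    case True
    thus ?thesis using l starts_and_ends[OF True l] w_before[OF True l] by (simp add: E_def comm_arr)
  qed (use E_outside[OF a] in simp)
  have E_ends: "E (arr a) (tail Q a, l @ [a]) = 0" if a: "a \<in> arcs Q" and l: "l \<noteq> []" for a l
  proof (cases "(tail Q a, l @ [a]) \<in> NP")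
    case True
    show ?thesis
    proof (cases "left_maximal (tail Q a, l)")
      case lm: True
      thus ?thesis using l ends_and_starts[OF True l] w_after[OF True l lm] True by (simp add: E_def comm_arr)
    next
      case False
      then obtain b where b: "b \<in> arcs Q" "head Q b = tail Q a" "(tail Q b, b # l) \<in> NP"
        by (auto simp: left_maximal_def)
      have okb: "ok b (hd l)" using b l by (simp add: NP_Cons)
      have oka: "ok (last l) a" using True l by (simp add: NP_snoc)
      have lNP: "(tail Q a, l) \<in> NP" using True by (simp add: NP_snoc)
      \<comment> \<open>here \<open>b l a\<close> is nonzero and \<open>b a = 0\<close>, so the Leibniz rule relates the coefficients at \<open>b l\<close> and \<open>l a\<close>\<close>
      have "\<not> ok b a"
      proof
        assume "ok b a"
        hence "a = hd l" using okb ok_right_unique by blast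
        thus False using no_cycle[OF lNP l] oka by simp
      qed
      moreover have "(tail Q b, b # l @ [a]) \<in> NP"
        using b True l okb by (simp add: NP_Cons)
      ultimately show ?thesis
        using derivation_relation[OF E b(1) a, of "(tail Q b, b # l @ [a])"] E_starts[OF b(1) l] b(2)
        by (simp add: mul_arr_left mul_arr_right butlast_append)
    qed
  qed (use E_outside[OF a] in simp)
  define c where "c = (\<lambda>(a, p). if a \<in> arcs Q then E (arr a) p else 0)"
  have c: "c \<in> coords (outer_index T ((2 :: 'k) = 0))"
    unfolding coords_def c_def
    using normalised_derivation_coords[OF E E_vert E_tree E_starts E_ends] by fastforce
  have ext: "extendable c" by (rule outer_index_extendable[OF c])
  have "E f = extension c f" if "f \<in> K" for f
    by (rule derivation_eqI[OF E derivation_extension[OF ext] _ _ that])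
      (simp_all add: E_vert extension_vert extension_arr[OF ext], simp add: c_def)
  hence "D f = (\<lambda>p. extension c f p + comm f (\<lambda>q. w q + u q) p)" if "f \<in> K" for f
  proof -
    have "D f p = E f p + comm f w p + comm f u p" for p by (simp add: E_def D'_def)
    moreover have "comm f (\<lambda>q. w q + u q) p = comm f w p + comm f u p" for p
      by (simp add: comm_def mul_add_left mul_add_right)
    ultimately show ?thesis using \<open>\<And>f. f \<in> K \<Longrightarrow> E f = extension c f\<close>[OF that]
      by (simp add: fun_eq_iff add.assoc)
  qed
  thus ?thesis using c coords_add[OF wK u] by blast
qed

text \<open>
  A commutator with \<open>a\<close> has coefficients only at paths that start or end with \<open>a\<close>, and the one at \<open>a\<close> is a
  difference of the coefficients at its ends. Vanishing on the tree makes these constant.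
\<close>

theorem outer_derivation_unique:
  fixes c :: "'e \<times> 'v \<times> 'e list \<Rightarrow> 'k::field"
  assumes c: "c \<in> coords (outer_index T ((2 :: 'k) = 0))"
    and T: "T \<subseteq> arcs Q"
    and const: "\<And>v :: 'v \<Rightarrow> 'k. \<forall>a\<in>T. v (head Q a) = v (tail Q a) \<Longrightarrow> \<exists>k. \<forall>x\<in>verts Q. v x = k"
    and inner: "\<And>f. f \<in> K \<Longrightarrow> extension c f = comm f u"
  shows "c = (\<lambda>s. 0)"
proof -
  have ext: "extendable c" by (rule outer_index_extendable[OF c])
  have val: "c (a, p) = comm (arr a) u p" if a: "a \<in> arcs Q" for a p
    using inner[OF arr_coords[OF a]] extension_arr[OF ext a] by (metis)
  have scale: "c (a, tail Q a, [a]) = u (head Q a, []) - u (tail Q a, [])" if a: "a \<in> arcs Q" for a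
    using val[OF a, of "(tail Q a, [a])"] a by (simp add: comm_arr NP_Cons)
  have "u (head Q a, []) = u (tail Q a, [])" if a: "a \<in> T" for a
  proof -
    have "(a, tail Q a, [a]) \<notin> outer_index T ((2 :: 'k) = 0)"
      using a by (auto simp: outer_index_def parallel_index_def scaling_index_def gentle_index_def)
    thus ?thesis using coords_outside[OF c] scale[of a] a T by force
  qed
  then obtain k where k: "\<And>x. x \<in> verts Q \<Longrightarrow> u (x, []) = k"
    using const[of "\<lambda>x. u (x, [])"] by blast
  have "c (a, p) = 0" if s: "(a, p) \<in> outer_index T ((2 :: 'k) = 0)" for a p
  proof -
    obtain x l where p: "p = (x, l)" by (cases p)
    have a: "a \<in> arcs Q"
      using s by (auto simp: outer_index_def parallel_index_def scaling_index_def gentle_index_def split: if_splits)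
    consider "(a, x, l) \<in> parallel_index" | "(x, l) = (tail Q a, [a])" | "l = []" "(x, l) \<in> NP"
      using s unfolding p by (auto simp: outer_index_def scaling_index_def gentle_index_def split: if_splits)
    thus ?thesis
    proof cases
      case 1
      hence "(x, l) \<in> NP" "\<not> (\<exists>r. l = a # r)" "\<not> (\<exists>r. l = r @ [a])" by (auto simp: parallel_index_def)
      moreover from this have "l \<noteq> [] \<Longrightarrow> hd l \<noteq> a" "l \<noteq> [] \<Longrightarrow> last l \<noteq> a"
        by (metis list.collapse) (metis calculation(3) append_butlast_last_id)
      ultimately show ?thesis using val[OF a, of p] by (auto simp: p comm_arr)
    next
      case 2
      thus ?thesis using scale[OF a] k a by (simp add: p)
    next
      case 3
      thus ?thesis using val[OF a, of p] by (simp add: p comm_arr)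
    qed
  qed
  hence "c s = 0" for s
    using coords_outside[OF c, of s] by (cases "s \<in> outer_index T ((2 :: 'k) = 0)") (cases s, auto)
  thus ?thesis by (simp add: fun_eq_iff)
qed

end

section \<open>Monomial ideals of the path algebra\<close>

lemma path_algebra_simps [simp]:
  "carrier (path_algebra Q) = {f. finite {p. f p \<noteq> 0} \<and> {p. f p \<noteq> 0} \<subseteq> paths Q}"
  "add (path_algebra Q) = (\<lambda>f g p. f p + g p)"
  "zero (path_algebra Q) = (\<lambda>p. 0)"
  "module.smult (path_algebra Q) = (\<lambda>c f p. c * f p)"
  "one (path_algebra Q) = (\<lambda>p. if p \<in> trivial_paths Q then 1 else 0)"
  by (simp_all add: path_algebra_def)

lemma path_algebra_mult: "mult (path_algebra Q) f g (u, l) =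
    (\<Sum>i\<le>length l. f (u, take i l) * g (tgt Q (u, take i l), drop i l))"
  by (simp add: path_algebra_def)

lemma path_elem_apply: "path_elem p q = (if q = p then 1 else 0)"
  by (simp add: path_elem_def)

lemma tgt_eq: "tgt Q (u, l) = (if l = [] then u else head Q (last l))"
  by (simp add: tgt_def pre_digraph.awalk_verts_conv)

lemma tgt_Cons: "tgt Q (u, a # l) = tgt Q (head Q a, l)"
  by (simp add: tgt_eq)

context wf_digraph
begin

lemma paths_Nil: "(u, []) \<in> paths G \<longleftrightarrow> u \<in> verts G"
  by (simp add: paths_def src_def tgt_eq awalk_def)

lemma paths_Cons: "(u, a # l) \<in> paths G \<longleftrightarrow> a \<in> arcs G \<and> u = tail G a \<and> (head G a, l) \<in> paths G"
  by (auto simp: paths_def src_def tgt_Cons awalk_def)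

lemma paths_append: "(u, l @ l') \<in> paths G \<longleftrightarrow> (u, l) \<in> paths G \<and> (tgt G (u, l), l') \<in> paths G"
proof (induction l arbitrary: u)
  case Nil
  show ?case by (cases l') (auto simp: paths_Nil paths_Cons tgt_eq)
next
  case (Cons a l)
  thus ?case by (auto simp: paths_Cons tgt_Cons)
qed

end

lemma path_elem_mult:
  assumes "v = tgt Q (u, l)"
  shows "mult (path_algebra Q) (path_elem (u, l)) (path_elem (v, l')) = (path_elem (u, l @ l') :: _ \<Rightarrow> 'k::field)"
proof -
  have "mult (path_algebra Q) (path_elem (u, l)) (path_elem (v, l')) (x, k) = (path_elem (u, l @ l') (x, k) :: 'k)" for x k
  proof (cases "x = u \<and> k = l @ l'")
    case True
    have "(\<Sum>i\<le>length k. path_elem (u, l) (x, take i k) * path_elem (v, l') (tgt Q (x, take i k), drop i k)) =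
      (\<Sum>i\<le>length k. if i = length l then 1 else (0 :: 'k))"
    proof (intro sum.cong refl)
      fix i assume "i \<in> {..length k}"
      hence "length (take i k) = i" by simp
      hence "take i k = l \<longleftrightarrow> i = length l"
        using True by (metis append_eq_conv_conj)
      thus "path_elem (u, l) (x, take i k) * path_elem (v, l') (tgt Q (x, take i k), drop i k) =
          (if i = length l then 1 else (0 :: 'k))"
        using True assms by (auto simp: path_elem_apply)
    qed
    thus ?thesis using True by (simp add: path_algebra_mult path_elem_apply)
  next
    case False
    have "path_elem (u, l) (x, take i k) * path_elem (v, l') (tgt Q (x, take i k), drop i k) = (0 :: 'k)" for i
      using False append_take_drop_id[of i k] by (auto simp: path_elem_apply)
    hence "mult (path_algebra Q) (path_elem (u, l)) (path_elem (v, l')) (x, k) = (0 :: 'k)"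
      by (simp only: path_algebra_mult sum.neutral_const)
    thus ?thesis using False by (auto simp: path_elem_apply)
  qed
  thus ?thesis by (auto simp: fun_eq_iff)
qed

lemma not_successivelyE:
  "\<not> successively P l \<Longrightarrow> \<exists>xs x y ys. l = xs @ [x, y] @ ys \<and> \<not> P x y"
proof (induction P l rule: successively.induct)
  case (3 P x y l)
  show ?case
  proof (cases "P x y")
    case True
    then obtain xs x' y' ys where "y # l = xs @ [x', y'] @ ys" "\<not> P x' y'" using 3 by auto
    thus ?thesis by (intro exI[of _ "x # xs"]) auto
  qed (auto intro: exI[of _ "[]"])
qed auto

lemma successively_appendD: "successively P (l @ l') \<Longrightarrow> successively P l \<and> successively P l'"
  by (simp add: successively_append_iff)

locale quadratic_monomial_ideal = wf_digraph Q for Q :: "('v, 'e) pre_digraph" +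
  fixes R :: "('v, 'e) path set" and I :: "(('v, 'e) path \<Rightarrow> 'k::field) set"
  assumes R: "R \<subseteq> {p \<in> paths Q. length (snd p) = 2}"
    and I_gen: "I = Idl\<^bsub>path_algebra Q\<^esub> (path_elem ` R)"
    and ideal_I: "ideal I (path_algebra Q)"
begin

sublocale I: ideal I "path_algebra Q" by (rule ideal_I)

abbreviation "kQ \<equiv> path_algebra Q :: ('k, ('v, 'e) path \<Rightarrow> 'k) module"

definition avoids :: "'e list \<Rightarrow> bool" where
  "avoids l \<longleftrightarrow> successively (\<lambda>a b. (tail Q a, [a, b]) \<notin> R) l"

lemma path_elem_carrier: "p \<in> paths Q \<Longrightarrow> path_elem p \<in> carrier kQ"
  by (auto simp: path_elem_def)

lemma uminus_kQ: "f \<in> carrier kQ \<Longrightarrow> \<ominus>\<^bsub>kQ\<^esub> f = (\<lambda>p. - f p)"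
  by (rule I.minus_equality) auto

lemma minus_kQ: "f \<in> carrier kQ \<Longrightarrow> g \<in> carrier kQ \<Longrightarrow> f \<ominus>\<^bsub>kQ\<^esub> g = (\<lambda>p. f p - g p)"
  using uminus_kQ[of g] by (simp add: a_minus_def)

definition nonavoiding :: "(('v, 'e) path \<Rightarrow> 'k) set" where
  "nonavoiding = {f \<in> carrier kQ. \<forall>u l. f (u, l) \<noteq> 0 \<longrightarrow> \<not> avoids l}"

lemma avoids_take_drop: "avoids l \<Longrightarrow> avoids (take i l) \<and> avoids (drop i l)"
  unfolding avoids_def using successively_appendD[of _ "take i l" "drop i l"] by simp

lemma mult_nonzero:
  assumes "mult kQ f g (u, l) \<noteq> 0"
  shows "\<exists>i v. f (u, take i l) \<noteq> 0 \<and> g (v, drop i l) \<noteq> 0"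
proof -
  have "(\<Sum>i\<le>length l. f (u, take i l) * g (tgt Q (u, take i l), drop i l)) \<noteq> 0"
    using assms by (simp add: path_algebra_mult)
  then obtain i where "f (u, take i l) * g (tgt Q (u, take i l), drop i l) \<noteq> 0"
    using sum.not_neutral_contains_not_neutral by blast
  thus ?thesis by auto
qed

text \<open>
  A path is bad if one of its pieces is bad, so the elements supported on bad paths absorb products.
\<close>

lemma ideal_nonavoiding: "ideal nonavoiding kQ"
proof (rule idealI)
  show "ring kQ" by (rule I.ring_axioms)
  show "subgroup nonavoiding (add_monoid kQ)"
  proof
    show "nonavoiding \<subseteq> carrier (add_monoid kQ)" by (auto simp: nonavoiding_def)
    show "\<one>\<^bsub>add_monoid kQ\<^esub> \<in> nonavoiding" by (auto simp: nonavoiding_def)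
    show "x \<otimes>\<^bsub>add_monoid kQ\<^esub> y \<in> nonavoiding" if "x \<in> nonavoiding" "y \<in> nonavoiding" for x y
    proof -
      have "x \<oplus>\<^bsub>kQ\<^esub> y \<in> carrier kQ" using that by (intro I.a_closed) (auto simp: nonavoiding_def)
      moreover have "\<not> avoids l" if "x (u, l) + y (u, l) \<noteq> 0" for u l
        using that \<open>x \<in> nonavoiding\<close> \<open>y \<in> nonavoiding\<close> unfolding nonavoiding_def
        by (cases "x (u, l) = 0") auto
      ultimately show ?thesis unfolding nonavoiding_def by simp
    qed
    show "inv\<^bsub>add_monoid kQ\<^esub> x \<in> nonavoiding" if "x \<in> nonavoiding" for x
      using that uminus_kQ[of x] by (simp add: nonavoiding_def a_inv_def)
  qed
next
  fix a x assume a: "a \<in> nonavoiding" and x: "x \<in> carrier kQ"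
  have aK: "a \<in> carrier kQ" using a unfolding nonavoiding_def by blast
  have av: "\<not> avoids l" if "a (u, l) \<noteq> 0" for u l using a that unfolding nonavoiding_def by blast
  have "\<not> avoids l" if "(x \<otimes>\<^bsub>kQ\<^esub> a) (u, l) \<noteq> 0" for u l
    using mult_nonzero[OF that] av avoids_take_drop by blast
  thus "x \<otimes>\<^bsub>kQ\<^esub> a \<in> nonavoiding" using I.m_closed[OF x aK] unfolding nonavoiding_def by blast
  have "\<not> avoids l" if "(a \<otimes>\<^bsub>kQ\<^esub> x) (u, l) \<noteq> 0" for u l
    using mult_nonzero[OF that] av avoids_take_drop by blast
  thus "a \<otimes>\<^bsub>kQ\<^esub> x \<in> nonavoiding" using I.m_closed[OF aK x] unfolding nonavoiding_def by blast
qed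

lemma R_carrier: "path_elem ` R \<subseteq> carrier kQ"
  using R path_elem_carrier by blast

lemma I_subset: "I \<subseteq> nonavoiding"
  unfolding I_gen
proof (rule I.genideal_minimal[OF ideal_nonavoiding], rule image_subsetI)
  fix p assume p: "p \<in> R"
  then obtain u a b where pab: "p = (u, [a, b])" "p \<in> paths Q"
    using R by (cases p) (auto simp: length_Suc_conv numeral_2_eq_2)
  hence "\<not> avoids [a, b]" using p by (simp add: avoids_def paths_Cons)
  thus "path_elem p \<in> nonavoiding"
    using pab path_elem_carrier[of p] unfolding nonavoiding_def by (auto simp: path_elem_apply)
qed

lemma path_elem_in_I:
  assumes p: "(u, l) \<in> paths Q" and l: "\<not> avoids l"
  shows "path_elem (u, l) \<in> I"
proof -
  obtain xs a b ys where l: "l = xs @ [a, b] @ ys" and ab: "(tail Q a, [a, b]) \<in> R"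
    using not_successivelyE l unfolding avoids_def by blast
  have xs: "(u, xs) \<in> paths Q" "tgt Q (u, xs) = tail Q a" and ys: "(head Q b, ys) \<in> paths Q"
    using p unfolding l by (auto simp: paths_append paths_Cons)
  have "path_elem (tail Q a, [a, b]) \<in> I"
    unfolding I_gen using I.genideal_self[OF R_carrier] ab by blast
  hence "path_elem (u, xs) \<otimes>\<^bsub>kQ\<^esub> (path_elem (tail Q a, [a, b]) \<otimes>\<^bsub>kQ\<^esub> path_elem (head Q b, ys)) \<in> I"
    using path_elem_carrier[OF xs(1)] path_elem_carrier[OF ys] by (intro I.I_l_closed I.I_r_closed)
  thus ?thesis
    using xs by (simp add: path_elem_mult tgt_eq l)
qed

text \<open>
  Ideals are closed under scalars because a scalar multiple of a path is a product with the same multiple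
  of the trivial path at its source.
\<close>

lemma smult_path_elem_in_I:
  assumes p: "(u, l) \<in> paths Q" and l: "\<not> avoids l"
  shows "(\<lambda>q. c * path_elem (u, l) q) \<in> I"
proof -
  have u: "(u, []) \<in> paths Q" using p by (cases l) (auto simp: paths_Nil paths_Cons)
  have "(\<lambda>q. c * path_elem (u, []) q) \<in> carrier kQ"
    using u by (auto simp: path_elem_apply intro: finite_subset[of _ "{(u, [])}"])
  hence "(\<lambda>q. c * path_elem (u, []) q) \<otimes>\<^bsub>kQ\<^esub> path_elem (u, l) \<in> I"
    by (intro I.I_l_closed path_elem_in_I[OF p l])
  moreover have "(\<lambda>q. c * path_elem (u, []) q) \<otimes>\<^bsub>kQ\<^esub> path_elem (u, l) = (\<lambda>q. c * path_elem (u, l) q)"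
  proof -
    have "((\<lambda>q. c * path_elem (u, []) q) \<otimes>\<^bsub>kQ\<^esub> path_elem (u, l)) (x, k) =
        c * (path_elem (u, []) \<otimes>\<^bsub>kQ\<^esub> path_elem (u, l)) (x, k)" for x k
      by (simp add: path_algebra_mult sum_distrib_left mult.assoc)
    thus ?thesis by (auto simp: fun_eq_iff path_elem_mult tgt_eq)
  qed
  ultimately show ?thesis by simp
qed

text \<open>
  Every path that contains a relation is a product with it, hence lies in the ideal; conversely the span
  of these paths is an ideal that contains the generators.
\<close>

theorem I_eq: "I = nonavoiding"
proof
  show "nonavoiding \<subseteq> I"
  proof
    fix f assume f: "f \<in> nonavoiding"
    have "f \<in> I" if "finite S" "f \<in> nonavoiding" "{p. f p \<noteq> 0} = S" for S f
      using that
    proof (induction S arbitrary: f rule: finite_induct)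
      case empty
      hence "f = (\<lambda>p. 0)" by (auto simp: fun_eq_iff)
      thus ?case using additive_subgroup.zero_closed[OF I.is_additive_subgroup] by simp
    next
      case (insert q S)
      let ?g = "\<lambda>p. if p = q then 0 else f p"
      obtain u l where q: "q = (u, l)" by (cases q)
      have supp: "{p. ?g p \<noteq> 0} = S" using insert.hyps insert.prems(2) by auto
      have fK: "f \<in> carrier kQ" and fav: "\<And>u l. f (u, l) \<noteq> 0 \<Longrightarrow> \<not> avoids l"
        using insert.prems(1) unfolding nonavoiding_def by blast+
      have "?g \<in> carrier kQ" using insert.hyps(1) supp fK insert.prems(2) by auto
      hence "?g \<in> nonavoiding" using fav unfolding nonavoiding_def by auto
      hence g: "?g \<in> I" using insert.IH supp by blast
      have fq: "f q \<noteq> 0" using insert.prems(2) by auto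
      hence "q \<in> paths Q" "\<not> avoids l" using fK fav[of u l] unfolding q by auto
      hence "(\<lambda>p. f q * path_elem q p) \<in> I" unfolding q by (intro smult_path_elem_in_I)
      from additive_subgroup.a_closed[OF I.is_additive_subgroup g this] have "(\<lambda>p. ?g p + f q * path_elem q p) \<in> I" by simp
      moreover have "(\<lambda>p. ?g p + f q * path_elem q p) = f" by (auto simp: path_elem_apply)
      ultimately show ?case by simp
    qed
    moreover have "finite {p. f p \<noteq> 0}" using f unfolding nonavoiding_def by simp
    ultimately show "f \<in> I" using f by blast
  qed
qed (rule I_subset)

lemma in_I_iff: "f \<in> I \<longleftrightarrow> f \<in> carrier kQ \<and> (\<forall>u l. avoids l \<longrightarrow> f (u, l) = 0)"
  unfolding I_eq nonavoiding_def by blast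

lemma path_elem_in_I_iff: "(u, l) \<in> paths Q \<Longrightarrow> path_elem (u, l) \<in> I \<longleftrightarrow> \<not> avoids l"
  using path_elem_in_I[of u l] in_I_iff[of "path_elem (u, l)"] by (auto simp: path_elem_apply)

end

lemma path_elem_in_power:
  assumes "wf_digraph Q" and ring: "ring (path_algebra Q :: ('k::field, _) module)"
    and p: "(u, l) \<in> paths Q"
  shows "(path_elem (u, l) :: _ \<Rightarrow> 'k) \<in> ideal_power (path_algebra Q) (arrow_ideal Q) (length l)"
  using p
proof (induction l rule: rev_induct)
  case Nil
  thus ?case by (auto simp: path_elem_apply)
next
  case (snoc a l)
  interpret wf_digraph Q by fact
  interpret kQ: ring "path_algebra Q :: ('k, _) module" by fact
  have p: "(u, l) \<in> paths Q" "(tgt Q (u, l), [a]) \<in> paths Q" using snoc.prems by (auto simp: paths_append)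
  have "path_elem ` arrow_paths Q \<subseteq> carrier (path_algebra Q :: ('k, _) module)"
    by (auto simp: arrow_paths_def path_elem_apply split: if_splits)
  moreover have "(tgt Q (u, l), [a]) \<in> arrow_paths Q" using p by (simp add: arrow_paths_def)
  ultimately have "(path_elem (tgt Q (u, l), [a]) :: _ \<Rightarrow> 'k) \<in> arrow_ideal Q"
    unfolding arrow_ideal_def using kQ.genideal_self by blast
  from ideal_prod.prod[OF snoc.IH[OF p(1)] this, of "path_algebra Q"] show ?case
    by (simp add: path_elem_mult)
qed

section \<open>Quadratic string algebras as algebras of nonzero paths\<close>

text \<open>
  The hypothesis provides the ring structure of the path algebra, which is part of \<open>I\<close> being an
  ideal.
\<close>

locale quadratic_string_algebra =
  fixes Q :: "('v, 'e) pre_digraph" and I :: "(('v, 'e) path \<Rightarrow> 'k::field) set"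
  assumes quadratic_string: "quadratic_string Q I"
begin

sublocale fin_digraph Q
  using quadratic_string by (simp add: quadratic_string_def)

definition relations :: "('v, 'e) path set" where
  "relations = (SOME R. R \<subseteq> {p \<in> paths Q. length (snd p) = 2} \<and>
     I = Idl\<^bsub>path_algebra Q\<^esub> (path_elem ` R))"

sublocale quadratic_monomial_ideal Q relations I
proof (intro quadratic_monomial_ideal.intro quadratic_monomial_ideal_axioms.intro wf_digraph_axioms)
  have "\<exists>R. R \<subseteq> {p \<in> paths Q. length (snd p) = 2} \<and> I = Idl\<^bsub>path_algebra Q\<^esub> (path_elem ` R)"
    using quadratic_string by (auto simp: quadratic_string_def)
  from someI_ex[OF this] show "relations \<subseteq> {p \<in> paths Q. length (snd p) = 2}"
    "I = Idl\<^bsub>path_algebra Q\<^esub> (path_elem ` relations)"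
    unfolding relations_def by blast+
  show "ideal I (path_algebra Q)"
    using quadratic_string by (simp add: quadratic_string_def admissible_ideal_def)
qed

definition ok :: "'e \<Rightarrow> 'e \<Rightarrow> bool" where
  "ok a b \<longleftrightarrow> a \<in> arcs Q \<and> b \<in> arcs Q \<and> arrows_notin Q I a b"

lemma ok_iff:
  "ok a b \<longleftrightarrow> a \<in> arcs Q \<and> b \<in> arcs Q \<and> head Q a = tail Q b \<and> (tail Q a, [a, b]) \<notin> relations"
  using path_elem_in_I_iff[of "tail Q a" "[a, b]"]
  by (auto simp: ok_def arrows_notin_def paths_Cons paths_Nil avoids_def)

lemma ok_path:
  "set l \<subseteq> arcs Q \<Longrightarrow> successively ok l \<Longrightarrow> l \<noteq> [] \<Longrightarrow> (tail Q (hd l), l) \<in> paths Q \<and> avoids l"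
proof (induction l)
  case (Cons a l)
  show ?case
  proof (cases l)
    case Nil
    thus ?thesis using Cons.prems by (simp add: paths_Cons paths_Nil avoids_def)
  next
    case (Cons b l')
    thus ?thesis using Cons.prems Cons.IH by (auto simp: paths_Cons avoids_def ok_iff)
  qed
qed simp

text \<open>
  A path of length \<open>m\<close> lies in the \<open>m\<close>-th power of the arrow ideal, hence in \<open>I\<close> for large \<open>m\<close>.
\<close>

lemma ok_length_bound: "\<exists>m. \<forall>l. set l \<subseteq> arcs Q \<longrightarrow> successively ok l \<longrightarrow> length l \<le> m"
proof -
  obtain m where m: "m \<ge> 2" "ideal_power (path_algebra Q) (arrow_ideal Q) m \<subseteq> I"
    using quadratic_string by (auto simp: quadratic_string_def admissible_ideal_def)
  have "length l \<le> m" if l: "set l \<subseteq> arcs Q" "successively ok l" for l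
  proof (rule ccontr)
    assume "\<not> length l \<le> m"
    hence len: "length (take m l) = m" by simp
    hence ne: "take m l \<noteq> []" using m(1) by auto
    have s: "set (take m l) \<subseteq> arcs Q" using l(1) set_take_subset by fast
    have "successively ok (take m l)" using successively_appendD[of ok "take m l" "drop m l"] l(2) by simp
    from ok_path[OF s this ne] have p: "(tail Q (hd (take m l)), take m l) \<in> paths Q" "avoids (take m l)" by auto
    have "(path_elem (tail Q (hd (take m l)), take m l) :: _ \<Rightarrow> 'k) \<in> I"
      using path_elem_in_power[OF wf_digraph_axioms I.ring_axioms p(1)] m(2) len by auto
    thus False using path_elem_in_I_iff[OF p(1)] p(2) by simp
  qed
  thus ?thesis by blast
qed

sublocale string_quiver Q ok
proof unfold_locales
  show "Digraph_Component.connected Q" using quadratic_string by (simp add: quadratic_string_def)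
  show "a \<in> arcs Q \<and> b \<in> arcs Q \<and> head Q a = tail Q b" if "ok a b" for a b
    using that by (simp add: ok_iff)
  have unique: "card {b \<in> arcs Q. arrows_notin Q I a b} \<le> 1 \<and> card {b \<in> arcs Q. arrows_notin Q I b a} \<le> 1"
    if "a \<in> arcs Q" for a
    using quadratic_string that unfolding quadratic_string_def by blast
  have card_1: "x = y" if "card S \<le> 1" "S \<subseteq> arcs Q" "x \<in> S" "y \<in> S" for S :: "'e set" and x y
    using that card_le_Suc0_iff_eq[of S] finite_subset[OF that(2) finite_arcs] by (metis One_nat_def)
  show "b = b'" if "ok a b" "ok a b'" for a b b'
  proof (rule card_1)
    show "card {b \<in> arcs Q. arrows_notin Q I a b} \<le> 1" using unique[of a] that(1) by (simp only: ok_def)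
  qed (use that in \<open>simp_all add: ok_def\<close>)
  show "a = a'" if "ok a b" "ok a' b" for a a' b
  proof (rule card_1)
    show "card {a \<in> arcs Q. arrows_notin Q I a b} \<le> 1" using unique[of b] that(1) by (simp only: ok_def)
  qed (use that in \<open>simp_all add: ok_def\<close>)
  obtain m where "\<forall>l. set l \<subseteq> arcs Q \<longrightarrow> successively ok l \<longrightarrow> length l \<le> m" using ok_length_bound by (rule exE)
  hence "{l. set l \<subseteq> arcs Q \<and> successively ok l} \<subseteq> {l. set l \<subseteq> arcs Q \<and> length l \<le> m}" by auto
  thus "finite {l. set l \<subseteq> arcs Q \<and> successively ok l}"
    by (rule finite_subset) (rule finite_lists_length_le[OF finite_arcs])
qed

lemma NP_iff: "(u, l) \<in> NP \<longleftrightarrow> (u, l) \<in> paths Q \<and> avoids l"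
proof (induction l arbitrary: u)
  case Nil
  show ?case by (simp add: paths_Nil avoids_def)
next
  case (Cons a l)
  show ?case
  proof (cases l)
    case Nil
    thus ?thesis by (simp add: NP_Cons paths_Cons paths_Nil avoids_def)
  next
    case (Cons b l')
    have "avoids (a # l) \<longleftrightarrow> (tail Q a, [a, b]) \<notin> relations \<and> avoids l" by (simp add: Cons avoids_def)
    moreover have "(u, a # l) \<in> NP \<longleftrightarrow> a \<in> arcs Q \<and> u = tail Q a \<and> (head Q a, l) \<in> NP \<and> ok a b"
      using NP_Cons[of u a l] Cons by simp
    moreover have "b \<in> arcs Q \<and> head Q a = tail Q b" if "(head Q a, l) \<in> paths Q"
      using that unfolding Cons paths_Cons by blast
    ultimately show ?thesis using Cons.IH[of "head Q a"] paths_Cons[of u a l] ok_iff[of a b] by blast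
  qed
qed

lemma nonzero_paths_eq: "nonzero_paths Q I = NP"
  using NP_iff path_elem_in_I_iff by (auto simp: nonzero_paths_def)

lemma path_elem_notin_iff: "(u, l) \<in> paths Q \<Longrightarrow> path_elem (u, l) \<notin> I \<longleftrightarrow> (u, l) \<in> NP"
  using NP_iff path_elem_in_I_iff by blast

abbreviation "A \<equiv> bound_quiver_algebra Q I"

text \<open>
  The polymorphic \<open>K\<close> leaves the scalars open; here they are those of \<open>I\<close>.
\<close>

abbreviation KK :: "('v \<times> 'e list \<Rightarrow> 'k) set" where "KK \<equiv> K"

definition cls :: "('v \<times> 'e list \<Rightarrow> 'k) \<Rightarrow> ('v \<times> 'e list \<Rightarrow> 'k) set" where
  "cls f = I +>\<^bsub>kQ\<^esub> f"

lemma A_simps: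
  "carrier A = cls ` carrier kQ"
  "mult A = rcoset_mult kQ I"
  "add A = set_add kQ"
  "one A = cls (one kQ)"
  "zero A = I"
  "module.smult A c X = I <+>\<^bsub>kQ\<^esub> (\<lambda>f. c \<odot>\<^bsub>kQ\<^esub> f) ` X"
  by (auto simp: bound_quiver_algebra_def quotient_module_def ring.defs module.defs FactRing_def
      A_RCOSETS_def' cls_def)

lemma KK_carrier: "f \<in> KK \<Longrightarrow> f \<in> carrier kQ"
proof -
  assume f: "f \<in> KK"
  hence "{p. f p \<noteq> 0} \<subseteq> NP" by (auto simp: coords_def)
  moreover have "NP \<subseteq> paths Q" using NP_iff by auto
  ultimately show ?thesis using finite_subset[OF _ finite_NP] by auto
qed

lemma cls_eq_iff:
  assumes f: "f \<in> carrier kQ" and g: "g \<in> carrier kQ"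
  shows "cls f = cls g \<longleftrightarrow> (\<forall>p\<in>NP. f p = g p)"
proof -
  have c: "(\<lambda>p. f p - g p) \<in> carrier kQ" using I.minus_closed[OF f g] minus_kQ[OF f g] by simp
  have out: "f p = 0" "g p = 0" if "p \<notin> paths Q" for p using f g that by auto
  have "cls f = cls g \<longleftrightarrow> (\<lambda>p. f p - g p) \<in> I"
    using I.quotient_eq_iff_same_a_r_cos[OF ideal_I f g] minus_kQ[OF f g] by (simp add: cls_def)
  also have "\<dots> \<longleftrightarrow> (\<forall>u l. avoids l \<longrightarrow> f (u, l) - g (u, l) = 0)"
    using c in_I_iff[of "\<lambda>p. f p - g p"] by blast
  also have "\<dots> \<longleftrightarrow> (\<forall>p\<in>NP. f p = g p)"
    using NP_iff out by (metis (no_types, lifting) diff_zero eq_iff_diff_eq_0 surj_pair)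
  finally show ?thesis .
qed

definition restr :: "('v \<times> 'e list \<Rightarrow> 'k) \<Rightarrow> 'v \<times> 'e list \<Rightarrow> 'k" where
  "restr f = (\<lambda>p. if p \<in> NP then f p else 0)"

lemma restr_KK [simp]: "restr f \<in> KK" by (auto simp: restr_def coords_def)

lemma cls_restr: "f \<in> carrier kQ \<Longrightarrow> cls (restr f) = cls f"
  using cls_eq_iff[OF KK_carrier[OF restr_KK]] by (simp add: restr_def)

text \<open>
  The classes of nonzero paths form a basis: each coset contains exactly one element supported on
  nonzero paths, obtained by dropping the coefficients at zero paths.
\<close>

lemma cls_bij: "bij_betw cls KK (carrier A)"
proof -
  have "inj_on cls KK"
  proof (rule inj_onI)
    fix f g assume f: "f \<in> KK" and g: "g \<in> KK" and "cls f = cls g"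
    hence eq: "\<forall>p\<in>NP. f p = g p" using cls_eq_iff[OF KK_carrier[OF f] KK_carrier[OF g]] by simp
    show "f = g"
    proof
      fix p show "f p = g p"
        using eq coords_outside[OF f, of p] coords_outside[OF g, of p] by (cases "p \<in> NP") simp_all
    qed
  qed
  moreover have "cls ` KK = carrier A"
  proof
    show "cls ` KK \<subseteq> carrier A" unfolding A_simps(1) using KK_carrier by (intro image_mono subsetI)
    show "carrier A \<subseteq> cls ` KK"
      unfolding A_simps(1)
    proof (rule image_subsetI)
      fix f assume f: "f \<in> carrier kQ"
      show "cls f \<in> cls ` KK" unfolding cls_restr[OF f, symmetric] by (rule imageI[OF restr_KK])
    qed
  qed
  ultimately show ?thesis by (simp add: bij_betw_def)
qed

lemma cls_add: "f \<in> KK \<Longrightarrow> g \<in> KK \<Longrightarrow> cls f \<oplus>\<^bsub>A\<^esub> cls g = cls (\<lambda>p. f p + g p)"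
  using I.a_rcos_sum[OF KK_carrier KK_carrier] by (simp add: A_simps cls_def)

lemma cls_zero: "\<zero>\<^bsub>A\<^esub> = cls (\<lambda>p. 0)"
  using I.a_rcos_zero[OF ideal_I, of "\<zero>\<^bsub>kQ\<^esub>"] additive_subgroup.zero_closed[OF I.is_additive_subgroup]
  by (simp add: A_simps cls_def)

lemma cls_smult: "f \<in> KK \<Longrightarrow> c \<odot>\<^bsub>A\<^esub> cls f = cls (\<lambda>p. c * f p)"
proof -
  assume f: "f \<in> KK"
  have I_smult: "(\<lambda>p. c * i p) \<in> I" if "i \<in> I" for i
  proof -
    have "i \<in> carrier kQ" "\<forall>u l. avoids l \<longrightarrow> i (u, l) = 0" using that in_I_iff by blast+
    moreover from this have "(\<lambda>p. c * i p) \<in> carrier kQ"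
      by (auto elim: finite_subset[rotated])
    ultimately show ?thesis using in_I_iff[of "\<lambda>p. c * i p"] by auto
  qed
  have "I <+>\<^bsub>kQ\<^esub> (\<lambda>g. c \<odot>\<^bsub>kQ\<^esub> g) ` (I +>\<^bsub>kQ\<^esub> f) = I +>\<^bsub>kQ\<^esub> (\<lambda>p. c * f p)"
  proof
    show "I <+>\<^bsub>kQ\<^esub> (\<lambda>g. c \<odot>\<^bsub>kQ\<^esub> g) ` (I +>\<^bsub>kQ\<^esub> f) \<subseteq> I +>\<^bsub>kQ\<^esub> (\<lambda>p. c * f p)"
    proof
      fix x assume "x \<in> I <+>\<^bsub>kQ\<^esub> (\<lambda>g. c \<odot>\<^bsub>kQ\<^esub> g) ` (I +>\<^bsub>kQ\<^esub> f)"
      then obtain i j where ij: "i \<in> I" "j \<in> I" and x: "x = (\<lambda>p. i p + c * (j p + f p))"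
        by (auto simp: set_add_def' a_r_coset_def')
      have "(\<lambda>p. i p + c * j p) \<in> I"
        using additive_subgroup.a_closed[OF I.is_additive_subgroup ij(1) I_smult[OF ij(2)]] by simp
      moreover have "x = (\<lambda>p. (i p + c * j p) + c * f p)" by (simp add: x algebra_simps)
      ultimately show "x \<in> I +>\<^bsub>kQ\<^esub> (\<lambda>p. c * f p)" by (auto simp: a_r_coset_def')
    qed
    show "I +>\<^bsub>kQ\<^esub> (\<lambda>p. c * f p) \<subseteq> I <+>\<^bsub>kQ\<^esub> (\<lambda>g. c \<odot>\<^bsub>kQ\<^esub> g) ` (I +>\<^bsub>kQ\<^esub> f)"
    proof
      fix x assume "x \<in> I +>\<^bsub>kQ\<^esub> (\<lambda>p. c * f p)"
      then obtain i where i: "i \<in> I" and x: "x = (\<lambda>p. i p + c * f p)" by (auto simp: a_r_coset_def')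
      have "f \<in> I +>\<^bsub>kQ\<^esub> f"
        using additive_subgroup.zero_closed[OF I.is_additive_subgroup] by (force simp: a_r_coset_def')
      thus "x \<in> I <+>\<^bsub>kQ\<^esub> (\<lambda>g. c \<odot>\<^bsub>kQ\<^esub> g) ` (I +>\<^bsub>kQ\<^esub> f)"
        using i by (force simp: x set_add_def')
    qed
  qed
  thus ?thesis by (simp add: A_simps cls_def)
qed

lemma cls_mul: "f \<in> KK \<Longrightarrow> g \<in> KK \<Longrightarrow> cls f \<otimes>\<^bsub>A\<^esub> cls g = cls (mul f g)"
proof -
  assume f: "f \<in> KK" and g: "g \<in> KK"
  note fc = KK_carrier[OF f] and gc = KK_carrier[OF g]
  have "cls f \<otimes>\<^bsub>A\<^esub> cls g = cls (f \<otimes>\<^bsub>kQ\<^esub> g)"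
    using I.rcoset_mult_add[OF fc gc] by (simp add: A_simps cls_def)
  moreover have "(f \<otimes>\<^bsub>kQ\<^esub> g) p = mul f g p" if "p \<in> NP" for p
    using that by (cases p) (simp add: path_algebra_mult mul_def tgt_eq endpoint_def)
  moreover have "f \<otimes>\<^bsub>kQ\<^esub> g \<in> carrier kQ" by (rule I.m_closed[OF fc gc])
  moreover have "mul f g \<in> carrier kQ" by (rule KK_carrier[OF mul_coords])
  ultimately show ?thesis using cls_eq_iff[of "f \<otimes>\<^bsub>kQ\<^esub> g" "mul f g"] by simp
qed

lemma vectorspace_A: "vectorspace class_ring A"
  by (rule vectorspace_by_coordinates[OF finite_NP cls_bij cls_add cls_smult cls_zero])

lemma ring_A: "ring A"
proof -
  have "abelian_group A"
    using vectorspace_A by (simp add: vectorspace_def module_def)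
  moreover have Quot: "ring (kQ Quot I)" by (rule I.quotient_is_ring)
  note quot_simps = bound_quiver_algebra_def quotient_module_def ring.defs module.defs FactRing_def
    ring.simps monoid.simps partial_object.simps
  have "Group.monoid A"
    using ring.is_monoid[OF Quot] unfolding Group.monoid_def quot_simps .
  moreover have "ring_axioms A"
    using Quot[unfolded ring_def, THEN conjunct2, THEN conjunct2] unfolding ring_axioms_def quot_simps .
  ultimately show ?thesis by (simp add: ring_def)
qed

lemma carrier_A_cases: "x \<in> carrier A \<Longrightarrow> \<exists>f\<in>KK. x = cls f"
  using cls_bij by (auto simp: bij_betw_def)

lemma cls_closed [simp]: "f \<in> KK \<Longrightarrow> cls f \<in> carrier A"
  using cls_bij by (auto simp: bij_betw_def)

lemma cls_inject: "f \<in> KK \<Longrightarrow> g \<in> KK \<Longrightarrow> cls f = cls g \<longleftrightarrow> f = g"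
  using cls_bij by (auto simp: bij_betw_def inj_on_eq_iff)

lemma associative_algebra_A: "associative_algebra A"
  unfolding associative_algebra_def associative_algebra_axioms_def
  using ring_A vectorspace_A
  by (auto dest!: carrier_A_cases simp: cls_smult cls_mul coords_smult mul_smult_left mul_smult_right)

sublocale A: associative_algebra A by (rule associative_algebra_A)

lemma cls_uminus: "f \<in> KK \<Longrightarrow> \<ominus>\<^bsub>A\<^esub> cls f = cls (\<lambda>p. - f p)"
  using A.reg.scale_minus_1[of "cls f"] cls_smult[of f "-1"] by (simp add: A.regular_simps)

lemma cls_minus: "f \<in> KK \<Longrightarrow> g \<in> KK \<Longrightarrow> cls f \<ominus>\<^bsub>A\<^esub> cls g = cls (\<lambda>p. f p - g p)"
  using cls_add[of f "\<lambda>p. - g p"] coords_smult[of g NP "-1"] by (simp add: a_minus_def cls_uminus)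

lemma cls_commutator: "f \<in> KK \<Longrightarrow> g \<in> KK \<Longrightarrow> A.commutator (cls f) (cls g) = cls (comm f g)"
  by (simp add: A.commutator_def cls_mul cls_minus comm_def)

definition rep :: "('v \<times> 'e list \<Rightarrow> 'k) set \<Rightarrow> 'v \<times> 'e list \<Rightarrow> 'k" where
  "rep = inv_into KK cls"

lemma rep_cls [simp]: "f \<in> KK \<Longrightarrow> rep (cls f) = f"
  using cls_bij by (simp add: rep_def bij_betw_def inv_into_f_f)

lemma rep_closed [simp]: "x \<in> carrier A \<Longrightarrow> rep x \<in> KK"
  and cls_rep [simp]: "x \<in> carrier A \<Longrightarrow> cls (rep x) = x"
  by (auto dest!: carrier_A_cases)

text \<open>
  The isomorphism between the algebra and the coefficient functions carries derivations to derivations,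
  in both directions.
\<close>

lemma derivation_to_K:
  assumes D: "D \<in> A.derivations"
  shows "derivation (\<lambda>f. rep (D (cls f)))"
proof -
  have c: "D x \<in> carrier A" if "x \<in> carrier A" for x using D that by (auto simp: A.derivations_def)
  have add: "D (x \<oplus>\<^bsub>A\<^esub> y) = D x \<oplus>\<^bsub>A\<^esub> D y" if "x \<in> carrier A" "y \<in> carrier A" for x y
    using D that by (auto simp: A.derivations_def)
  have smult: "D (r \<odot>\<^bsub>A\<^esub> x) = r \<odot>\<^bsub>A\<^esub> D x" if "x \<in> carrier A" for r x
    using D that by (auto simp: A.derivations_def)
  have mult: "D (x \<otimes>\<^bsub>A\<^esub> y) = D x \<otimes>\<^bsub>A\<^esub> y \<oplus>\<^bsub>A\<^esub> x \<otimes>\<^bsub>A\<^esub> D y" if "x \<in> carrier A" "y \<in> carrier A" for x y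
    using D that by (auto simp: A.derivations_def)
  have ex: "\<exists>g\<in>KK. D (cls f) = cls g" if "f \<in> KK" for f using carrier_A_cases[OF c] that by simp
  show ?thesis
    unfolding derivation_def
  proof (intro conjI ballI allI)
    fix f assume f: "f \<in> KK"
    then obtain f' where f': "f' \<in> KK" "D (cls f) = cls f'" using ex by blast
    show "rep (D (cls f)) \<in> KK" using f' by simp
    show "rep (D (cls (\<lambda>p. r * f p))) = (\<lambda>p. r * rep (D (cls f)) p)" for r
      using smult[of "cls f" r] f f' by (simp add: cls_smult coords_smult)
    fix g assume g: "g \<in> KK"
    then obtain g' where g': "g' \<in> KK" "D (cls g) = cls g'" using ex by blast
    show "rep (D (cls (\<lambda>p. f p + g p))) = (\<lambda>p. rep (D (cls f)) p + rep (D (cls g)) p)"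
      using add[of "cls f" "cls g"] f f' g g' by (simp add: cls_add coords_add)
    show "rep (D (cls (mul f g))) = (\<lambda>p. mul (rep (D (cls f))) g p + mul f (rep (D (cls g))) p)"
      using mult[of "cls f" "cls g"] f f' g g' by (simp add: cls_add cls_mul coords_add)
  qed
qed

lemma derivation_from_K:
  assumes D: "derivation D"
  shows "(\<lambda>x. cls (D (rep x))) \<in> A.derivations"
  unfolding A.derivations_def
  using derivationD[OF D]
  by (auto dest!: carrier_A_cases simp: cls_add cls_smult cls_mul coords_add coords_smult)

section \<open>The combinatorial counts\<close>

lemma left_ann_iff: "(u, l) \<in> NP \<Longrightarrow>
    \<not> (\<exists>\<beta>\<in>arcs Q. head Q \<beta> = src (u, l) \<and> path_elem (tail Q \<beta>, \<beta> # snd (u, l)) \<notin> I) \<longleftrightarrow> left_maximal (u, l)"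
proof -
  assume "(u, l) \<in> NP"
  hence p: "(u, l) \<in> paths Q" using NP_iff by blast
  have "path_elem (tail Q b, b # l) \<notin> I \<longleftrightarrow> (tail Q b, b # l) \<in> NP" if "b \<in> arcs Q" "head Q b = u" for b
    using p that by (intro path_elem_notin_iff) (simp add: paths_Cons)
  thus ?thesis unfolding left_maximal_def src_def fst_conv snd_conv by blast
qed

lemma right_ann_iff: "(u, l) \<in> NP \<Longrightarrow>
    \<not> (\<exists>\<beta>\<in>arcs Q. tail Q \<beta> = tgt Q (u, l) \<and> path_elem (src (u, l), snd (u, l) @ [\<beta>]) \<notin> I) \<longleftrightarrow> right_maximal (u, l)"
proof -
  assume "(u, l) \<in> NP"
  hence p: "(u, l) \<in> paths Q" using NP_iff by blast
  have "path_elem (u, l @ [b]) \<notin> I \<longleftrightarrow> (u, l @ [b]) \<in> NP" if "b \<in> arcs Q" "tail Q b = tgt Q (u, l)" for b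
    using p that by (intro path_elem_notin_iff) (simp add: paths_append paths_Cons paths_Nil)
  moreover have "tgt Q (u, l) = endpoint u l" by (simp add: tgt_eq endpoint_def)
  ultimately show ?thesis unfolding right_maximal_def src_def fst_conv snd_conv by auto
qed

lemma both_ann_iff:
  assumes "(\<rho>, \<gamma>) \<in> S \<Longrightarrow> \<gamma> \<in> NP"
  shows "(\<rho>, \<gamma>) \<in> both_ann Q I S \<longleftrightarrow> (\<rho>, \<gamma>) \<in> S \<and> left_maximal \<gamma> \<and> right_maximal \<gamma>"
  using left_ann_iff[of "fst \<gamma>" "snd \<gamma>"] right_ann_iff[of "fst \<gamma>" "snd \<gamma>"] assms
  unfolding both_ann_def left_ann_def right_ann_def prod.collapse by blast

lemma card_central_cycles:
  "card (both_ann Q I (parallel Q (trivial_paths Q) (nonzero_paths_ge Q I 1))) = card central_cycles"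
proof -
  let ?S = "parallel Q (trivial_paths Q) (nonzero_paths_ge Q I 1)"
  have S: "(\<rho>, \<gamma>) \<in> ?S \<longleftrightarrow> \<gamma> \<in> NP \<and> snd \<gamma> \<noteq> [] \<and> endpoint (fst \<gamma>) (snd \<gamma>) = fst \<gamma> \<and> \<rho> = (fst \<gamma>, [])" for \<rho> \<gamma>
  proof -
    obtain x k u l where eq: "\<rho> = (x, k)" "\<gamma> = (u, l)" by (cases \<rho>, cases \<gamma>)
    have "u \<in> verts Q" if "(u, l) \<in> NP" using that by (simp add: NP_def)
    moreover have "\<gamma> \<in> nonzero_paths_ge Q I 1 \<longleftrightarrow> (u, l) \<in> NP \<and> l \<noteq> []"
      by (cases l) (simp_all add: nonzero_paths_ge_def nonzero_paths_eq eq)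
    moreover have "\<rho> \<in> trivial_paths Q \<longleftrightarrow> k = [] \<and> x \<in> verts Q"
      by (cases k) (simp_all add: trivial_paths_def eq paths_Nil)
    moreover have "tgt Q \<gamma> = endpoint u l" by (simp add: tgt_eq endpoint_def eq)
    moreover have "tgt Q \<rho> = x" if "k = []" using that by (simp add: tgt_eq eq)
    moreover have "src \<rho> = x" "src \<gamma> = u" by (simp_all add: src_def eq)
    moreover have "(\<rho>, \<gamma>) \<in> ?S \<longleftrightarrow> \<rho> \<in> trivial_paths Q \<and> \<gamma> \<in> nonzero_paths_ge Q I 1 \<and>
        src \<rho> = src \<gamma> \<and> tgt Q \<rho> = tgt Q \<gamma>"
      by (simp add: parallel_def)
    moreover have "\<rho> = (u, []) \<longleftrightarrow> x = u \<and> k = []" "fst \<gamma> = u" "snd \<gamma> = l" "\<gamma> \<in> NP \<longleftrightarrow> (u, l) \<in> NP"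
      by (simp_all add: eq)
    ultimately show ?thesis by metis
  qed
  have mem: "(\<rho>, \<gamma>) \<in> both_ann Q I ?S \<longleftrightarrow> \<gamma> \<in> central_cycles \<and> \<rho> = (fst \<gamma>, [])" for \<rho> \<gamma>
  proof -
    have "(\<rho>, \<gamma>) \<in> both_ann Q I ?S \<longleftrightarrow> (\<rho>, \<gamma>) \<in> ?S \<and> left_maximal \<gamma> \<and> right_maximal \<gamma>"
      by (rule both_ann_iff) (simp only: S)
    thus ?thesis unfolding S central_cycles_def by blast
  qed
  have "both_ann Q I ?S = (\<lambda>\<gamma>. ((fst \<gamma>, []), \<gamma>)) ` central_cycles"
  proof (rule Set.set_eqI)
    fix x :: "('v, 'e) path \<times> ('v, 'e) path"
    obtain \<rho> \<gamma> where x: "x = (\<rho>, \<gamma>)" by (cases x)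
    show "x \<in> both_ann Q I ?S \<longleftrightarrow> x \<in> (\<lambda>\<gamma>. ((fst \<gamma>, []), \<gamma>)) ` central_cycles"
      unfolding x mem by (auto simp: image_iff)
  qed
  thus ?thesis by (simp add: card_image inj_on_def)
qed

lemma arrow_paths_eq: "arrow_paths Q = (\<lambda>a. (tail Q a, [a])) ` arcs Q"
proof -
  have "(u, l) \<in> arrow_paths Q \<longleftrightarrow> (u, l) \<in> (\<lambda>a. (tail Q a, [a])) ` arcs Q" for u l
    by (auto simp: arrow_paths_def paths_Cons paths_Nil length_Suc_conv image_iff)
  thus ?thesis by auto
qed

lemma card_parallel_index: "card (both_ann Q I (zero_zero_1 Q I)) = card parallel_index"
proof -
  let ?S = "zero_zero_1 Q I" and ?f = "\<lambda>(a, \<gamma>). ((tail Q a, [a]), \<gamma>)"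
  have S: "(\<rho>, \<gamma>) \<in> ?S \<longleftrightarrow> (\<exists>a\<in>arcs Q. \<rho> = (tail Q a, [a]) \<and> \<gamma> \<in> NP \<and> fst \<gamma> = tail Q a \<and>
      endpoint (fst \<gamma>) (snd \<gamma>) = head Q a \<and> \<not> (\<exists>r. snd \<gamma> = a # r) \<and> \<not> (\<exists>r. snd \<gamma> = r @ [a]))" for \<rho> \<gamma>
  proof -
    have "(\<rho>, \<gamma>) \<in> ?S \<longleftrightarrow> \<rho> \<in> arrow_paths Q \<and> \<gamma> \<in> NP \<and> src \<rho> = src \<gamma> \<and> tgt Q \<rho> = tgt Q \<gamma> \<and>
       \<not> (\<exists>r. snd \<gamma> = snd \<rho> @ r) \<and> \<not> (\<exists>r. snd \<gamma> = r @ snd \<rho>)"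
      by (simp add: zero_zero_1_def parallel_def nonzero_paths_eq)
    moreover have "tgt Q \<gamma> = endpoint (fst \<gamma>) (snd \<gamma>)" "src \<gamma> = fst \<gamma>"
      by (cases \<gamma>, simp add: tgt_eq endpoint_def src_def)+
    moreover have "\<rho> \<in> arrow_paths Q \<longleftrightarrow> (\<exists>a\<in>arcs Q. \<rho> = (tail Q a, [a]))"
      by (simp add: arrow_paths_eq image_iff)
    moreover have "src (tail Q a, [a]) = tail Q a" "tgt Q (tail Q a, [a]) = head Q a"
      "snd (tail Q a, [a]) @ r = a # r" "r @ snd (tail Q a, [a]) = r @ [a]" for a r
      by (simp_all add: src_def tgt_eq)
    ultimately show ?thesis by metis
  qed
  have mem: "(\<rho>, \<gamma>) \<in> both_ann Q I ?S \<longleftrightarrow> (\<exists>a. \<rho> = (tail Q a, [a]) \<and> (a, \<gamma>) \<in> parallel_index)" for \<rho> \<gamma>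
  proof -
    have "(\<rho>, \<gamma>) \<in> both_ann Q I ?S \<longleftrightarrow> (\<rho>, \<gamma>) \<in> ?S \<and> left_maximal \<gamma> \<and> right_maximal \<gamma>"
      by (rule both_ann_iff) (auto simp only: S)
    also have "\<dots> \<longleftrightarrow> (\<exists>a. \<rho> = (tail Q a, [a]) \<and> (a, \<gamma>) \<in> parallel_index)"
      unfolding S parallel_index_def mem_Collect_eq case_prod_conv by blast
    finally show ?thesis .
  qed
  have "both_ann Q I ?S = ?f ` parallel_index"
  proof (rule Set.set_eqI)
    fix x :: "('v, 'e) path \<times> ('v, 'e) path"
    obtain \<rho> \<gamma> where x: "x = (\<rho>, \<gamma>)" by (cases x)
    show "x \<in> both_ann Q I ?S \<longleftrightarrow> x \<in> ?f ` parallel_index"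
      unfolding x mem by (force simp: image_iff)
  qed
  moreover have "inj_on ?f parallel_index" by (auto simp: inj_on_def)
  ultimately show ?thesis by (simp add: card_image)
qed

lemma arrows_in_iff: "a \<in> arcs Q \<Longrightarrow> b \<in> arcs Q \<Longrightarrow> arrows_in Q I a b \<longleftrightarrow> head Q a = tail Q b \<and> \<not> ok a b"
  by (auto simp: arrows_in_def ok_def arrows_notin_def)

lemma card_gentle_index: "card (gentle_pairs_1 Q I) = card gentle_index"
proof -
  let ?f = "\<lambda>(a, \<gamma>). ((tail Q a, [a]), \<gamma>)"
  have "gentle_pairs_1 Q I = ?f ` gentle_index"
    unfolding gentle_pairs_1_def gentle_index_def
    using not_ok_self by (auto simp: arrows_in_iff image_iff) metis+
  moreover have "inj_on ?f gentle_index" by (auto simp: inj_on_def)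
  ultimately show ?thesis by (simp add: card_image)
qed

end

lemma two_eq_zero_iff_char: "(2 :: 'k::field) = 0 \<longleftrightarrow> CHAR('k) = 2"
proof
  assume "(2 :: 'k) = 0"
  hence "of_nat 2 = (0 :: 'k)" by simp
  hence "CHAR('k) dvd 2" by (simp only: of_nat_eq_0_iff_char_dvd)
  moreover have "CHAR('k) \<noteq> 1" by simp
  ultimately show "CHAR('k) = 2" using two_is_prime_nat prime_nat_iff by blast
next
  assume "CHAR('k) = 2"
  hence "of_nat 2 = (0 :: 'k)" using of_nat_CHAR[where 'a = 'k] by simp
  thus "(2 :: 'k) = 0" by simp
qed

section \<open>Hochschild cohomology of a quadratic string algebra\<close>

context quadratic_string_algebra
begin

lemma dim_HH0_central_cycles:
  assumes "projective_resolution A (regular_bimodule A) P d \<epsilon>"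
  shows "vectorspace.fin_dim class_ring (HH A P d 0) \<and>
    vectorspace.dim class_ring (HH A P d 0) = card central_cycles + 1"
proof -
  interpret hochschild_resolution A P d \<epsilon>
    by (intro hochschild_resolution.intro associative_algebra_A hochschild_resolution_axioms.intro assms)
  let ?\<zeta> = "\<lambda>c :: ('v \<times> 'e list) option \<Rightarrow> 'k. cls (central_elem c)"
  have fin: "finite central_cycles"
    by (rule finite_subset[OF _ finite_NP]) (auto simp: central_cycles_def)
  have centre: "?\<zeta> ` coords central_index = A.centre"
  proof
    show "?\<zeta> ` coords central_index \<subseteq> A.centre"
    proof (rule image_subsetI)
      fix c :: "('v \<times> 'e list) option \<Rightarrow> 'k"
      have "a \<otimes>\<^bsub>A\<^esub> ?\<zeta> c = ?\<zeta> c \<otimes>\<^bsub>A\<^esub> a" if a: "a \<in> carrier A" for a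
      proof -
        obtain f where f: "f \<in> KK" "a = cls f" using carrier_A_cases[OF a] by blast
        show ?thesis
          by (simp add: f(2) cls_mul[OF f(1) central_elem_coords] cls_mul[OF central_elem_coords f(1)]
              central_elem_commutes[OF f(1)])
      qed
      thus "?\<zeta> c \<in> A.centre" unfolding A.centre_def using cls_closed[OF central_elem_coords] by blast
    qed
    show "A.centre \<subseteq> ?\<zeta> ` coords central_index"
    proof
      fix z assume "z \<in> A.centre"
      hence z: "z \<in> carrier A" and zc: "\<And>a. a \<in> carrier A \<Longrightarrow> a \<otimes>\<^bsub>A\<^esub> z = z \<otimes>\<^bsub>A\<^esub> a"
        unfolding A.centre_def by blast+
      obtain g where g: "g \<in> KK" "z = cls g" using carrier_A_cases[OF z] by blast
      have "mul f g = mul g f" if f: "f \<in> KK" for f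
      proof -
        have "cls (mul f g) = cls (mul g f)"
          using zc[OF cls_closed[OF f]] by (simp add: g(2) cls_mul[OF f g(1)] cls_mul[OF g(1) f])
        thus ?thesis using cls_inject[OF mul_coords mul_coords] by simp
      qed
      then obtain c where "c \<in> coords central_index" "g = central_elem c"
        using central_elem_surj[OF g(1)] by blast
      thus "z \<in> ?\<zeta> ` coords central_index" using g(2) by blast
    qed
  qed
  have card: "card (central_index :: ('v \<times> 'e list) option set) = card central_cycles + 1"
    using fin by (simp add: card_image)
  have fin_index: "finite central_index" using fin by simp
  have add: "?\<zeta> (\<lambda>s. c s + c' s) = ?\<zeta> c \<oplus>\<^bsub>A\<^esub> ?\<zeta> c'" for c c'
  proof -
    have "central_elem (\<lambda>s. c s + c' s) = (\<lambda>p. central_elem c p + central_elem c' p)"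
      by (auto simp: central_elem_def)
    thus ?thesis by (simp add: cls_add[OF central_elem_coords central_elem_coords])
  qed
  have smult: "?\<zeta> (\<lambda>s. r * c s) = r \<odot>\<^bsub>A\<^esub> ?\<zeta> c" for r c
  proof -
    have "central_elem (\<lambda>s. r * c s) = (\<lambda>p. r * central_elem c p)" by (auto simp: central_elem_def)
    thus ?thesis by (simp add: cls_smult[OF central_elem_coords])
  qed
  have inj: "c = (\<lambda>s. 0)" if c: "c \<in> coords central_index" "?\<zeta> c = \<zero>\<^bsub>A\<^esub>" for c
  proof -
    have "central_elem c = (\<lambda>p. 0)"
      using c(2) cls_inject[OF central_elem_coords coords_zero] by (simp add: cls_zero)
    thus ?thesis using central_elem_inj[OF c(1)] by simp
  qed
  show ?thesis
    unfolding card[symmetric] using dim_HH0[where \<zeta> = ?\<zeta>, OF fin_index centre add smult inj] by (rule conjI)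
qed

lemma dim_HH1_outer_index:
  assumes "projective_resolution A (regular_bimodule A) P d \<epsilon>"
    and T: "T \<subseteq> arcs Q"
    and potential: "\<And>c :: 'e \<Rightarrow> 'k. \<exists>v. \<forall>a\<in>T. v (head Q a) - v (tail Q a) = c a"
    and const: "\<And>v :: 'v \<Rightarrow> 'k. \<forall>a\<in>T. v (head Q a) = v (tail Q a) \<Longrightarrow> \<exists>k. \<forall>x\<in>verts Q. v x = k"
  shows "vectorspace.fin_dim class_ring (HH A P d 1) \<and>
    vectorspace.dim class_ring (HH A P d 1) = card (outer_index T ((2 :: 'k) = 0))"
proof -
  interpret hochschild_resolution A P d \<epsilon>
    by (intro hochschild_resolution.intro associative_algebra_A hochschild_resolution_axioms.intro assms)
  let ?S = "outer_index T ((2 :: 'k) = 0)"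
  let ?\<Delta> = "\<lambda>(c :: 'e \<times> 'v \<times> 'e list \<Rightarrow> 'k) x. cls (extension c (rep x))"
  have fin: "finite ?S" using finite_indices by (simp add: outer_index_def)
  have derivation: "?\<Delta> c \<in> A.derivations" if "c \<in> coords ?S" for c
    by (rule derivation_from_K[OF derivation_extension[OF outer_index_extendable[OF that]]])
  have add: "?\<Delta> (\<lambda>s. c s + c' s) x = ?\<Delta> c x \<oplus>\<^bsub>A\<^esub> ?\<Delta> c' x" for c c' x
    by (simp add: extension_add_values cls_add)
  have smult: "?\<Delta> (\<lambda>s. r * c s) x = r \<odot>\<^bsub>A\<^esub> ?\<Delta> c x" for r c x
    by (simp add: extension_smult_values cls_smult)
  have total: "\<exists>c\<in>coords ?S. \<exists>u\<in>carrier A. \<forall>x\<in>carrier A. D x = ?\<Delta> c x \<oplus>\<^bsub>A\<^esub> A.commutator x u"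
    if D: "D \<in> A.derivations" for D
  proof -
    obtain c u where c: "c \<in> coords ?S" and u: "u \<in> KK"
      and eq: "\<And>f. f \<in> KK \<Longrightarrow> rep (D (cls f)) = (\<lambda>p. extension c f p + comm f u p)"
      using derivation_decomposition[OF derivation_to_K[OF D] T potential] by blast
    have "D x = ?\<Delta> c x \<oplus>\<^bsub>A\<^esub> A.commutator x (cls u)" if x: "x \<in> carrier A" for x
    proof -
      obtain f where f: "f \<in> KK" "x = cls f" using carrier_A_cases[OF x] by blast
      have "D x \<in> carrier A" using D x by (auto simp: A.derivations_def)
      hence "D x = cls (rep (D x))" by simp
      also have "\<dots> = cls (extension c f) \<oplus>\<^bsub>A\<^esub> cls (comm f u)"
        using eq[OF f(1)] f(2) by (simp add: cls_add)
      finally show ?thesis using f u by (simp add: cls_commutator)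
    qed
    thus ?thesis using c cls_closed[OF u] by blast
  qed
  have inner: "c = (\<lambda>s. 0)"
    if c: "c \<in> coords ?S" and u: "u \<in> carrier A"
      and inner: "\<And>x. x \<in> carrier A \<Longrightarrow> ?\<Delta> c x = A.commutator x u" for c u
  proof (rule outer_derivation_unique[OF c T const])
    obtain g where g: "g \<in> KK" "u = cls g" using carrier_A_cases[OF u] by blast
    show "extension c f = comm f (rep u)" if f: "f \<in> KK" for f
    proof -
      have "cls (extension c f) = cls (comm f g)"
        using inner[OF cls_closed[OF f]] f g by (simp add: cls_commutator)
      thus ?thesis using cls_inject[OF extension_coords comm_coords] g by simp
    qed
  qed blast
  show ?thesis
    using dim_HH1[where \<Delta> = ?\<Delta>, OF fin derivation add smult total inner] by (rule conjI)
qed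

end

theorem theorem3p13:
  fixes Q :: "('v, 'e) pre_digraph"
    and I :: "(('v, 'e) path \<Rightarrow> 'k::alg_closed_field) set"
    and A :: "('k, (('v, 'e) path \<Rightarrow> 'k) set) module"
    and P :: "nat \<Rightarrow> ('k, (('v, 'e) path \<Rightarrow> 'k) set, 'm) bimodule"
    and d :: "nat \<Rightarrow> 'm \<Rightarrow> 'm"
    and \<epsilon> :: "'m \<Rightarrow> (('v, 'e) path \<Rightarrow> 'k) set"
  assumes "quadratic_string Q I"
    and "A = bound_quiver_algebra Q I"
    and "projective_resolution A (regular_bimodule A) P d \<epsilon>"
  shows "vectorspace.fin_dim class_ring (HH A P d 0) \<and>
         vectorspace.dim class_ring (HH A P d 0) =
           card (both_ann Q I (parallel Q (trivial_paths Q) (nonzero_paths_ge Q I 1))) + 1 \<and>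
         vectorspace.fin_dim class_ring (HH A P d 1) \<and>
         (CHAR('k) \<noteq> 2 \<longrightarrow>
           int (vectorspace.dim class_ring (HH A P d 1)) =
             int (card (both_ann Q I (zero_zero_1 Q I))) + int (card (arcs Q)) - int (card (verts Q)) + 1) \<and>
         (CHAR('k) = 2 \<longrightarrow>
           int (vectorspace.dim class_ring (HH A P d 1)) =
             int (card (both_ann Q I (zero_zero_1 Q I))) + int (card (arcs Q)) - int (card (verts Q)) + 1
               + int (card (gentle_pairs_1 Q I)))"
proof -
  interpret quadratic_string_algebra Q I by (rule quadratic_string_algebra.intro) fact
  have res: "projective_resolution (bound_quiver_algebra Q I) (regular_bimodule (bound_quiver_algebra Q I)) P d \<epsilon>"
    using assms(3) unfolding assms(2) .
  obtain T where T: "T \<subseteq> arcs Q" "card T + 1 = card (verts Q)"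
    and potential: "\<And>c :: 'e \<Rightarrow> 'k. \<exists>v. \<forall>a\<in>T. v (head Q a) - v (tail Q a) = c a"
    and const: "\<And>v :: 'v \<Rightarrow> 'k. \<forall>a\<in>T. v (head Q a) = v (tail Q a) \<Longrightarrow> \<exists>k. \<forall>x\<in>verts Q. v x = k"
  proof -
    obtain T where "T \<subseteq> arcs Q \<and> card T + 1 = card (verts Q) \<and>
      (\<forall>c :: 'e \<Rightarrow> 'k. \<exists>v. \<forall>a\<in>T. v (head Q a) - v (tail Q a) = c a) \<and>
      (\<forall>v :: 'v \<Rightarrow> 'k. (\<forall>a\<in>T. v (head Q a) = v (tail Q a)) \<longrightarrow> (\<exists>k. \<forall>x\<in>verts Q. v x = k))"
      using spanning_tree_potential[OF fin_digraph_axioms connected, where 'k = 'k] by (rule exE)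
    note t = this
    show thesis
      by (rule that[OF t[THEN conjunct1] t[THEN conjunct2, THEN conjunct1]
          t[THEN conjunct2, THEN conjunct2, THEN conjunct1, THEN spec]
          t[THEN conjunct2, THEN conjunct2, THEN conjunct2, THEN spec, THEN mp]])
  qed
  note HH0 = dim_HH0_central_cycles[OF res]
  note HH1 = dim_HH1_outer_index[OF res T(1) potential const]
  show ?thesis
    unfolding assms(2) card_central_cycles card_parallel_index card_gentle_index
    using HH0 HH1 card_outer_index[OF T, of "(2 :: 'k) = 0"] two_eq_zero_iff_char[where 'k = 'k]
    by (cases "CHAR('k) = 2") simp_all
qed

end
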